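(* Let $(B_t)_{t\ge0}$ be an order invariant quantum Lévy process. Then there exist constants $c(\sigma)$ for all $\sigma\in\bigcup_{n\in\mathbb{N}}\mathcal{O}(n)$ such that for all $n\in\mathbb{N}$ and all $t\ge0$ $$\varphi(B_t^n)=\sum_{\sigma\in\mathcal{O}(n)}\frac1{|\sigma|!}\,c(\sigma)\,t^{|\sigma|}.$$
   Context: Intervals: $\mathcal{I}$ is the set of all $I=[s,t)$ with $-\infty<s<t<\infty$; $I+u=[s+u,t+u)$; $I<J$ means $s<t$ for all $s\in I$, $t\in J$. $\mathbb{N}=\{1,2,\dots\}$. Continuous Bernoulli system: $(\mathcal{A},\varphi,(\mathcal{A}_I)_{I\in\mathcal{I}})$ where $\mathcal{A}$ is a von Neumann algebra with separable predual, $\varphi$ is a faithful normal tracial state on $\mathcal{A}$, and $\mathcal{A}_I\subset\mathcal{A}$ are von Neumann subalgebras with (a) $\mathcal{A}=\bigvee\{\mathcal{A}_I: I\in\mathcal{I}\}$; (b) $\mathcal{A}_I\subset\mathcal{A}_J$ whenever $I\subset J$; (c) $\varphi(ab)=\varphi(a)\varphi(b)$ for $a\in\mathcal{A}_I$, $b\in\mathcal{A}_J$ whenever $I\cap J=\emptyset$. $L^p(\mathcal{A})$ ($1\le p<\infty$) is the completion of $\mathcal{A}$ in $\|x\|_p=\varphi(|x|^p)^{1/p}$, and $L^{\infty-}(\mathcal{A})=\bigcap_{1\le p<\infty}L^p(\mathcal{A})$; $\varphi$ is extended to $L^1(\mathcal{A})$. A flow is a family $(B_I)_{I\in\mathcal{I}}\subset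 L^{\infty-}(\mathcal{A})$ such that (i) $(s,t)\mapsto B_{[s,t)}\in L^p(\mathcal{A})$ is jointly continuous for all $1\le p<\infty$; (ii) $B_I\in L^{\infty-}(\mathcal{A}_I)$ for all $I$; (iii) $B_{[s,u)}=B_{[s,t)}+B_{[t,u)}$ for $s<t<u$. It is stationary if $\varphi(B_{I_1+t}\cdots B_{I_n+t})$ does not depend on $t\in\mathbb{R}$, for all $n$ and $I_1,\dots,I_n\in\mathcal{I}$; the quantum Lévy process of a stationary flow is $B_t:=B_{[0,t)}$ ($t>0$), $B_0:=0$. A flow (or its quantum Lévy process) is order invariant if for all $n$ and all $I_1,\dots,I_n\in\mathcal{I}$ such that any two $I_k,I_l$ are either equal or disjoint, $\varphi(B_{I_1}\cdots B_{I_n})=\varphi(B_{I_1+t_1}\cdots B_{I_n+t_n})$ for all $t_1,\dots,t_n\in\mathbb{R}$ such that, for all $k,l$, $I_k=I_l$ implies $t_k=t_l$ and $I_k<I_l$ implies $I_k+t_k<I_l+t_l$. An order invariant flow is in particular stationary. Two $n$-tuples $\mathbf{i},\mathbf{j}:\{1,\dots,n\}\to\mathbb{N}$ are order equivalent if $i(k)\le i(l)\Leftrightarrow j(k)\le j(l)$ for all $k,l$. $\mathcal{O}(n)$ is the (finite) set of order equivalence classes, and for $\sigma\in\mathcal{O}(n)$, $|\sigma|$ is the number of distinct values taken by any $\mathbf{i}\in\sigma$. *)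

theory Defs
  imports "HOL-Analysis.Analysis"
begin

section \<open>Complex Banach and Hilbert spaces\<close>

class complex_banach = banach +
  fixes scaleC :: "complex \<Rightarrow> 'a \<Rightarrow> 'a"  (infixr "*\<^sub>C" 75)
  assumes scaleC_add_right: "c *\<^sub>C (x + y) = c *\<^sub>C x + c *\<^sub>C y"
    and scaleC_add_left: "(c + d) *\<^sub>C x = c *\<^sub>C x + d *\<^sub>C x"
    and scaleC_scaleC: "c *\<^sub>C d *\<^sub>C x = (c * d) *\<^sub>C x"
    and scaleC_of_real: "of_real r *\<^sub>C x = r *\<^sub>R x"
    and norm_scaleC: "norm (c *\<^sub>C x) = cmod c * norm x"

text \<open>The inner product is linear in the second and conjugate-linear in the first argument.\<close>

class complex_hilbert = complex_banach +
  fixes cinner :: "'a \<Rightarrow> 'a \<Rightarrow> complex"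
  assumes cinner_commute: "cinner x y = cnj (cinner y x)"
    and cinner_add_right: "cinner x (y + z) = cinner x y + cinner x z"
    and cinner_scaleC_right: "cinner x (c *\<^sub>C y) = c * cinner x y"
    and cinner_self: "cinner x x = of_real ((norm x)\<^sup>2)"

lemma bounded_linear_scaleC: "bounded_linear (\<lambda>x::'a::complex_banach. c *\<^sub>C x)"
proof (rule bounded_linear_intro[where K = "cmod c"])
  fix x y :: 'a and r :: real
  show "c *\<^sub>C (x + y) = c *\<^sub>C x + c *\<^sub>C y" by (rule scaleC_add_right)
  show "c *\<^sub>C (r *\<^sub>R x) = r *\<^sub>R c *\<^sub>C x"
    by (simp add: scaleC_scaleC mult.commute flip: scaleC_of_real)
  show "norm (c *\<^sub>C x) \<le> norm x * cmod c" by (simp add: norm_scaleC)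
qed

instantiation blinfun :: (real_normed_vector, complex_banach) complex_banach
begin

definition scaleC_blinfun :: "complex \<Rightarrow> ('a \<Rightarrow>\<^sub>L 'b) \<Rightarrow> ('a \<Rightarrow>\<^sub>L 'b)" where
  "scaleC_blinfun c x = Blinfun (\<lambda>\<xi>. c *\<^sub>C blinfun_apply x \<xi>)"

lemma blinfun_apply_scaleC: "blinfun_apply (c *\<^sub>C x) \<xi> = c *\<^sub>C blinfun_apply x \<xi>"
  unfolding scaleC_blinfun_def
  by (rule bounded_linear_Blinfun_apply[THEN fun_cong])
     (rule bounded_linear_compose[OF bounded_linear_scaleC blinfun.bounded_linear_right])

instance
proof
  fix c d :: complex and r :: real and x y :: "'a \<Rightarrow>\<^sub>L 'b"
  show "c *\<^sub>C (x + y) = c *\<^sub>C x + c *\<^sub>C y"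
    by (rule blinfun_eqI) (simp add: blinfun_apply_scaleC blinfun.add_left scaleC_add_right)
  show "(c + d) *\<^sub>C x = c *\<^sub>C x + d *\<^sub>C x"
    by (rule blinfun_eqI) (simp add: blinfun_apply_scaleC blinfun.add_left scaleC_add_left)
  show "c *\<^sub>C d *\<^sub>C x = (c * d) *\<^sub>C x"
    by (rule blinfun_eqI) (simp add: blinfun_apply_scaleC scaleC_scaleC)
  show "of_real r *\<^sub>C x = r *\<^sub>R x"
    by (rule blinfun_eqI) (simp add: blinfun_apply_scaleC blinfun.scaleR_left scaleC_of_real)
  have le: "norm (a *\<^sub>C z) \<le> cmod a * norm z" for a and z :: "'a \<Rightarrow>\<^sub>L 'b"
    by (rule norm_blinfun_bound)
       (auto simp: blinfun_apply_scaleC norm_scaleC mult.assoc intro!: mult_left_mono norm_blinfun)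
  show "norm (c *\<^sub>C x) = cmod c * norm x"
  proof (cases "c = 0")
    case True
    then show ?thesis using le[of 0 x] by simp
  next
    case False
    have one: "inverse c *\<^sub>C c *\<^sub>C x = x"
      using False scaleC_of_real[of 1]
      by (intro blinfun_eqI) (simp add: blinfun_apply_scaleC scaleC_scaleC)
    have "norm x \<le> cmod (inverse c) * norm (c *\<^sub>C x)"
      using le[of "inverse c" "c *\<^sub>C x"] one by simp
    then have "cmod c * norm x \<le> norm (c *\<^sub>C x)"
      using False by (simp add: norm_inverse norm_divide field_simps)
    then show ?thesis using le[of c x] by simp
  qed
qed

end


section \<open>Von Neumann algebras\<close>

text \<open>Elements of this type are only real-linear; complex linearity is imposed by
  \<open>clinear_ops\<close>. The real operator norm of a complex-linear operator is its usual norm.\<close>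

type_synonym 'h op = "'h \<Rightarrow>\<^sub>L 'h"

definition clinear_ops :: "'h::complex_hilbert op set" where
  "clinear_ops = {x. \<forall>c \<xi>. blinfun_apply x (c *\<^sub>C \<xi>) = c *\<^sub>C blinfun_apply x \<xi>}"

definition is_adjoint :: "'h::complex_hilbert op \<Rightarrow> 'h op \<Rightarrow> bool" where
  "is_adjoint y x \<longleftrightarrow>
     (\<forall>\<xi> \<eta>. cinner (blinfun_apply y \<xi>) \<eta> = cinner \<xi> (blinfun_apply x \<eta>))"

definition adj :: "'h::complex_hilbert op \<Rightarrow> 'h op" where
  "adj x = (THE y. is_adjoint y x)"

definition commutant :: "'h::complex_hilbert op set \<Rightarrow> 'h op set" where
  "commutant S = {y \<in> clinear_ops. \<forall>x\<in>S. x o\<^sub>L y = y o\<^sub>L x}"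

text \<open>All von Neumann algebras contain the identity operator of the underlying Hilbert space.\<close>

definition von_neumann_algebra :: "'h::complex_hilbert op set \<Rightarrow> bool" where
  "von_neumann_algebra M \<longleftrightarrow>
     M \<subseteq> clinear_ops \<and> (\<forall>x\<in>M. \<exists>y\<in>M. is_adjoint y x) \<and> commutant (commutant M) = M"

text \<open>The ultraweakly continuous linear functionals on \<open>M\<close>. A functional is a total
  function of which only the restriction to \<open>M\<close> matters.\<close>

definition predual :: "'h::complex_hilbert op set \<Rightarrow> ('h op \<Rightarrow> complex) set" where
  "predual M = {\<omega>. \<exists>\<xi> \<eta> :: nat \<Rightarrow> 'h.
     summable (\<lambda>k. (norm (\<xi> k))\<^sup>2) \<and> summable (\<lambda>k. (norm (\<eta> k))\<^sup>2) \<and>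
     (\<forall>x\<in>M. (\<lambda>k. cinner (\<xi> k) (blinfun_apply x (\<eta> k))) sums \<omega> x)}"

text \<open>Separability is with respect to the norm of functionals on \<open>M\<close>.\<close>

definition separable_predual :: "'h::complex_hilbert op set \<Rightarrow> bool" where
  "separable_predual M \<longleftrightarrow>
     (\<exists>D \<subseteq> predual M. countable D \<and>
        (\<forall>\<omega>\<in>predual M. \<forall>e>0. \<exists>\<omega>'\<in>D. \<forall>x\<in>M. cmod (\<omega> x - \<omega>' x) \<le> e * norm x))"

definition clinear_on :: "'h::complex_hilbert op set \<Rightarrow> ('h op \<Rightarrow> complex) \<Rightarrow> bool" where
  "clinear_on M \<phi> \<longleftrightarrow>
     (\<forall>x\<in>M. \<forall>y\<in>M. \<phi> (x + y) = \<phi> x + \<phi> y) \<and> (\<forall>c. \<forall>x\<in>M. \<phi> (c *\<^sub>C x) = c * \<phi> x)"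

definition faithful_normal_tracial_state ::
    "'h::complex_hilbert op set \<Rightarrow> ('h op \<Rightarrow> complex) \<Rightarrow> bool" where
  "faithful_normal_tracial_state M \<phi> \<longleftrightarrow>
     clinear_on M \<phi> \<and>
     (\<forall>x\<in>M. \<phi> (adj x o\<^sub>L x) \<in> \<real>\<^sub>\<ge>\<^sub>0) \<and>
     \<phi> id_blinfun = 1 \<and>
     (\<forall>x\<in>M. \<forall>y\<in>M. \<phi> (x o\<^sub>L y) = \<phi> (y o\<^sub>L x)) \<and>
     (\<forall>x\<in>M. \<phi> (adj x o\<^sub>L x) = 0 \<longrightarrow> x = 0) \<and>
     \<phi> \<in> predual M"


section \<open>Continuous Bernoulli systems\<close>

definition intervals :: "real set set" where
  "intervals = {{s..<t} | s t. s < t}"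

definition shift :: "real set \<Rightarrow> real \<Rightarrow> real set" where
  "shift I u = (\<lambda>s. s + u) ` I"

definition interval_less :: "real set \<Rightarrow> real set \<Rightarrow> bool" where
  "interval_less I J \<longleftrightarrow> (\<forall>s\<in>I. \<forall>t\<in>J. s < t)"

definition continuous_bernoulli_system ::
    "'h::complex_hilbert op set \<Rightarrow> ('h op \<Rightarrow> complex) \<Rightarrow> (real set \<Rightarrow> 'h op set) \<Rightarrow> bool" where
  "continuous_bernoulli_system M \<phi> A \<longleftrightarrow>
     von_neumann_algebra M \<and> separable_predual M \<and> faithful_normal_tracial_state M \<phi> \<and>
     (\<forall>I\<in>intervals. von_neumann_algebra (A I) \<and> A I \<subseteq> M) \<and>
     M = von_neumann_algebra hull (\<Union>I\<in>intervals. A I) \<and>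
     (\<forall>I\<in>intervals. \<forall>J\<in>intervals. I \<subseteq> J \<longrightarrow> A I \<subseteq> A J) \<and>
     (\<forall>I\<in>intervals. \<forall>J\<in>intervals. I \<inter> J = {} \<longrightarrow>
        (\<forall>a\<in>A I. \<forall>b\<in>A J. \<phi> (a o\<^sub>L b) = \<phi> a * \<phi> b))"


section \<open>Noncommutative \<open>L\<^sup>p\<close> spaces\<close>

definition op_poly :: "real poly \<Rightarrow> 'h::complex_hilbert op \<Rightarrow> 'h op" where
  "op_poly P a = (\<Sum>i\<le>degree P. coeff P i *\<^sub>R (((\<lambda>b. a o\<^sub>L b) ^^ i) id_blinfun))"

text \<open>Continuous functional calculus \<open>f(a)\<close> of a positive operator \<open>a\<close>, whose spectrum lies in
  \<open>{0..norm a}\<close>, for \<open>f\<close> continuous on this interval.\<close>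

definition cfc :: "(real \<Rightarrow> real) \<Rightarrow> 'h::complex_hilbert op \<Rightarrow> 'h op" where
  "cfc f a = (THE b. \<forall>P :: nat \<Rightarrow> real poly.
     uniform_limit {0..norm a} (\<lambda>n. poly (P n)) f sequentially \<longrightarrow>
     (\<lambda>n. op_poly (P n) a) \<longlonglongrightarrow> b)"

definition op_abs :: "'h::complex_hilbert op \<Rightarrow> 'h op" where
  "op_abs x = cfc sqrt (adj x o\<^sub>L x)"

definition p_norm :: "('h::complex_hilbert op \<Rightarrow> complex) \<Rightarrow> real \<Rightarrow> 'h op \<Rightarrow> real" where
  "p_norm \<phi> p x = (Re (\<phi> (cfc (\<lambda>t. t powr p) (op_abs x)))) powr (1 / p)"

text \<open>The completion \<open>L\<^sup>1(M)\<close> is the closure of the image of \<open>M\<close> under a linear isometry \<open>\<iota>\<close>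
  from \<open>M\<close>, with the norm \<open>p_norm \<phi> 1\<close>, into an arbitrary complex Banach space. As
  \<open>p_norm \<phi> p\<close> increases with \<open>p\<close> and the induced maps from \<open>L\<^sup>p(M)\<close> to \<open>L\<^sup>1(M)\<close> are
  injective, \<open>L\<^sup>p(M)\<close> is identified with its image in \<open>L\<^sup>1(M)\<close>; this is what gives meaning
  to the intersection of these spaces.\<close>

definition L1_embedding ::
    "'h::complex_hilbert op set \<Rightarrow> ('h op \<Rightarrow> complex) \<Rightarrow> ('h op \<Rightarrow> 'l::complex_banach) \<Rightarrow> bool" where
  "L1_embedding M \<phi> \<iota> \<longleftrightarrow>
     (\<forall>x\<in>M. \<forall>y\<in>M. \<iota> (x + y) = \<iota> x + \<iota> y) \<and>
     (\<forall>c. \<forall>x\<in>M. \<iota> (c *\<^sub>C x) = c *\<^sub>C \<iota> x) \<and>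
     (\<forall>x\<in>M. norm (\<iota> x) = p_norm \<phi> 1 x)"

text \<open>\<open>Lp_lim N \<phi> \<iota> p x X\<close>: the sequence \<open>x\<close> in \<open>N\<close> is Cauchy for \<open>p_norm \<phi> p\<close>, and \<open>X\<close> is
  its limit in the completion.\<close>

definition Lp_lim :: "'h::complex_hilbert op set \<Rightarrow> ('h op \<Rightarrow> complex) \<Rightarrow> ('h op \<Rightarrow> 'l::complex_banach) \<Rightarrow>
    real \<Rightarrow> (nat \<Rightarrow> 'h op) \<Rightarrow> 'l \<Rightarrow> bool" where
  "Lp_lim N \<phi> \<iota> p x X \<longleftrightarrow>
     (\<forall>n. x n \<in> N) \<and>
     (\<forall>e>0. \<exists>K. \<forall>m\<ge>K. \<forall>n\<ge>K. p_norm \<phi> p (x m - x n) < e) \<and>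
     (\<lambda>n. \<iota> (x n)) \<longlonglongrightarrow> X"

definition Lp_space :: "'h::complex_hilbert op set \<Rightarrow> ('h op \<Rightarrow> complex) \<Rightarrow> ('h op \<Rightarrow> 'l::complex_banach) \<Rightarrow>
    real \<Rightarrow> 'l set" where
  "Lp_space N \<phi> \<iota> p = {X. \<exists>x. Lp_lim N \<phi> \<iota> p x X}"

definition L_inf_minus :: "'h::complex_hilbert op set \<Rightarrow> ('h op \<Rightarrow> complex) \<Rightarrow>
    ('h op \<Rightarrow> 'l::complex_banach) \<Rightarrow> 'l set" where
  "L_inf_minus N \<phi> \<iota> = (\<Inter>p\<in>{1..}. Lp_space N \<phi> \<iota> p)"

text \<open>The norm of \<open>L\<^sup>p(M)\<close>, the extension of \<open>\<phi>\<close> to \<open>L\<^sup>1(M)\<close> and the product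
  \<open>L\<^sup>2(M) \<times> L\<^sup>2(M) \<rightarrow> L\<^sup>1(M)\<close>, all obtained from \<open>M\<close> by continuity.\<close>

definition Lp_norm :: "'h::complex_hilbert op set \<Rightarrow> ('h op \<Rightarrow> complex) \<Rightarrow> ('h op \<Rightarrow> 'l::complex_banach) \<Rightarrow>
    real \<Rightarrow> 'l \<Rightarrow> real" where
  "Lp_norm M \<phi> \<iota> p X =
     (THE r. \<forall>x. Lp_lim M \<phi> \<iota> p x X \<longrightarrow> (\<lambda>n. p_norm \<phi> p (x n)) \<longlonglongrightarrow> r)"

definition L_state :: "'h::complex_hilbert op set \<Rightarrow> ('h op \<Rightarrow> complex) \<Rightarrow>
    ('h op \<Rightarrow> 'l::complex_banach) \<Rightarrow> 'l \<Rightarrow> complex" where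
  "L_state M \<phi> \<iota> X = (THE c. \<forall>x. Lp_lim M \<phi> \<iota> 1 x X \<longrightarrow> (\<lambda>n. \<phi> (x n)) \<longlonglongrightarrow> c)"

definition L_mult :: "'h::complex_hilbert op set \<Rightarrow> ('h op \<Rightarrow> complex) \<Rightarrow>
    ('h op \<Rightarrow> 'l::complex_banach) \<Rightarrow> 'l \<Rightarrow> 'l \<Rightarrow> 'l" where
  "L_mult M \<phi> \<iota> X Y =
     (THE Z. \<forall>x y. Lp_lim M \<phi> \<iota> 2 x X \<longrightarrow> Lp_lim M \<phi> \<iota> 2 y Y \<longrightarrow>
        (\<lambda>n. \<iota> (x n o\<^sub>L y n)) \<longlonglongrightarrow> Z)"

text \<open>The product \<open>X\<^sub>1 (X\<^sub>2 (\<dots> (X\<^sub>n 1)))\<close> of a list of elements of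
  \<open>L_inf_minus M \<phi> \<iota>\<close>, and the value of \<open>\<phi>\<close> on it.\<close>

definition L_prod :: "'h::complex_hilbert op set \<Rightarrow> ('h op \<Rightarrow> complex) \<Rightarrow>
    ('h op \<Rightarrow> 'l::complex_banach) \<Rightarrow> 'l list \<Rightarrow> 'l" where
  "L_prod M \<phi> \<iota> Xs = foldr (L_mult M \<phi> \<iota>) Xs (\<iota> id_blinfun)"

definition moment :: "'h::complex_hilbert op set \<Rightarrow> ('h op \<Rightarrow> complex) \<Rightarrow>
    ('h op \<Rightarrow> 'l::complex_banach) \<Rightarrow> 'l list \<Rightarrow> complex" where
  "moment M \<phi> \<iota> Xs = L_state M \<phi> \<iota> (L_prod M \<phi> \<iota> Xs)"


section \<open>Flows and quantum Levy processes\<close>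

definition flow :: "'h::complex_hilbert op set \<Rightarrow> ('h op \<Rightarrow> complex) \<Rightarrow> (real set \<Rightarrow> 'h op set) \<Rightarrow>
    ('h op \<Rightarrow> 'l::complex_banach) \<Rightarrow> (real set \<Rightarrow> 'l) \<Rightarrow> bool" where
  "flow M \<phi> A \<iota> B \<longleftrightarrow>
     (\<forall>I\<in>intervals. B I \<in> L_inf_minus M \<phi> \<iota>) \<and>
     (\<forall>p\<ge>1. \<forall>s t. s < t \<longrightarrow>
        ((\<lambda>(s', t'). Lp_norm M \<phi> \<iota> p (B {s'..<t'} - B {s..<t})) \<longlongrightarrow> 0)
          (at (s, t) within {(s', t'). s' < t'})) \<and>
     (\<forall>I\<in>intervals. B I \<in> L_inf_minus (A I) \<phi> \<iota>) \<and>
     (\<forall>s t u. s < t \<longrightarrow> t < u \<longrightarrow> B {s..<u} = B {s..<t} + B {t..<u})"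

definition stationary :: "'h::complex_hilbert op set \<Rightarrow> ('h op \<Rightarrow> complex) \<Rightarrow>
    ('h op \<Rightarrow> 'l::complex_banach) \<Rightarrow> (real set \<Rightarrow> 'l) \<Rightarrow> bool" where
  "stationary M \<phi> \<iota> B \<longleftrightarrow>
     (\<forall>n\<ge>1. \<forall>I :: nat \<Rightarrow> real set. (\<forall>k\<in>{1..n}. I k \<in> intervals) \<longrightarrow>
        (\<forall>t u. moment M \<phi> \<iota> (map (\<lambda>k. B (shift (I k) t)) [1..<Suc n]) =
               moment M \<phi> \<iota> (map (\<lambda>k. B (shift (I k) u)) [1..<Suc n])))"

definition order_invariant :: "'h::complex_hilbert op set \<Rightarrow> ('h op \<Rightarrow> complex) \<Rightarrow>
    ('h op \<Rightarrow> 'l::complex_banach) \<Rightarrow> (real set \<Rightarrow> 'l) \<Rightarrow> bool" where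
  "order_invariant M \<phi> \<iota> B \<longleftrightarrow>
     (\<forall>n\<ge>1. \<forall>(I :: nat \<Rightarrow> real set) (t :: nat \<Rightarrow> real).
        (\<forall>k\<in>{1..n}. I k \<in> intervals) \<longrightarrow>
        (\<forall>k\<in>{1..n}. \<forall>l\<in>{1..n}. I k = I l \<or> I k \<inter> I l = {}) \<longrightarrow>
        (\<forall>k\<in>{1..n}. \<forall>l\<in>{1..n}. (I k = I l \<longrightarrow> t k = t l) \<and>
           (interval_less (I k) (I l) \<longrightarrow>
              interval_less (shift (I k) (t k)) (shift (I l) (t l)))) \<longrightarrow>
        moment M \<phi> \<iota> (map (\<lambda>k. B (I k)) [1..<Suc n]) =
        moment M \<phi> \<iota> (map (\<lambda>k. B (shift (I k) (t k))) [1..<Suc n]))"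

definition levy_process :: "(real set \<Rightarrow> 'l::complex_banach) \<Rightarrow> real \<Rightarrow> 'l" where
  "levy_process B t = (if t = 0 then 0 else B {0..<t})"


section \<open>Order equivalence classes\<close>

text \<open>An \<open>n\<close>-tuple is a list of length \<open>n\<close> with positive entries.\<close>

definition tuples :: "nat \<Rightarrow> nat list set" where
  "tuples n = {i. length i = n \<and> (\<forall>v\<in>set i. 1 \<le> v)}"

definition order_equiv :: "nat \<Rightarrow> (nat list \<times> nat list) set" where
  "order_equiv n = {(i, j). i \<in> tuples n \<and> j \<in> tuples n \<and>
     (\<forall>k<n. \<forall>l<n. i ! k \<le> i ! l \<longleftrightarrow> j ! k \<le> j ! l)}"

definition order_classes :: "nat \<Rightarrow> nat list set set" where
  "order_classes n = tuples n // order_equiv n"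

definition num_values :: "nat list set \<Rightarrow> nat" where
  "num_values \<sigma> = (THE r. \<forall>i\<in>\<sigma>. card (set i) = r)"

lemma equiv_order_equiv: "equiv (tuples n) (order_equiv n)"
  by (auto simp: equiv_def order_equiv_def refl_on_def sym_def trans_def)

lemma finite_order_classes: "finite (order_classes n)"
proof -
  define g where "g i = {(k, l). k < n \<and> l < n \<and> i ! k \<le> i ! l}" for i :: "nat list"
  have "order_equiv n `` {i} = {j \<in> tuples n. g j = g i}" if "i \<in> tuples n" for i
    using that by (fastforce simp: order_equiv_def g_def set_eq_iff)
  then have "order_classes n \<subseteq> (\<lambda>S. {j \<in> tuples n. g j = S}) ` Pow ({..<n} \<times> {..<n})"
    by (auto simp: order_classes_def quotient_def g_def)
  then show ?thesis
    by (rule finite_subset) auto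
qed

lemma num_values_eq:
  assumes "\<sigma> \<in> order_classes n" "i \<in> \<sigma>"
  shows "num_values \<sigma> = card (set i)"
proof -
  have card_le: "card (set j) \<le> card (set k)"
    if jk: "(j, k) \<in> order_equiv n" for j k
  proof -
    have len: "length j = n" "length k = n"
      using jk by (auto simp: order_equiv_def tuples_def)
    have *: "k ! l = k ! m \<Longrightarrow> j ! l = j ! m" if "l < n" "m < n" for l m
      using jk that by (force simp: order_equiv_def intro: antisym)
    define h where "h v = j ! (SOME m. m < n \<and> k ! m = v)" for v
    have "h (k ! l) = j ! l" if "l < n" for l
      unfolding h_def using someI[of "\<lambda>m. m < n \<and> k ! m = k ! l" l] that
      by (intro *) auto
    then have "set j \<subseteq> h ` set k"
      by (force simp: in_set_conv_nth len)
    then show ?thesis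
      by (meson List.finite_set surj_card_le)
  qed
  have "(i, j) \<in> order_equiv n" if "j \<in> \<sigma>" for j
    using assms that equiv_order_equiv[of n] unfolding order_classes_def
    by (meson quotient_eq_iff)
  moreover have "(j, i) \<in> order_equiv n" if "(i, j) \<in> order_equiv n" for j
    using that by (simp add: order_equiv_def)
  ultimately have same: "card (set j) = card (set i)" if "j \<in> \<sigma>" for j
    using that by (intro antisym card_le) blast+
  show ?thesis
    unfolding num_values_def
  proof (rule the_equality)
    show "\<forall>j\<in>\<sigma>. card (set j) = card (set i)" using same by blast
  next
    fix r assume "\<forall>j\<in>\<sigma>. card (set j) = r"
    then show "r = card (set i)" using assms(2) by auto
  qed
qed

end

theory Submission
  imports Defs "HOL-Computational_Algebra.Fundamental_Theorem_Algebra"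
begin

text \<open>Cutting \<open>[0, m t)\<close> into \<open>m\<close> intervals of length \<open>t\<close> and grouping the terms of \<open>\<phi> (B\<^sub>1 \<dots> B\<^sub>n)\<close> by the
  set of intervals which occur, order invariance shows that \<open>m \<mapsto> \<phi> (B (m t) ^ n)\<close> is a combination
  of the binomial coefficients \<open>m choose r\<close> with \<open>1 \<le> r \<le> n\<close>, hence polynomial of degree at most \<open>n\<close>.
  These polynomials agree for commensurable \<open>t\<close>, so the moment is polynomial on the rationals, and
  by continuity everywhere. Its coefficients are then distributed over the order classes.

  Multilinearity and continuity of the moments rest on Hoelder's inequality for the trace. It is only
  needed for the exponents \<open>2\<^bsup>j\<^esup>\<close>, where it follows from the Cauchy-Schwarz inequality by induction on \<open>j\<close>.\<close>

section \<open>Complex Hilbert spaces and adjoints\<close>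

text \<open>The functional calculus, the norms, the product and the state on the completion are all
  definite descriptions over arbitrary approximating sequences, so nothing can be said about a
  moment before existence and independence of the sequence are settled. For \<open>cfc\<close> this
  needs the bound of \<open>norm (op_poly P a)\<close> by the supremum of \<open>P\<close> on the
  segment from 0 to \<open>norm a\<close>; it is derived from the fundamental theorem of algebra,
  without spectral theory. For \<open>L_mult\<close> it needs a bound on the trace norm of
  \<open>x o\<^sub>L y\<close>, hence a polar decomposition, for which a polynomial approximation is
  enough.

  The exponents \<open>2 ^ Suc j\<close> are singled out because the norm is then a root of the
  trace of a power of \<open>adj x o\<^sub>L x\<close>, with no modulus left. A product costs one
  level \<open>j\<close>, so a word of arbitrary length is controlled only if convergence holds on
  all levels at once.

  The constant term of each polynomial vanishes because the process starts at 0. An order class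
  determines the length \<open>n\<close> of its tuples, so the constants can be read off separately
  for each \<open>n\<close>.\<close>

lemma mult_cnj_self: "z * cnj z = (complex_of_real (cmod z))\<^sup>2"
  by (metis complex_norm_square of_real_power)

text \<open>The Cauchy-Schwarz inequality for two vectors involves only these three numbers. It is
  applied to the inner product and again to the form
  \<open>\<phi> (adj x o\<^sub>L y)\<close>.\<close>

lemma hermitian_form_cauchy_schwarz:
  fixes p q :: real and z :: complex
  assumes "0 \<le> q" and form: "\<And>c. 0 \<le> p + 2 * Re (c * z) + (cmod c)\<^sup>2 * q"
  shows "(cmod z)\<^sup>2 \<le> p * q"
proof (cases "q = 0")
  case True
  have "z = 0"
  proof (rule ccontr)
    assume "z \<noteq> 0"
    \<comment> \<open>This \<open>c\<close> makes the linear term \<open>- 2 * (p + 1)\<close>,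
      which pushes the form below 0.\<close>
    define c where "c = - complex_of_real ((p + 1) / (cmod z)\<^sup>2) * cnj z"
    have "c * z = - complex_of_real (p + 1)"
      using \<open>z \<noteq> 0\<close> by (simp add: c_def field_simps flip: mult_cnj_self)
    then have "p + 2 * Re (c * z) = p - 2 * (p + 1)" by simp
    then have "0 \<le> p - 2 * (p + 1)" using form[of c] True by simp
    moreover have "0 \<le> p" using form[of 0] by simp
    ultimately show False by simp
  qed
  then show ?thesis using True by simp
next
  case False
  then have "q > 0" using assms by simp
  \<comment> \<open>The minimiser of the quadratic form.\<close>
  define c where "c = - cnj z / complex_of_real q"
  have "c * z = - complex_of_real ((cmod z)\<^sup>2 / q)"
    by (simp add: c_def mult.commute mult_cnj_self[symmetric])
  then have "Re (c * z) = - (cmod z)\<^sup>2 / q" by simp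
  moreover have "(cmod c)\<^sup>2 * q = (cmod z)\<^sup>2 / q"
    using \<open>q > 0\<close> by (simp add: c_def norm_divide power_divide power2_eq_square)
  ultimately have "0 \<le> p - (cmod z)\<^sup>2 / q" using form[of c] by simp
  then show ?thesis using \<open>q > 0\<close> by (simp add: field_simps)
qed

lemma scaleR_scaleC: "r *\<^sub>R x = complex_of_real r *\<^sub>C (x::'a::complex_banach)"
  by (simp add: scaleC_of_real)

lemma scaleC_zero_left [simp]: "0 *\<^sub>C (x::'a::complex_banach) = 0"
  using scaleC_of_real[of 0 x] by simp

lemma scaleC_minus_one: "(- 1) *\<^sub>C (x::'a::complex_banach) = - x"
  using scaleC_of_real[of "- 1" x] by simp

lemma scaleC_diff_left: "(c - d) *\<^sub>C x = c *\<^sub>C x - d *\<^sub>C (x::'a::complex_banach)"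
  using scaleC_add_left[of "c - d" d x] by simp

lemma cinner_add_left: "cinner (x + y) z = cinner x z + cinner y (z::'h::complex_hilbert)"
  using cinner_commute[of "x + y" z] cinner_commute[of x z] cinner_commute[of y z]
  by (simp add: cinner_add_right)

lemma cinner_scaleC_left: "cinner (c *\<^sub>C x) y = cnj c * cinner x (y::'h::complex_hilbert)"
  using cinner_commute[of "c *\<^sub>C x" y] cinner_commute[of x y]
  by (simp add: cinner_scaleC_right)

lemma cinner_scaleR_right: "cinner x (r *\<^sub>R y) = of_real r * cinner x (y::'h::complex_hilbert)"
  by (simp add: scaleR_scaleC cinner_scaleC_right)

lemma cinner_scaleR_left: "cinner (r *\<^sub>R x) y = of_real r * cinner x (y::'h::complex_hilbert)"
  by (simp add: scaleR_scaleC cinner_scaleC_left)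

lemma cinner_zero [simp]: "cinner x 0 = 0" "cinner 0 x = (0::complex)" for x :: "'h::complex_hilbert"
  using cinner_scaleR_right[of x 0 0] cinner_scaleR_left[of 0 0 x] by simp_all

lemma cinner_diff_right: "cinner x (y - z) = cinner x y - cinner x (z::'h::complex_hilbert)"
  using cinner_add_right[of x "y - z" z] by simp

lemma cinner_diff_left: "cinner (x - y) z = cinner x z - cinner y (z::'h::complex_hilbert)"
  using cinner_add_left[of "x - y" y z] by simp

lemma norm_add_scaleC_sq:
  fixes x y :: "'h::complex_hilbert"
  shows "(norm (x + c *\<^sub>C y))\<^sup>2 = (norm x)\<^sup>2 + 2 * Re (c * cinner x y) + (cmod c)\<^sup>2 * (norm y)\<^sup>2"
proof -
  have "complex_of_real ((norm (x + c *\<^sub>C y))\<^sup>2) =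
      of_real ((norm x)\<^sup>2) + (c * cinner x y + cnj (c * cinner x y)) + c * cnj c * of_real ((norm y)\<^sup>2)"
    unfolding cinner_self[symmetric] cinner_add_left cinner_add_right cinner_scaleC_left
      cinner_scaleC_right
    by (simp add: algebra_simps cinner_commute[of y x])
  also have "c * cinner x y + cnj (c * cinner x y) = of_real (2 * Re (c * cinner x y))"
    by (rule complex_add_cnj)
  also have "c * cnj c = of_real ((cmod c)\<^sup>2)" by (simp add: mult_cnj_self)
  finally show ?thesis
    by (metis (no_types, lifting) of_real_add of_real_mult of_real_eq_iff)
qed

lemma cinner_cauchy_schwarz: "cmod (cinner x y) \<le> norm x * norm (y::'h::complex_hilbert)"
proof -
  have "(cmod (cinner x y))\<^sup>2 \<le> (norm x)\<^sup>2 * (norm y)\<^sup>2"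
    by (rule hermitian_form_cauchy_schwarz) (simp_all only: norm_add_scaleC_sq[symmetric] zero_le_power2)
  then show ?thesis
    by (metis power_mult_distrib power2_le_imp_le mult_nonneg_nonneg norm_ge_zero)
qed

lemma cinner_eqI: "(\<And>\<eta>. cinner x \<eta> = cinner y \<eta>) \<Longrightarrow> x = (y::'h::complex_hilbert)"
  using cinner_self[of "x - y"] by (simp add: cinner_diff_left)

lemma is_adjoint_unique: "is_adjoint y x \<Longrightarrow> is_adjoint y' x \<Longrightarrow> y = y'"
  unfolding is_adjoint_def by (intro blinfun_eqI cinner_eqI) simp

text \<open>Rules for adjoints are proved for the relation \<open>is_adjoint\<close>, since
  \<open>adj\<close> is a definite description and an adjoint is known to exist only for members of
  a von Neumann algebra. This rule transfers them.\<close>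

lemma adj_eqI: "is_adjoint y x \<Longrightarrow> adj x = y"
  unfolding adj_def by (rule the_equality) (auto intro: is_adjoint_unique)

lemma is_adjoint_sym: "is_adjoint y x \<Longrightarrow> is_adjoint x y"
  unfolding is_adjoint_def by (metis cinner_commute)

lemma is_adjoint_id: "is_adjoint id_blinfun id_blinfun"
  by (simp add: is_adjoint_def)

lemma is_adjoint_add: "is_adjoint y x \<Longrightarrow> is_adjoint y' x' \<Longrightarrow> is_adjoint (y + y') (x + x')"
  by (simp add: is_adjoint_def blinfun.add_left cinner_add_left cinner_add_right)

lemma is_adjoint_diff: "is_adjoint y x \<Longrightarrow> is_adjoint y' x' \<Longrightarrow> is_adjoint (y - y') (x - x')"
  by (simp add: is_adjoint_def blinfun.diff_left cinner_diff_left cinner_diff_right)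

lemma is_adjoint_scaleC: "is_adjoint y x \<Longrightarrow> is_adjoint (cnj c *\<^sub>C y) (c *\<^sub>C x)"
  by (simp add: is_adjoint_def blinfun_apply_scaleC cinner_scaleC_left cinner_scaleC_right)

lemma is_adjoint_scaleR: "is_adjoint y x \<Longrightarrow> is_adjoint (r *\<^sub>R y) (r *\<^sub>R x)"
  by (simp add: is_adjoint_def blinfun.scaleR_left cinner_scaleR_left cinner_scaleR_right)

lemma is_adjoint_compose: "is_adjoint y x \<Longrightarrow> is_adjoint y' x' \<Longrightarrow> is_adjoint (y' o\<^sub>L y) (x o\<^sub>L x')"
  by (simp add: is_adjoint_def)

lemma norm_apply_sq: "is_adjoint y x \<Longrightarrow>
    of_real ((norm (blinfun_apply x \<xi>))\<^sup>2) = cinner \<xi> (blinfun_apply (y o\<^sub>L x) \<xi>)"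
  by (metis blinfun_apply_blinfun_compose cinner_self is_adjoint_def is_adjoint_sym)

text \<open>One half of the C*-identity: the squared norm of \<open>x \<xi>\<close> is the inner
  product of \<open>\<xi>\<close> with \<open>(y o\<^sub>L x) \<xi>\<close>.\<close>

lemma norm_sq_le_norm_adjoint_compose:
  assumes "is_adjoint y x"
  shows "(norm x)\<^sup>2 \<le> norm (y o\<^sub>L x)"
proof -
  have "norm x \<le> sqrt (norm (y o\<^sub>L x))"
  proof (rule norm_blinfun_bound)
    fix \<xi>
    have "(norm (blinfun_apply x \<xi>))\<^sup>2 = cmod (cinner \<xi> (blinfun_apply (y o\<^sub>L x) \<xi>))"
      using norm_apply_sq[OF assms, of \<xi>, symmetric] by (simp add: norm_power del: of_real_power)
    also have "\<dots> \<le> norm \<xi> * (norm (y o\<^sub>L x) * norm \<xi>)"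
      by (meson cinner_cauchy_schwarz norm_blinfun order_trans mult_left_mono norm_ge_zero)
    also have "\<dots> = (sqrt (norm (y o\<^sub>L x)) * norm \<xi>)\<^sup>2"
      by (simp add: power2_eq_square)
    finally show "norm (blinfun_apply x \<xi>) \<le> sqrt (norm (y o\<^sub>L x)) * norm \<xi>"
      by (rule power2_le_imp_le) simp
  qed simp
  then have "(norm x)\<^sup>2 \<le> (sqrt (norm (y o\<^sub>L x)))\<^sup>2" by (rule power_mono) simp
  then show ?thesis by simp
qed

lemma norm_adjoint_le:
  assumes "is_adjoint y x"
  shows "norm x \<le> norm y"
proof (cases "norm x = 0")
  case False
  have "norm x * norm x \<le> norm y * norm x"
    using norm_sq_le_norm_adjoint_compose[OF assms] norm_blinfun_compose[of y x]
    by (simp add: power2_eq_square)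
  then show ?thesis using False by simp
qed simp

lemma norm_adjoint_compose:
  assumes "is_adjoint y x"
  shows "norm (y o\<^sub>L x) = (norm x)\<^sup>2"
proof (rule antisym[OF _ norm_sq_le_norm_adjoint_compose[OF assms]])
  have "norm y = norm x"
    using norm_adjoint_le assms is_adjoint_sym by (metis antisym)
  then show "norm (y o\<^sub>L x) \<le> (norm x)\<^sup>2"
    using norm_blinfun_compose[of y x] by (simp add: power2_eq_square)
qed

text \<open>Needed for the functional calculus: continuous functions of a positive operator are norm
  limits of self-adjoint polynomials in it.\<close>

lemma is_adjoint_limit:
  fixes x y :: "nat \<Rightarrow> 'h::complex_hilbert op"
  assumes "\<And>n. is_adjoint (y n) (x n)" "x \<longlonglongrightarrow> x0" "y \<longlonglongrightarrow> y0"
  shows "is_adjoint y0 x0"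
proof -
  have bl: "bounded_linear (cinner \<xi>)" for \<xi> :: 'h
    by (rule bounded_linear_intro[where K = "norm \<xi>"])
      (auto simp: cinner_add_right cinner_scaleR_right scaleR_conv_of_real mult.commute
        intro: order_trans[OF cinner_cauchy_schwarz])
  have "cinner (blinfun_apply y0 \<xi>) \<eta> = cinner \<xi> (blinfun_apply x0 \<eta>)" for \<xi> \<eta>
  proof (rule LIMSEQ_unique)
    show "(\<lambda>n. cinner \<xi> (blinfun_apply (x n) \<eta>)) \<longlonglongrightarrow> cinner \<xi> (blinfun_apply x0 \<eta>)"
      by (intro bounded_linear.tendsto[OF bl] blinfun.tendsto assms tendsto_const)
    have "(\<lambda>n. cnj (cinner \<eta> (blinfun_apply (y n) \<xi>))) \<longlonglongrightarrow> cnj (cinner \<eta> (blinfun_apply y0 \<xi>))"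
      by (intro tendsto_cnj bounded_linear.tendsto[OF bl] blinfun.tendsto assms tendsto_const)
    then have "(\<lambda>n. cinner (blinfun_apply (y n) \<xi>) \<eta>) \<longlonglongrightarrow> cinner (blinfun_apply y0 \<xi>) \<eta>"
      by (simp flip: cinner_commute)
    then show "(\<lambda>n. cinner \<xi> (blinfun_apply (x n) \<eta>)) \<longlonglongrightarrow> cinner (blinfun_apply y0 \<xi>) \<eta>"
      using assms(1) by (simp add: is_adjoint_def)
  qed
  then show ?thesis by (simp add: is_adjoint_def)
qed

section \<open>Polynomials in a positive operator\<close>

lemma o_assoc: "(a o\<^sub>L b) o\<^sub>L c = a o\<^sub>L (b o\<^sub>L c)"
  by (rule blinfun_eqI) simp

lemma o_id [simp]: "a o\<^sub>L id_blinfun = a" "id_blinfun o\<^sub>L a = a"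
  by (auto intro: blinfun_eqI)

lemmas o_add_left = bounded_bilinear.add_left[OF bounded_bilinear_blinfun_compose]
  and o_add_right = bounded_bilinear.add_right[OF bounded_bilinear_blinfun_compose]
  and o_diff_left = bounded_bilinear.diff_left[OF bounded_bilinear_blinfun_compose]
  and o_diff_right = bounded_bilinear.diff_right[OF bounded_bilinear_blinfun_compose]
  and o_scaleR_left = bounded_bilinear.scaleR_left[OF bounded_bilinear_blinfun_compose]
  and o_scaleR_right = bounded_bilinear.scaleR_right[OF bounded_bilinear_blinfun_compose]
  and o_sum_right = bounded_bilinear.sum_right[OF bounded_bilinear_blinfun_compose]
  and o_tendsto = bounded_bilinear.tendsto[OF bounded_bilinear_blinfun_compose]

lemma o_scaleC_left: "(c *\<^sub>C x) o\<^sub>L y = c *\<^sub>C (x o\<^sub>L y)"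
  by (rule blinfun_eqI) (simp add: blinfun_apply_scaleC)

definition opow :: "'h::complex_hilbert op \<Rightarrow> nat \<Rightarrow> 'h op" where
  "opow a n = ((\<lambda>b. a o\<^sub>L b) ^^ n) id_blinfun"

lemma opow_0 [simp]: "opow a 0 = id_blinfun"
  and opow_Suc: "opow a (Suc n) = a o\<^sub>L opow a n"
  by (simp_all add: opow_def)

lemma opow_1 [simp]: "opow a (Suc 0) = a"
  by (simp add: opow_Suc)

lemma opow_add: "opow a (m + n) = opow a m o\<^sub>L opow a n"
  by (induction m) (simp_all add: opow_Suc o_assoc)

lemma opow_Suc2: "opow a (Suc n) = opow a n o\<^sub>L a"
  using opow_add[of a n 1] by simp

lemma opow_mult: "opow a (m * n) = opow (opow a m) n"
  by (induction n) (simp_all add: opow_Suc opow_add)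

lemma op_poly_opow: "op_poly P a = (\<Sum>i\<le>degree P. coeff P i *\<^sub>R opow a i)"
  by (simp add: op_poly_def opow_def)

lemma op_poly_sum: "degree P \<le> N \<Longrightarrow> op_poly P a = (\<Sum>i\<le>N. coeff P i *\<^sub>R opow a i)"
  unfolding op_poly_opow by (rule sum.mono_neutral_left) (auto simp: coeff_eq_0)

lemma op_poly_0 [simp]: "op_poly 0 a = 0"
  by (simp add: op_poly_opow)

lemma op_poly_add: "op_poly (P + Q) a = op_poly P a + op_poly Q a"
  unfolding op_poly_sum[OF degree_add_le_max] op_poly_sum[OF max.cobounded1[of "degree P" "degree Q"]]
    op_poly_sum[OF max.cobounded2[of "degree Q" "degree P"]]
  by (simp add: scaleR_left_distrib sum.distrib)

lemma op_poly_smult: "op_poly (smult c P) a = c *\<^sub>R op_poly P a"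
  unfolding op_poly_sum[OF degree_smult_le] op_poly_opow by (simp add: scaleR_sum_right)

lemma op_poly_diff: "op_poly (P - Q) a = op_poly P a - op_poly Q a"
  using op_poly_add[of "P - Q" Q a] by simp

lemma op_poly_pCons: "op_poly (pCons c P) a = c *\<^sub>R id_blinfun + (a o\<^sub>L op_poly P a)"
proof -
  have "op_poly (pCons c P) a = (\<Sum>i\<le>Suc (degree P). coeff (pCons c P) i *\<^sub>R opow a i)"
    by (rule op_poly_sum) (simp add: degree_pCons_le)
  also have "\<dots> = c *\<^sub>R id_blinfun + (\<Sum>i\<le>degree P. coeff P i *\<^sub>R opow a (Suc i))"
    by (subst sum.atMost_Suc_shift) simp
  finally show ?thesis
    by (simp add: op_poly_opow o_sum_right o_scaleR_right opow_Suc)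
qed

lemma op_poly_mult: "op_poly (P * Q) a = op_poly P a o\<^sub>L op_poly Q a"
  by (induction P)
    (simp_all add: op_poly_add op_poly_smult op_poly_pCons o_add_left o_scaleR_left o_assoc)

lemma op_poly_1 [simp]: "op_poly 1 a = id_blinfun"
  using op_poly_pCons[of 1 0 a] by (simp add: one_pCons)

lemma op_poly_X: "op_poly [:0, 1:] a = a"
  by (simp add: op_poly_pCons)

lemma op_poly_power: "op_poly (P ^ n) a = opow (op_poly P a) n"
  by (induction n) (simp_all add: op_poly_mult opow_Suc)

lemma is_adjoint_opow: "is_adjoint b a \<Longrightarrow> is_adjoint (opow b n) (opow a n)"
  by (induction n) (simp_all add: is_adjoint_id opow_Suc[of a] opow_Suc2[of b] is_adjoint_compose)

lemma is_adjoint_sum: "(\<And>i. i \<in> S \<Longrightarrow> is_adjoint (g i) (f i)) \<Longrightarrow> is_adjoint (sum g S) (sum f S)"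
  by (induction S rule: infinite_finite_induct)
    (auto intro: is_adjoint_add simp: is_adjoint_def[of 0])

lemma is_adjoint_op_poly: "is_adjoint b a \<Longrightarrow> is_adjoint (op_poly P b) (op_poly P a)"
  unfolding op_poly_opow by (intro is_adjoint_sum is_adjoint_scaleR is_adjoint_opow)

text \<open>Complex linearity is required because the operator type is only real-linear,
  self-adjointness because only the real part of the quadratic form is constrained. The former lets
  scalars pass in the factorisation into linear factors, the latter makes the Rayleigh quotient
  real.\<close>

definition pos_op :: "'h::complex_hilbert op \<Rightarrow> bool" where
  "pos_op a \<longleftrightarrow> a \<in> clinear_ops \<and> is_adjoint a a \<and> (\<forall>\<xi>. 0 \<le> Re (cinner \<xi> (blinfun_apply a \<xi>)))"

lemma clinear_ops_compose: "x \<in> clinear_ops \<Longrightarrow> y \<in> clinear_ops \<Longrightarrow> x o\<^sub>L y \<in> clinear_ops"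
  by (simp add: clinear_ops_def)

lemma pos_op_adjoint_compose:
  assumes "is_adjoint y x" "x \<in> clinear_ops" "y \<in> clinear_ops"
  shows "pos_op (y o\<^sub>L x)"
  unfolding pos_op_def
proof (intro conjI allI)
  show "is_adjoint (y o\<^sub>L x) (y o\<^sub>L x)"
    using assms is_adjoint_compose is_adjoint_sym by blast
  show "0 \<le> Re (cinner \<xi> (blinfun_apply (y o\<^sub>L x) \<xi>))" for \<xi>
    by (simp del: of_real_power blinfun_apply_blinfun_compose flip: norm_apply_sq[OF assms(1)])
qed (use assms in \<open>auto intro: clinear_ops_compose\<close>)

lemma pos_op_square: "is_adjoint a a \<Longrightarrow> a \<in> clinear_ops \<Longrightarrow> pos_op (a o\<^sub>L a)"
  by (rule pos_op_adjoint_compose)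

text \<open>Real polynomials need not split, so complex coefficients are used. The action on vectors
  is enough, since only lower bounds are sought.\<close>

definition complex_op_poly :: "complex poly \<Rightarrow> 'h::complex_hilbert op \<Rightarrow> 'h \<Rightarrow> 'h" where
  "complex_op_poly q a \<xi> = (\<Sum>i\<le>degree q. coeff q i *\<^sub>C blinfun_apply (opow a i) \<xi>)"

lemma complex_op_poly_sum:
  "degree q \<le> N \<Longrightarrow> complex_op_poly q a \<xi> = (\<Sum>i\<le>N. coeff q i *\<^sub>C blinfun_apply (opow a i) \<xi>)"
  unfolding complex_op_poly_def by (rule sum.mono_neutral_left) (auto simp: coeff_eq_0)

lemma complex_op_poly_of_real:
  "complex_op_poly (map_poly of_real P) a \<xi> = blinfun_apply (op_poly P a) \<xi>"
  by (simp add: complex_op_poly_def op_poly_opow degree_map_poly coeff_map_poly scaleC_of_real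
      blinfun.sum_left blinfun.scaleR_left)

lemma complex_op_poly_linear_factor:
  assumes "a \<in> clinear_ops"
  shows "complex_op_poly ([:-z, 1:] * q) a \<xi> =
    blinfun_apply a (complex_op_poly q a \<xi>) - z *\<^sub>C complex_op_poly q a \<xi>"
proof -
  have eq: "[:-z, 1:] * q = pCons 0 q - smult z q" by simp
  have "degree ([:-z, 1:] * q) \<le> Suc (degree q)"
    unfolding eq by (intro degree_diff_le) (auto simp: degree_pCons_le intro: le_trans[OF degree_smult_le])
  then have "complex_op_poly ([:-z, 1:] * q) a \<xi> =
      (\<Sum>i\<le>Suc (degree q). (coeff (pCons 0 q) i - z * coeff q i) *\<^sub>C blinfun_apply (opow a i) \<xi>)"
    by (simp only: complex_op_poly_sum) (simp only: eq coeff_diff coeff_smult)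
  also have "\<dots> = (\<Sum>i\<le>Suc (degree q). coeff (pCons 0 q) i *\<^sub>C blinfun_apply (opow a i) \<xi>)
      - (\<Sum>i\<le>Suc (degree q). (z * coeff q i) *\<^sub>C blinfun_apply (opow a i) \<xi>)"
    by (simp only: scaleC_diff_left sum_subtractf)
  also have "(\<Sum>i\<le>Suc (degree q). (z * coeff q i) *\<^sub>C blinfun_apply (opow a i) \<xi>) =
      z *\<^sub>C complex_op_poly q a \<xi>"
    unfolding complex_op_poly_sum[OF le_SucI[OF order_refl]]
    by (simp only: linear_sum[OF bounded_linear.linear[OF bounded_linear_scaleC]] scaleC_scaleC)
  also have "(\<Sum>i\<le>Suc (degree q). coeff (pCons 0 q) i *\<^sub>C blinfun_apply (opow a i) \<xi>) =
      (\<Sum>i\<le>degree q. coeff q i *\<^sub>C blinfun_apply (opow a (Suc i)) \<xi>)"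
    by (subst sum.atMost_Suc_shift) simp
  also have "\<dots> = blinfun_apply a (complex_op_poly q a \<xi>)"
    using assms by (simp add: complex_op_poly_def blinfun.sum_right opow_Suc clinear_ops_def)
  finally show ?thesis .
qed

text \<open>The Rayleigh quotient \<open>\<rho>\<close> of \<open>a\<close> lies between 0 and
  \<open>norm a\<close>, and the inner product of \<open>\<xi>\<close> with
  \<open>a \<xi> - z \<xi>\<close> is \<open>\<rho> - z\<close> times the squared norm of
  \<open>\<xi>\<close>. Cauchy-Schwarz turns the distance of \<open>z\<close> from the segment into
  the constant \<open>c\<close>.\<close>

lemma pos_op_minus_scalar_bounded_below:
  assumes "pos_op a" and z: "z \<notin> of_real ` {0..norm a}"
  obtains c where "c > 0" "\<And>\<xi>. c * norm \<xi> \<le> norm (blinfun_apply a \<xi> - z *\<^sub>C \<xi>)"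
proof -
  let ?K = "complex_of_real ` {0..norm a}"
  have "closed ?K"
    by (intro compact_imp_closed compact_continuous_image continuous_intros) auto
  then obtain c where c: "c > 0" "\<And>w. w \<in> ?K \<Longrightarrow> c \<le> dist z w"
    using separate_point_closed[of ?K z] z by blast
  have "c * norm \<xi> \<le> norm (blinfun_apply a \<xi> - z *\<^sub>C \<xi>)" for \<xi>
  proof (cases "\<xi> = 0")
    case False
    define \<rho> where "\<rho> = Re (cinner \<xi> (blinfun_apply a \<xi>)) / (norm \<xi>)\<^sup>2"
    have "cinner \<xi> (blinfun_apply a \<xi>) = cnj (cinner \<xi> (blinfun_apply a \<xi>))"
      using assms(1) unfolding pos_op_def is_adjoint_def by (metis cinner_commute)
    then have "Im (cinner \<xi> (blinfun_apply a \<xi>)) = 0"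
      by (simp add: complex_eq_iff)
    then have inner: "cinner \<xi> (blinfun_apply a \<xi>) = of_real (\<rho> * (norm \<xi>)\<^sup>2)"
      using False by (simp add: \<rho>_def complex_eq_iff)
    have "\<rho> * (norm \<xi>)\<^sup>2 \<le> norm a * (norm \<xi>)\<^sup>2"
    proof -
      have "\<rho> * (norm \<xi>)\<^sup>2 \<le> cmod (cinner \<xi> (blinfun_apply a \<xi>))"
        unfolding inner norm_of_real by simp
      also have "\<dots> \<le> norm \<xi> * (norm a * norm \<xi>)"
        by (meson cinner_cauchy_schwarz norm_blinfun order_trans mult_left_mono norm_ge_zero)
      finally show ?thesis by (simp add: power2_eq_square algebra_simps)
    qed
    moreover have "0 \<le> \<rho>"
      using assms(1) by (simp add: \<rho>_def pos_op_def)
    ultimately have "of_real \<rho> \<in> ?K" using False by simp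
    then have "c \<le> cmod (of_real \<rho> - z)"
      using c(2) by (metis dist_norm norm_minus_commute)
    then have "c * (norm \<xi>)\<^sup>2 \<le> cmod (of_real \<rho> - z) * (norm \<xi>)\<^sup>2"
      by (simp add: mult_right_mono)
    also have "\<dots> = cmod ((of_real \<rho> - z) * of_real ((norm \<xi>)\<^sup>2))"
      by (simp add: norm_mult norm_power)
    also have "(of_real \<rho> - z) * of_real ((norm \<xi>)\<^sup>2) = cinner \<xi> (blinfun_apply a \<xi> - z *\<^sub>C \<xi>)"
      by (simp add: cinner_diff_right cinner_scaleC_right cinner_self inner algebra_simps)
    also have "cmod \<dots> \<le> norm \<xi> * norm (blinfun_apply a \<xi> - z *\<^sub>C \<xi>)"
      by (rule cinner_cauchy_schwarz)
    finally show ?thesis using False by (simp add: power2_eq_square)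
  qed simp
  then show ?thesis using that c(1) by blast
qed

text \<open>Every complex root lies off the segment, so each linear factor is bounded below, and the
  lower bounds multiply.\<close>

lemma complex_op_poly_bounded_below:
  assumes "pos_op a" "\<And>t. 0 \<le> t \<Longrightarrow> t \<le> norm a \<Longrightarrow> poly q (of_real t) \<noteq> 0"
  shows "\<exists>c>0. \<forall>\<xi>. c * norm \<xi> \<le> norm (complex_op_poly q a \<xi>)"
  using assms(2)
proof (induction "degree q" arbitrary: q)
  case 0
  then have "coeff q 0 \<noteq> 0"
    by (metis degree_eq_zeroE coeff_pCons_0 poly_pCons poly_0 mult_zero_right add_0_right norm_ge_zero order_refl)
  then show ?case
    using 0 by (intro exI[of _ "cmod (coeff q 0)"]) (simp add: complex_op_poly_def norm_scaleC)
next
  case (Suc d)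
  then have "\<not> constant (poly q)"
    using constant_degree by (metis nat.distinct(1))
  then obtain z where z: "poly q z = 0" using fundamental_theorem_of_algebra by blast
  then obtain q' where q': "q = [:-z, 1:] * q'" using poly_eq_0_iff_dvd by (metis dvdE)
  have "q' \<noteq> 0" using q' Suc(2) by auto
  then have "degree q = Suc (degree q')"
    unfolding q' by (subst degree_mult_eq) auto
  then have "d = degree q'" using Suc(2) by simp
  moreover have "poly q' (of_real t) \<noteq> 0" if "0 \<le> t" "t \<le> norm a" for t
    using Suc(3)[OF that] by (auto simp: q')
  ultimately obtain c' where c': "c' > 0" "\<And>\<xi>. c' * norm \<xi> \<le> norm (complex_op_poly q' a \<xi>)"
    using Suc(1) by blast
  have "z \<notin> of_real ` {0..norm a}" using Suc(3) z by auto
  then obtain c where c: "c > 0" "\<And>\<xi>. c * norm \<xi> \<le> norm (blinfun_apply a \<xi> - z *\<^sub>C \<xi>)"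
    using pos_op_minus_scalar_bounded_below[OF assms(1)] by blast
  have "c * c' * norm \<xi> \<le> norm (complex_op_poly q a \<xi>)" for \<xi>
  proof -
    have "c * c' * norm \<xi> \<le> c * norm (complex_op_poly q' a \<xi>)"
      using c' c by (simp add: mult.assoc)
    also have "\<dots> \<le> norm (complex_op_poly q a \<xi>)"
      using assms(1) c(2) by (simp add: q' complex_op_poly_linear_factor pos_op_def del: mult_pCons_left)
    finally show ?thesis .
  qed
  then show ?case using c c' by (intro exI[of _ "c * c'"]) auto
qed

text \<open>With \<open>l = norm T\<close>, the vector \<open>(T\<^sup>2 - l\<^sup>2) \<xi>\<close> has squared norm at most
  \<open>l\<^sup>2 (l\<^sup>2 (norm \<xi>)\<^sup>2 - (norm (T \<xi>))\<^sup>2)\<close>, which is small where \<open>norm (T \<xi>)\<close> is close to \<open>l * norm \<xi>\<close>.\<close>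

lemma self_adjoint_eq_0_if_bounded_below:
  fixes T :: "'h::complex_hilbert op"
  assumes adj: "is_adjoint T T" and "c > 0"
    and below: "\<And>\<xi>. c * norm \<xi> \<le> norm (blinfun_apply (T o\<^sub>L T) \<xi> - (norm T)\<^sup>2 *\<^sub>R \<xi>)"
  shows "T = 0"
proof (rule ccontr)
  assume "T \<noteq> 0"
  define l where "l = norm T"
  have l: "l > 0" using \<open>T \<noteq> 0\<close> by (simp add: l_def)
  have ineq: "c\<^sup>2 * (norm \<xi>)\<^sup>2 \<le> l\<^sup>2 * (l\<^sup>2 * (norm \<xi>)\<^sup>2 - (norm (blinfun_apply T \<xi>))\<^sup>2)" for \<xi>
  proof -
    define \<eta> where "\<eta> = blinfun_apply T (blinfun_apply T \<xi>)"
    have eq: "\<eta> + (- of_real (l\<^sup>2)) *\<^sub>C \<xi> = \<eta> - l\<^sup>2 *\<^sub>R \<xi>"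
      using scaleR_scaleC[of "- l\<^sup>2" \<xi>] by simp
    have "cinner \<eta> \<xi> = of_real ((norm (blinfun_apply T \<xi>))\<^sup>2)"
      using adj by (simp add: \<eta>_def is_adjoint_def cinner_self)
    then have "(norm (\<eta> - l\<^sup>2 *\<^sub>R \<xi>))\<^sup>2 =
        (norm \<eta>)\<^sup>2 - 2 * l\<^sup>2 * (norm (blinfun_apply T \<xi>))\<^sup>2 + (l\<^sup>2)\<^sup>2 * (norm \<xi>)\<^sup>2"
      unfolding eq[symmetric] norm_add_scaleC_sq by (simp add: norm_power)
    moreover have "(c * norm \<xi>)\<^sup>2 \<le> (norm (\<eta> - l\<^sup>2 *\<^sub>R \<xi>))\<^sup>2"
      using below[of \<xi>] \<open>c > 0\<close> by (intro power_mono) (auto simp: \<eta>_def l_def)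
    moreover have "norm \<eta> \<le> l * norm (blinfun_apply T \<xi>)"
      unfolding \<eta>_def l_def by (rule norm_blinfun)
    then have "(norm \<eta>)\<^sup>2 \<le> (l * norm (blinfun_apply T \<xi>))\<^sup>2"
      by (rule power_mono) simp
    ultimately show ?thesis by (simp add: power_mult_distrib algebra_simps power2_eq_square)
  qed
  \<comment> \<open>Divided by the square of \<open>l\<close>, \<open>ineq\<close> says that
    \<open>r\<close> bounds \<open>T\<close>, while \<open>r < l = norm T\<close>. The
    \<open>max\<close> covers a negative difference.\<close>
  define r where "r = sqrt (max 0 (l\<^sup>2 - c\<^sup>2 / l\<^sup>2))"
  have "l \<le> r"
    unfolding l_def
  proof (rule norm_blinfun_bound)
    fix \<xi>
    have "l\<^sup>2 * (norm (blinfun_apply T \<xi>))\<^sup>2 \<le> l\<^sup>2 * ((l\<^sup>2 - c\<^sup>2 / l\<^sup>2) * (norm \<xi>)\<^sup>2)"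
      using ineq[of \<xi>] l by (simp add: algebra_simps)
    then have "(norm (blinfun_apply T \<xi>))\<^sup>2 \<le> (l\<^sup>2 - c\<^sup>2 / l\<^sup>2) * (norm \<xi>)\<^sup>2"
      using l by simp
    also have "\<dots> \<le> max 0 (l\<^sup>2 - c\<^sup>2 / l\<^sup>2) * (norm \<xi>)\<^sup>2"
      by (intro mult_right_mono) auto
    also have "\<dots> = (r * norm \<xi>)\<^sup>2"
      by (simp add: r_def power_mult_distrib)
    finally show "norm (blinfun_apply T \<xi>) \<le> r * norm \<xi>"
      by (rule power2_le_imp_le) (simp add: r_def)
  qed (simp add: r_def)
  moreover have "r < l"
    unfolding r_def using l \<open>c > 0\<close> by (intro real_less_lsqrt) auto
  ultimately show False by simp
qed

lemma poly_map_of_real: "poly (map_poly of_real P) (of_real t) = complex_of_real (poly P t)"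
  by (simp add: poly_altdef degree_map_poly coeff_map_poly)

text \<open>The polynomial \<open>P\<^sup>2 - (norm (P(a)))\<^sup>2\<close> has a root in \<open>{0..norm a}\<close>, since otherwise
  its value at \<open>a\<close> would be a product of factors bounded below.\<close>

lemma norm_op_poly_le:
  assumes "pos_op a" and le: "\<And>t. 0 \<le> t \<Longrightarrow> t \<le> norm a \<Longrightarrow> \<bar>poly P t\<bar> \<le> C"
  shows "norm (op_poly P a) \<le> C"
proof -
  define T where "T = op_poly P a"
  define Q where "Q = P * P - [:(norm T)\<^sup>2:]"
  have adj: "is_adjoint T T"
    using assms is_adjoint_op_poly unfolding T_def pos_op_def by blast
  have Q: "op_poly Q a = (T o\<^sub>L T) - (norm T)\<^sup>2 *\<^sub>R id_blinfun"
    by (simp add: Q_def op_poly_diff op_poly_mult op_poly_pCons T_def)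
  have "norm T \<le> C"
  proof (cases "\<exists>t. 0 \<le> t \<and> t \<le> norm a \<and> poly Q t = 0")
    case True
    then obtain t where t: "0 \<le> t" "t \<le> norm a" "poly Q t = 0" by blast
    then have "(poly P t)\<^sup>2 = (norm T)\<^sup>2" by (simp add: Q_def power2_eq_square)
    then have "\<bar>poly P t\<bar> = norm T"
      by (metis abs_norm_cancel power2_eq_iff_nonneg power2_abs abs_ge_zero)
    then show ?thesis using le t by metis
  next
    case False
    have "\<exists>c>0. \<forall>\<xi>. c * norm \<xi> \<le> norm (complex_op_poly (map_poly of_real Q) a \<xi>)"
      using False by (intro complex_op_poly_bounded_below[OF assms(1)]) (auto simp: poly_map_of_real)
    \<comment> \<open>The lower bound for \<open>Q\<close> at \<open>a\<close> is a lower bound for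
      \<open>T\<^sup>2 - (norm T)\<^sup>2\<close>, possible only for \<open>T = 0\<close>.\<close>
    then have "T = 0"
      using self_adjoint_eq_0_if_bounded_below[OF adj]
      by (auto simp: complex_op_poly_of_real Q blinfun.diff_left blinfun.scaleR_left)
    then show ?thesis using le[of 0] by simp
  qed
  then show ?thesis by (simp add: T_def)
qed

section \<open>Continuous functional calculus\<close>

lemma real_poly_approx:
  fixes f :: "real \<Rightarrow> real"
  assumes "continuous_on {a..b} f" "e > 0"
  obtains P where "\<And>t. t \<in> {a..b} \<Longrightarrow> \<bar>poly P t - f t\<bar> < e"
proof -
  obtain g where g: "real_polynomial_function g" "\<And>x. x \<in> {a..b} \<Longrightarrow> \<bar>f x - g x\<bar> < e"
    using Stone_Weierstrass_real_polynomial_function[OF compact_Icc assms] by blast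
  obtain c n where gc: "g = (\<lambda>x. \<Sum>i\<le>n. c i * x ^ i)"
    using g(1) real_polynomial_function_iff_sum by blast
  have "poly (\<Sum>i\<le>n. monom (c i) i) t = g t" for t
    by (simp add: gc poly_sum poly_monom)
  then show ?thesis
    using g(2) by (intro that[of "\<Sum>i\<le>n. monom (c i) i"]) (simp add: abs_minus_commute)
qed

lemma norm_op_poly_diff_le:
  assumes "pos_op a" "\<And>t. t \<in> {0..norm a} \<Longrightarrow> \<bar>poly P t - poly Q t\<bar> \<le> C"
  shows "norm (op_poly P a - op_poly Q a) \<le> C"
  using norm_op_poly_le[OF assms(1), of "P - Q" C] assms(2) by (simp add: op_poly_diff)

lemma continuous_on_sqrt [continuous_intros]: "continuous_on S sqrt"
  using continuous_on_real_sqrt[OF continuous_on_id, of S] by simp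

lemma uniform_poly_limit_exists:
  fixes f :: "real \<Rightarrow> real"
  assumes "continuous_on {a..b} f"
  obtains P where "uniform_limit {a..b} (\<lambda>n::nat. poly (P n)) f sequentially"
proof -
  have "\<exists>P. \<forall>t\<in>{a..b}. \<bar>poly P t - f t\<bar> < inverse (Suc n)" for n
    using real_poly_approx[OF assms, of "inverse (Suc n)"] by (metis inverse_positive_iff_positive of_nat_0_less_iff zero_less_Suc)
  then obtain P where P: "\<And>n t. t \<in> {a..b} \<Longrightarrow> \<bar>poly (P n) t - f t\<bar> < inverse (Suc n)"
    by metis
  have "uniform_limit {a..b} (\<lambda>n. poly (P n)) f sequentially"
  proof (rule uniform_limitI)
    fix e :: real assume "0 < e"
    with LIMSEQ_inverse_real_of_nat have "\<forall>\<^sub>F n in sequentially. inverse (Suc n) < e"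
      by (rule order_tendstoD)
    then show "\<forall>\<^sub>F n in sequentially. \<forall>t\<in>{a..b}. dist (poly (P n) t) (f t) < e"
      by eventually_elim (use P in \<open>force simp: dist_real_def simp del: of_nat_Suc intro: less_trans\<close>)
  qed
  then show ?thesis by (rule that)
qed

text \<open>Both halves of the definite description rest on \<open>close\<close>: with
  \<open>P\<close> in both places it makes the sequence Cauchy, and with two different approximating
  sequences it shows that the limits agree.\<close>

lemma cfc_tendsto:
  assumes a: "pos_op a" and "continuous_on {0..norm a} f"
    and P: "uniform_limit {0..norm a} (\<lambda>n. poly (P n)) f sequentially"
  shows "(\<lambda>n. op_poly (P n) a) \<longlonglongrightarrow> cfc f a"
proof -
  let ?S = "{0..norm a}"
  have close: "\<exists>N. \<forall>m\<ge>N. \<forall>n\<ge>N. norm (op_poly (Q m) a - op_poly (R n) a) < e"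
    if "e > 0" and Q: "uniform_limit ?S (\<lambda>n. poly (Q n)) f sequentially"
      and R: "uniform_limit ?S (\<lambda>n. poly (R n)) f sequentially" for e Q R
  proof -
    obtain N where N: "\<forall>n\<ge>N. \<forall>t\<in>?S. dist (poly (Q n) t) (f t) < e / 4"
      using Q[unfolded uniform_limit_sequentially_iff] \<open>e > 0\<close> by (metis zero_less_divide_iff zero_less_numeral)
    obtain N' where N': "\<forall>n\<ge>N'. \<forall>t\<in>?S. dist (poly (R n) t) (f t) < e / 4"
      using R[unfolded uniform_limit_sequentially_iff] \<open>e > 0\<close> by (metis zero_less_divide_iff zero_less_numeral)
    have "norm (op_poly (Q m) a - op_poly (R n) a) \<le> e / 2" if "m \<ge> max N N'" "n \<ge> max N N'" for m n
    proof (rule norm_op_poly_diff_le[OF a])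
      fix t assume "t \<in> ?S"
      then have "dist (poly (Q m) t) (f t) < e / 4" "dist (poly (R n) t) (f t) < e / 4"
        using that N N' by auto
      then show "\<bar>poly (Q m) t - poly (R n) t\<bar> \<le> e / 2" unfolding dist_real_def by linarith
    qed
    then show ?thesis using \<open>e > 0\<close> by (intro exI[of _ "max N N'"]) force
  qed
  have "Cauchy (\<lambda>n. op_poly (P n) a)"
    unfolding Cauchy_def dist_norm using close[OF _ P P] by blast
  then obtain b where b: "(\<lambda>n. op_poly (P n) a) \<longlonglongrightarrow> b"
    using Cauchy_convergent convergentD by blast
  have all: "(\<lambda>n. op_poly (Q n) a) \<longlonglongrightarrow> b"
    if "uniform_limit ?S (\<lambda>n. poly (Q n)) f sequentially" for Q
  proof -
    have "(\<lambda>n. op_poly (Q n) a - op_poly (P n) a) \<longlonglongrightarrow> 0"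
      unfolding LIMSEQ_iff using close[OF _ that P] by (metis diff_zero)
    from tendsto_add[OF this b] show ?thesis by simp
  qed
  have "cfc f a = b"
    unfolding cfc_def
  proof (rule the_equality)
    show "b' = b" if "\<forall>P. uniform_limit ?S (\<lambda>n. poly (P n)) f sequentially \<longrightarrow>
        (\<lambda>n. op_poly (P n) a) \<longlonglongrightarrow> b'" for b'
      using that P b LIMSEQ_unique by blast
  qed (use all in blast)
  then show ?thesis using b by simp
qed

text \<open>The quantitative form of the calculus: \<open>P = 0\<close> yields a norm bound,
  \<open>C = 0\<close> the evaluation at polynomials.\<close>

lemma cfc_approx:
  assumes a: "pos_op a" and f: "continuous_on {0..norm a} f"
    and le: "\<And>t. t \<in> {0..norm a} \<Longrightarrow> \<bar>poly P t - f t\<bar> \<le> C"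
  shows "norm (op_poly P a - cfc f a) \<le> C"
proof -
  obtain Q where Q: "uniform_limit {0..norm a} (\<lambda>n. poly (Q n)) f sequentially"
    using uniform_poly_limit_exists[OF f] .
  have lim: "(\<lambda>n. norm (op_poly P a - op_poly (Q n) a)) \<longlonglongrightarrow> norm (op_poly P a - cfc f a)"
    by (intro tendsto_norm tendsto_diff tendsto_const cfc_tendsto[OF a f Q])
  show ?thesis
  proof (rule field_le_epsilon)
    fix e :: real assume "e > 0"
    have "\<forall>\<^sub>F n in sequentially. norm (op_poly P a - op_poly (Q n) a) \<le> C + e"
      using uniform_limitD[OF Q \<open>e > 0\<close>]
    proof eventually_elim
      case (elim n)
      show ?case
        by (rule norm_op_poly_diff_le[OF a]) (use le elim in \<open>fastforce simp: dist_real_def\<close>)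
    qed
    then show "norm (op_poly P a - cfc f a) \<le> C + e"
      using tendsto_upperbound[OF lim] by simp
  qed
qed

lemma norm_cfc_le:
  assumes "pos_op a" "continuous_on {0..norm a} f" "\<And>t. t \<in> {0..norm a} \<Longrightarrow> \<bar>f t\<bar> \<le> C"
  shows "norm (cfc f a) \<le> C"
  using cfc_approx[OF assms(1,2), of 0 C] assms(3) by simp

lemma cfc_poly:
  assumes "pos_op a" "\<And>t. t \<in> {0..norm a} \<Longrightarrow> f t = poly P t"
  shows "cfc f a = op_poly P a"
proof -
  have "continuous_on {0..norm a} f"
    using assms(2) by (subst continuous_on_cong[OF refl, of _ _ "poly P"]) (auto intro: continuous_intros)
  then show ?thesis
    using cfc_approx[OF assms(1), of f P 0] assms(2) by simp
qed

lemma cfc_cong: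
  assumes "\<And>t. t \<in> {0..norm a} \<Longrightarrow> f t = g t"
  shows "cfc f a = cfc g a"
proof -
  have "uniform_limit {0..norm a} (\<lambda>n. poly (P n)) f sequentially \<longleftrightarrow>
      uniform_limit {0..norm a} (\<lambda>n. poly (P n)) g sequentially" for P :: "nat \<Rightarrow> real poly"
    by (rule uniform_limit_cong') (use assms in auto)
  then show ?thesis by (simp add: cfc_def)
qed

lemma cfc_mult:
  assumes a: "pos_op a" and f: "continuous_on {0..norm a} f" and g: "continuous_on {0..norm a} g"
  shows "cfc (\<lambda>t. f t * g t) a = cfc f a o\<^sub>L cfc g a"
proof -
  obtain P where P: "uniform_limit {0..norm a} (\<lambda>n. poly (P n)) f sequentially"
    using uniform_poly_limit_exists[OF f] .
  obtain Q where Q: "uniform_limit {0..norm a} (\<lambda>n. poly (Q n)) g sequentially"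
    using uniform_poly_limit_exists[OF g] .
  have "uniform_limit {0..norm a} (\<lambda>n t. poly (P n) t * poly (Q n) t) (\<lambda>t. f t * g t) sequentially"
    by (intro uniform_lim_mult P Q compact_imp_bounded compact_continuous_image f g) auto
  then have "(\<lambda>n. op_poly (P n * Q n) a) \<longlonglongrightarrow> cfc (\<lambda>t. f t * g t) a"
    by (intro cfc_tendsto a continuous_intros f g) (simp flip: poly_mult)
  moreover have "(\<lambda>n. op_poly (P n * Q n) a) \<longlonglongrightarrow> (cfc f a o\<^sub>L cfc g a)"
    unfolding op_poly_mult by (intro o_tendsto cfc_tendsto a f g P Q)
  ultimately show ?thesis by (rule LIMSEQ_unique)
qed

lemma cfc_diff:
  assumes a: "pos_op a" and f: "continuous_on {0..norm a} f" and g: "continuous_on {0..norm a} g"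
  shows "cfc (\<lambda>t. f t - g t) a = cfc f a - cfc g a"
proof -
  obtain P where P: "uniform_limit {0..norm a} (\<lambda>n. poly (P n)) f sequentially"
    using uniform_poly_limit_exists[OF f] .
  obtain Q where Q: "uniform_limit {0..norm a} (\<lambda>n. poly (Q n)) g sequentially"
    using uniform_poly_limit_exists[OF g] .
  have "uniform_limit {0..norm a} (\<lambda>n t. poly (P n) t - poly (Q n) t) (\<lambda>t. f t - g t) sequentially"
    by (intro uniform_limit_intros P Q)
  then have "(\<lambda>n. op_poly (P n - Q n) a) \<longlonglongrightarrow> cfc (\<lambda>t. f t - g t) a"
    by (intro cfc_tendsto a continuous_intros f g) (simp flip: poly_diff)
  moreover have "(\<lambda>n. op_poly (P n - Q n) a) \<longlonglongrightarrow> cfc f a - cfc g a"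
    unfolding op_poly_diff by (intro tendsto_diff cfc_tendsto a f g P Q)
  ultimately show ?thesis by (rule LIMSEQ_unique)
qed

text \<open>Applied to the algebra \<open>M\<close> and to the set of self-adjoint
  operators.\<close>

lemma cfc_in_sequentially_closed:
  assumes a: "pos_op a" and f: "continuous_on {0..norm a} f"
    and "\<And>P. op_poly P a \<in> S" "\<And>x l. (\<And>n::nat. x n \<in> S) \<Longrightarrow> x \<longlonglongrightarrow> l \<Longrightarrow> l \<in> S"
  shows "cfc f a \<in> S"
proof -
  obtain P where "uniform_limit {0..norm a} (\<lambda>n. poly (P n)) f sequentially"
    using uniform_poly_limit_exists[OF f] .
  from assms(4)[OF _ cfc_tendsto[OF a f this]] show ?thesis using assms(3) by blast
qed

lemma is_adjoint_cfc:
  assumes "pos_op a" "continuous_on {0..norm a} f"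
  shows "is_adjoint (cfc f a) (cfc f a)"
proof -
  have "cfc f a \<in> {x. is_adjoint x x}"
  proof (rule cfc_in_sequentially_closed[OF assms])
    show "op_poly P a \<in> {x. is_adjoint x x}" for P
      using assms(1) is_adjoint_op_poly by (auto simp: pos_op_def)
    show "l \<in> {x. is_adjoint x x}"
      if "\<And>n. x n \<in> {x. is_adjoint x x}" "x \<longlonglongrightarrow> l" for x :: "nat \<Rightarrow> 'a op" and l
      using that is_adjoint_limit[of x x l l] by simp
  qed
  then show ?thesis by simp
qed

section \<open>Closure properties of von Neumann algebras\<close>

lemma commutant_compose:
  assumes "x \<in> commutant S" "y \<in> commutant S"
  shows "x o\<^sub>L y \<in> commutant S"
  using assms unfolding commutant_def by (auto intro: clinear_ops_compose) (metis o_assoc)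

lemma commutant_id: "id_blinfun \<in> commutant S"
  by (auto simp: commutant_def clinear_ops_def)

lemma commutant_add: "x \<in> commutant S \<Longrightarrow> y \<in> commutant S \<Longrightarrow> x + y \<in> commutant S"
  by (auto simp: commutant_def clinear_ops_def o_add_left o_add_right blinfun.add_left scaleC_add_right)

lemma commutant_scaleC:
  assumes "x \<in> commutant S" "S \<subseteq> clinear_ops"
  shows "c *\<^sub>C x \<in> commutant S"
proof -
  have "y o\<^sub>L (c *\<^sub>C x) = (c *\<^sub>C x) o\<^sub>L y" if "y \<in> S" for y
  proof -
    have "y o\<^sub>L (c *\<^sub>C x) = c *\<^sub>C (y o\<^sub>L x)"
      using that assms(2) by (intro blinfun_eqI) (auto simp: blinfun_apply_scaleC clinear_ops_def)
    also have "y o\<^sub>L x = x o\<^sub>L y" using that assms(1) by (auto simp: commutant_def)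
    finally show ?thesis by (simp add: o_scaleC_left)
  qed
  then show ?thesis
    using assms(1) by (auto simp: commutant_def clinear_ops_def blinfun_apply_scaleC scaleC_scaleC mult.commute)
qed

lemma commutant_limit:
  assumes x: "\<And>n::nat. x n \<in> commutant S" and l: "x \<longlonglongrightarrow> l"
  shows "l \<in> commutant S"
proof -
  have "blinfun_apply l (c *\<^sub>C \<xi>) = c *\<^sub>C blinfun_apply l \<xi>" for c \<xi>
  proof (rule LIMSEQ_unique)
    show "(\<lambda>n. blinfun_apply (x n) (c *\<^sub>C \<xi>)) \<longlonglongrightarrow> blinfun_apply l (c *\<^sub>C \<xi>)"
      by (intro blinfun.tendsto l tendsto_const)
    have "(\<lambda>n. c *\<^sub>C blinfun_apply (x n) \<xi>) \<longlonglongrightarrow> c *\<^sub>C blinfun_apply l \<xi>"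
      by (intro bounded_linear.tendsto[OF bounded_linear_scaleC] blinfun.tendsto l tendsto_const)
    then show "(\<lambda>n. blinfun_apply (x n) (c *\<^sub>C \<xi>)) \<longlonglongrightarrow> c *\<^sub>C blinfun_apply l \<xi>"
      using x by (simp add: commutant_def clinear_ops_def)
  qed
  moreover have "y o\<^sub>L l = l o\<^sub>L y" if "y \<in> S" for y
  proof (rule LIMSEQ_unique)
    show "(\<lambda>n. y o\<^sub>L x n) \<longlonglongrightarrow> (y o\<^sub>L l)" by (intro o_tendsto l tendsto_const)
    have "(\<lambda>n. x n o\<^sub>L y) \<longlonglongrightarrow> (l o\<^sub>L y)" by (intro o_tendsto l tendsto_const)
    then show "(\<lambda>n. y o\<^sub>L x n) \<longlonglongrightarrow> (l o\<^sub>L y)" using x that by (simp add: commutant_def)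
  qed
  ultimately show ?thesis by (simp add: commutant_def clinear_ops_def)
qed

locale vn_algebra =
  fixes M :: "'h::complex_hilbert op set"
  assumes vn: "von_neumann_algebra M"
begin

text \<open>Source of the algebraic and topological closure properties below: each holds for every
  commutant (of complex-linear operators, for scalars), in particular for that of
  \<open>commutant M\<close>.\<close>

lemma bicommutant: "M = commutant (commutant M)"
  using vn by (simp add: von_neumann_algebra_def)

lemma M_clinear: "x \<in> M \<Longrightarrow> x \<in> clinear_ops"
  using vn by (auto simp: von_neumann_algebra_def)

lemma M_id [simp]: "id_blinfun \<in> M"
  by (subst bicommutant) (rule commutant_id)

lemma M_compose [simp]: "x \<in> M \<Longrightarrow> y \<in> M \<Longrightarrow> x o\<^sub>L y \<in> M"
  by (subst bicommutant) (metis bicommutant commutant_compose)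

lemma M_add [simp]: "x \<in> M \<Longrightarrow> y \<in> M \<Longrightarrow> x + y \<in> M"
  by (subst bicommutant) (metis bicommutant commutant_add)

lemma M_scaleC [simp]: "x \<in> M \<Longrightarrow> c *\<^sub>C x \<in> M"
proof (subst bicommutant, rule commutant_scaleC)
  show "x \<in> commutant (commutant M)" if "x \<in> M" using that bicommutant by simp
qed (simp add: commutant_def)

lemma M_scaleR [simp]: "x \<in> M \<Longrightarrow> r *\<^sub>R x \<in> M"
  by (simp add: scaleR_scaleC)

lemma M_zero [simp]: "0 \<in> M"
  using M_scaleR[OF M_id, of 0] by simp

lemma M_diff [simp]: "x \<in> M \<Longrightarrow> y \<in> M \<Longrightarrow> x - y \<in> M"
  using M_add[of x "(-1) *\<^sub>R y"] M_scaleR[of y "-1"] by simp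

lemma M_limit: "(\<And>n::nat. x n \<in> M) \<Longrightarrow> x \<longlonglongrightarrow> l \<Longrightarrow> l \<in> M"
  by (subst bicommutant, rule commutant_limit) (use bicommutant in auto)

lemma is_adjoint_adj: "x \<in> M \<Longrightarrow> is_adjoint (adj x) x"
  using vn adj_eqI unfolding von_neumann_algebra_def by metis

lemma M_adj [simp]: "x \<in> M \<Longrightarrow> adj x \<in> M"
  using vn adj_eqI unfolding von_neumann_algebra_def by metis

lemma adj_adj [simp]: "x \<in> M \<Longrightarrow> adj (adj x) = x"
  using is_adjoint_adj is_adjoint_sym adj_eqI by blast

lemma norm_adj: "x \<in> M \<Longrightarrow> norm (adj x) = norm x"
  by (metis norm_adjoint_le is_adjoint_adj is_adjoint_sym order_antisym)

lemma adj_compose [simp]: "x \<in> M \<Longrightarrow> y \<in> M \<Longrightarrow> adj (x o\<^sub>L y) = adj y o\<^sub>L adj x"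
  by (intro adj_eqI is_adjoint_compose is_adjoint_adj)

lemma adj_id [simp]: "adj id_blinfun = id_blinfun"
  by (rule adj_eqI[OF is_adjoint_id])

lemma adj_add: "x \<in> M \<Longrightarrow> y \<in> M \<Longrightarrow> adj (x + y) = adj x + adj y"
  by (intro adj_eqI is_adjoint_add is_adjoint_adj)

lemma adj_scaleC: "x \<in> M \<Longrightarrow> adj (c *\<^sub>C x) = cnj c *\<^sub>C adj x"
  by (intro adj_eqI is_adjoint_scaleC is_adjoint_adj)

lemma M_opow [simp]: "x \<in> M \<Longrightarrow> opow x n \<in> M"
  by (induction n) (simp_all add: opow_Suc)

lemma M_sum: "(\<And>i. i \<in> S \<Longrightarrow> f i \<in> M) \<Longrightarrow> sum f S \<in> M"
  by (induction S rule: infinite_finite_induct) auto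

lemma M_op_poly [simp]: "x \<in> M \<Longrightarrow> op_poly P x \<in> M"
  by (simp add: op_poly_opow M_sum)

lemma M_cfc: "a \<in> M \<Longrightarrow> pos_op a \<Longrightarrow> continuous_on {0..norm a} f \<Longrightarrow> cfc f a \<in> M"
  by (rule cfc_in_sequentially_closed) (auto intro: M_limit)

lemma pos_op_modulus_square: "x \<in> M \<Longrightarrow> pos_op (adj x o\<^sub>L x)"
  by (intro pos_op_adjoint_compose is_adjoint_adj M_clinear) auto

lemma norm_adj_compose: "x \<in> M \<Longrightarrow> norm (adj x o\<^sub>L x) = (norm x)\<^sup>2"
  by (intro norm_adjoint_compose is_adjoint_adj)

lemma cfc_sqrt:
  assumes "a \<in> M" "pos_op a"
  shows "cfc sqrt a \<in> M" "pos_op (cfc sqrt a)" "cfc sqrt a o\<^sub>L cfc sqrt a = a"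
proof -
  show "cfc sqrt a \<in> M" using assms by (intro M_cfc continuous_intros)
  have "cfc (\<lambda>t. sqrt t * sqrt t) a = op_poly [:0, 1:] a"
    by (rule cfc_poly[OF assms(2)]) simp
  then show "cfc sqrt a o\<^sub>L cfc sqrt a = a"
    using cfc_mult[OF assms(2), of sqrt sqrt] by (simp add: op_poly_X continuous_intros)
  \<comment> \<open>Positivity of the square root comes from the fourth root:
    \<open>cfc sqrt a\<close> is the square of the self-adjoint \<open>r\<close>.\<close>
  have cont: "continuous_on {0..norm a} (\<lambda>t. sqrt (sqrt t))" by (intro continuous_intros)
  define r where "r = cfc (\<lambda>t. sqrt (sqrt t)) a"
  have "pos_op (r o\<^sub>L r)"
    unfolding r_def using assms cont by (intro pos_op_square is_adjoint_cfc M_clinear M_cfc)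
  moreover have "cfc (\<lambda>t. sqrt (sqrt t) * sqrt (sqrt t)) a = r o\<^sub>L r"
    unfolding r_def by (rule cfc_mult[OF assms(2) cont cont])
  moreover have "cfc (\<lambda>t. sqrt (sqrt t) * sqrt (sqrt t)) a = cfc sqrt a"
    by (rule cfc_cong) simp
  ultimately show "pos_op (cfc sqrt a)" by simp
qed

lemma op_abs:
  assumes "x \<in> M"
  shows "op_abs x \<in> M" "pos_op (op_abs x)" "op_abs x o\<^sub>L op_abs x = adj x o\<^sub>L x"
  using cfc_sqrt[OF _ pos_op_modulus_square[OF assms]] assms by (simp_all add: op_abs_def)

text \<open>The exponent 0 is excluded because \<open>0 powr 0 = 0\<close>, whereas
  \<open>0 ^ 0 = 1\<close>.\<close>

lemma cfc_powr:
  assumes "pos_op b" "n \<ge> 1" "p = real n"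
  shows "cfc (\<lambda>t. t powr p) b = opow b n"
proof -
  have "cfc (\<lambda>t. t powr p) b = op_poly ([:0, 1:] ^ n) b"
    using assms by (intro cfc_poly) (auto simp: powr_realpow' )
  then show ?thesis by (simp add: op_poly_power op_poly_X)
qed

lemma p_norm_1: "x \<in> M \<Longrightarrow> p_norm \<phi> 1 x = Re (\<phi> (op_abs x)) powr 1"
  unfolding p_norm_def using cfc_powr[of "op_abs x" 1 1] op_abs[of x] by simp

text \<open>An even power of the modulus is a power of \<open>adj x o\<^sub>L x\<close>. Hence at
  these exponents the norm is given by the trace of a word in \<open>x\<close> and
  \<open>adj x\<close>.\<close>

lemma p_norm_power2:
  assumes "x \<in> M"
  shows "p_norm \<phi> (2 ^ Suc j) x = Re (\<phi> (opow (adj x o\<^sub>L x) (2 ^ j))) powr (1 / 2 ^ Suc j)"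
proof -
  have "cfc (\<lambda>t. t powr (2 ^ Suc j)) (op_abs x) = opow (op_abs x) (2 * 2 ^ j)"
    using op_abs[OF assms] by (intro cfc_powr) auto
  also have "\<dots> = opow (adj x o\<^sub>L x) (2 ^ j)"
    unfolding opow_mult using op_abs(3)[OF assms] by (simp add: opow_Suc numeral_2_eq_2)
  finally show ?thesis by (simp add: p_norm_def)
qed

lemma pos_op_bound_minus:
  assumes h: "h \<in> M" "pos_op h" and "norm h \<le> C"
  shows "pos_op (C *\<^sub>R id_blinfun - h)"
  unfolding pos_op_def
proof (intro conjI allI)
  show "C *\<^sub>R id_blinfun - h \<in> clinear_ops" using h by (intro M_clinear) simp
  show "is_adjoint (C *\<^sub>R id_blinfun - h) (C *\<^sub>R id_blinfun - h)"
    using h by (intro is_adjoint_diff is_adjoint_scaleR is_adjoint_id) (simp add: pos_op_def)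
  fix \<xi>
  have "Re (cinner \<xi> (blinfun_apply h \<xi>)) \<le> norm \<xi> * (norm h * norm \<xi>)"
    by (meson complex_Re_le_cmod cinner_cauchy_schwarz norm_blinfun order_trans mult_left_mono norm_ge_zero)
  also have "\<dots> \<le> C * (norm \<xi>)\<^sup>2"
    using mult_right_mono[OF assms(3), of "(norm \<xi>)\<^sup>2"] by (simp add: power2_eq_square mult_ac)
  finally show "0 \<le> Re (cinner \<xi> (blinfun_apply (C *\<^sub>R id_blinfun - h) \<xi>))"
    by (simp add: blinfun.diff_left blinfun.scaleR_left cinner_diff_right cinner_scaleR_right
        cinner_self del: of_real_power)
qed

text \<open>For a polynomial \<open>g\<close> close to \<open>1 / sqrt (t + \<delta>)\<close>, the element \<open>x g(x\<^sup>* x)\<close> is a substitute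
  for the partial isometry in the polar decomposition of \<open>x\<close>.\<close>

lemma approximate_polar_decomposition:
  assumes x: "x \<in> M" and "e > 0"
  obtains g where "g \<in> M" "is_adjoint g g" "norm ((g o\<^sub>L (adj x o\<^sub>L x)) - op_abs x) \<le> e" "norm (x o\<^sub>L g) \<le> 1 + e"
    "norm (x - (x o\<^sub>L g o\<^sub>L op_abs x)) \<le> e"
proof -
  define a where "a = adj x o\<^sub>L x"
  have a: "a \<in> M" "pos_op a" "is_adjoint a a"
    using x pos_op_modulus_square by (auto simp: a_def pos_op_def)
  \<comment> \<open>Then \<open>sqrt \<delta> = e / 2\<close> bounds the error of
    \<open>t * h t\<close> as a substitute for \<open>sqrt t\<close>.\<close>
  define \<delta> where "\<delta> = (e / 2)\<^sup>2"
  define h where "h t = inverse (sqrt (t + \<delta>))" for t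
  have \<delta>: "\<delta> > 0" "sqrt \<delta> = e / 2" using \<open>e > 0\<close> by (auto simp: \<delta>_def)
  \<comment> \<open>The factor \<open>1 + norm a\<close> dominates both \<open>t\<close> and
    \<open>sqrt t\<close> on the segment, so either product with the approximation error of
    \<open>P\<close> stays below \<open>e / 2\<close>.\<close>
  define \<epsilon> where "\<epsilon> = e / (2 * (1 + norm a))"
  have "1 + norm a > 0" by (simp add: add_pos_nonneg)
  then have \<epsilon>: "\<epsilon> > 0" "\<epsilon> * (1 + norm a) = e / 2" using \<open>e > 0\<close> by (auto simp: \<epsilon>_def field_simps)
  have "continuous_on {0..norm a} h"
    unfolding h_def using \<delta>(1) by (intro continuous_intros) auto
  then obtain P where P: "\<And>t. t \<in> {0..norm a} \<Longrightarrow> \<bar>poly P t - h t\<bar> < \<epsilon>"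
    using real_poly_approx \<epsilon>(1) by blast
  have P_le: "\<bar>poly P t - h t\<bar> * s \<le> e / 2" if "t \<in> {0..norm a}" "0 \<le> s" "s \<le> 1 + norm a" for t s
  proof -
    have "\<bar>poly P t - h t\<bar> * s \<le> \<epsilon> * (1 + norm a)"
      using P[OF that(1)] that \<epsilon>(1) by (intro mult_mono) auto
    then show ?thesis using \<epsilon>(2) by simp
  qed
  have sqrt_le: "sqrt t \<le> 1 + norm a" if "t \<in> {0..norm a}" for t
    using that by (intro real_le_lsqrt) (auto simp: power2_eq_square algebra_simps intro: order_trans[of _ "norm a"])
  have h_bounds: "0 \<le> sqrt t * h t" "sqrt t * h t \<le> 1" "\<bar>sqrt t - h t * t\<bar> \<le> e / 2" if "0 \<le> t" for t
  proof -
    have pos: "sqrt (t + \<delta>) > 0" using that \<delta> by simp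
    have "sqrt (t + \<delta>) \<le> sqrt t + sqrt \<delta>" using that \<delta> by (intro sqrt_add_le_add_sqrt) auto
    moreover have mono: "sqrt t \<le> sqrt (t + \<delta>)" using \<delta> by simp
    ultimately have d: "0 \<le> sqrt (t + \<delta>) - sqrt t" "sqrt (t + \<delta>) - sqrt t \<le> e / 2" using \<delta>(2) by auto
    show 1: "0 \<le> sqrt t * h t" using that \<delta> by (simp add: h_def)
    show 2: "sqrt t * h t \<le> 1" using pos mono by (simp add: h_def field_simps)
    have "sqrt t - h t * t = (sqrt t * h t) * (sqrt (t + \<delta>) - sqrt t)"
      using pos that unfolding h_def right_diff_distrib
      by (simp add: mult.assoc[symmetric]) (simp add: mult.commute mult.left_commute)
    moreover have "(sqrt t * h t) * (sqrt (t + \<delta>) - sqrt t) \<le> 1 * (e / 2)"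
      using 1 2 d by (intro mult_mono) auto
    ultimately show "\<bar>sqrt t - h t * t\<bar> \<le> e / 2"
      using 1 d by simp
  qed
  define g where "g = op_poly P a"
  have g: "g \<in> M" "is_adjoint g g" using a is_adjoint_op_poly by (auto simp: g_def)
  have sqrt_a: "cfc sqrt a = op_abs x" by (simp add: a_def op_abs_def)
  have key: "\<bar>poly P t * t - sqrt t\<bar> \<le> e" if "t \<in> {0..norm a}" for t
  proof -
    have "poly P t * t - sqrt t = (poly P t - h t) * t - (sqrt t - h t * t)"
      by (simp add: algebra_simps)
    moreover have "\<bar>(poly P t - h t) * t\<bar> \<le> e / 2"
      using P_le[of t t] that by (simp add: abs_mult)
    moreover have "\<bar>sqrt t - h t * t\<bar> \<le> e / 2" using h_bounds(3) that by simp
    ultimately show ?thesis by linarith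
  qed
  have "norm ((g o\<^sub>L a) - op_abs x) \<le> e"
    using cfc_approx[OF a(2), of sqrt "P * [:0,1:]" e] key
    by (simp add: op_poly_mult op_poly_X g_def sqrt_a continuous_intros mult.commute del: mult_pCons_right)
  moreover have "norm (x o\<^sub>L g) \<le> 1 + e"
  proof (rule power2_le_imp_le)
    \<comment> \<open>As \<open>g\<close> is self-adjoint, the squared norm is that of
      \<open>g o\<^sub>L a o\<^sub>L g\<close>, a polynomial in \<open>a\<close>, and can be
      estimated pointwise on the segment.\<close>
    have "(norm (x o\<^sub>L g))\<^sup>2 = norm (op_poly (P * [:0,1:] * P) a)"
      using norm_adj_compose[of "x o\<^sub>L g"] x g adj_eqI[OF g(2)]
      by (simp add: op_poly_mult op_poly_X a_def o_assoc g_def del: mult_pCons_right)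
    also have "\<dots> \<le> (1 + e)\<^sup>2"
    proof (rule norm_op_poly_le[OF a(2)])
      fix t assume t: "0 \<le> t" "t \<le> norm a"
      have "\<bar>sqrt t * poly P t\<bar> \<le> \<bar>sqrt t * h t\<bar> + \<bar>poly P t - h t\<bar> * sqrt t"
      proof -
        have "sqrt t * poly P t = sqrt t * h t + (poly P t - h t) * sqrt t" by (simp add: algebra_simps)
        moreover have "\<bar>(poly P t - h t) * sqrt t\<bar> = \<bar>poly P t - h t\<bar> * sqrt t" using t by (simp add: abs_mult)
        ultimately show ?thesis by (metis abs_triangle_ineq)
      qed
      also have "\<dots> \<le> 1 + e"
        using h_bounds[of t] P_le[of t "sqrt t"] sqrt_le[of t] t \<open>e > 0\<close> by auto
      finally have "\<bar>sqrt t * poly P t\<bar>\<^sup>2 \<le> (1 + e)\<^sup>2" by (rule power_mono) simp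
      moreover have "poly (P * [:0,1:] * P) t = (sqrt t * poly P t)\<^sup>2"
        using t by (simp add: power_mult_distrib power2_eq_square[of "poly P t"])
      ultimately show "\<bar>poly (P * [:0,1:] * P) t\<bar> \<le> (1 + e)\<^sup>2" by simp
    qed
    finally show "(norm (x o\<^sub>L g))\<^sup>2 \<le> (1 + e)\<^sup>2" .
  qed (use \<open>e > 0\<close> in simp)
  moreover have "norm (x - (x o\<^sub>L g o\<^sub>L op_abs x)) \<le> e"
  proof (rule power2_le_imp_le)
    \<comment> \<open>The difference is \<open>x o\<^sub>L D\<close> with
      \<open>D = cfc f a\<close>. Its squared norm is that of
      \<open>D o\<^sub>L a o\<^sub>L D\<close>, governed by
      \<open>sqrt t * f t = sqrt t - poly P t * t\<close>, which \<open>key\<close> bounds by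
      \<open>e\<close>.\<close>
    define f where "f t = 1 - poly P t * sqrt t" for t
    have cont: "continuous_on {0..norm a} f" "continuous_on {0..norm a} (\<lambda>t. poly P t * sqrt t)"
      "continuous_on {0..norm a} (\<lambda>t. t)" "continuous_on {0..norm a} (\<lambda>t. f t * t)"
      unfolding f_def by (intro continuous_intros continuous_on_poly)+
    define D where "D = id_blinfun - (g o\<^sub>L op_abs x)"
    have "cfc (\<lambda>t. poly P t * sqrt t) a = g o\<^sub>L op_abs x"
      using cfc_mult[OF a(2), of "poly P" sqrt] cfc_poly[OF a(2), of "poly P" P]
      by (simp add: g_def sqrt_a continuous_intros continuous_on_poly)
    moreover have "cfc (\<lambda>t. 1) a = id_blinfun"
      using cfc_poly[OF a(2), of "\<lambda>t. 1" 1] by simp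
    ultimately have D: "cfc f a = D"
      using cfc_diff[OF a(2) _ cont(2), of "\<lambda>t. 1"] by (simp add: f_def[abs_def] D_def continuous_intros)
    have "D \<in> M" using a cont unfolding D[symmetric] by (intro M_cfc)
    moreover have "adj D = D" using a cont unfolding D[symmetric] by (intro adj_eqI is_adjoint_cfc)
    ultimately have "(norm (x o\<^sub>L D))\<^sup>2 = norm (D o\<^sub>L a o\<^sub>L D)"
      using norm_adj_compose[of "x o\<^sub>L D"] x by (simp add: a_def o_assoc)
    also have "x o\<^sub>L D = x - (x o\<^sub>L g o\<^sub>L op_abs x)" by (simp add: D_def o_diff_right o_assoc)
    also have "D o\<^sub>L a o\<^sub>L D = cfc (\<lambda>t. f t * t * f t) a"
      using cfc_mult[OF a(2) cont(4,1)] cfc_mult[OF a(2) cont(1,3)] cfc_poly[OF a(2), of "\<lambda>t. t" "[:0,1:]"]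
      by (simp add: D op_poly_X)
    also have "norm \<dots> \<le> e\<^sup>2"
    proof (rule norm_cfc_le[OF a(2)])
      show "continuous_on {0..norm a} (\<lambda>t. f t * t * f t)" by (intro continuous_intros cont)
      fix t assume t: "t \<in> {0..norm a}"
      have "sqrt t * f t = sqrt t - poly P t * (sqrt t * sqrt t)"
        by (simp add: f_def algebra_simps)
      then have "\<bar>sqrt t * f t\<bar> \<le> e"
        using key[OF t] t by (simp add: abs_minus_commute)
      then have "\<bar>sqrt t * f t\<bar>\<^sup>2 \<le> e\<^sup>2" by (rule power_mono) simp
      moreover have "f t * t * f t = (sqrt t * f t)\<^sup>2"
        using t by (simp add: power_mult_distrib power2_eq_square[of "f t"])
      ultimately show "\<bar>f t * t * f t\<bar> \<le> e\<^sup>2" by simp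
    qed
    finally show "(norm (x - (x o\<^sub>L g o\<^sub>L op_abs x)))\<^sup>2 \<le> e\<^sup>2" .
  qed (use \<open>e > 0\<close> in simp)
  ultimately show ?thesis using that[OF g] unfolding a_def by blast
qed

end

section \<open>Trace inequalities\<close>

text \<open>Removes the error \<open>e\<close> of the approximate polar decomposition.\<close>

lemma le_if_le_add_mult:
  fixes a b c :: real
  assumes "\<And>e. e > 0 \<Longrightarrow> a \<le> b + e * c"
  shows "a \<le> b"
proof (rule tendsto_lowerbound)
  show "((\<lambda>e. b + e * c) \<longlongrightarrow> b) (at_right 0)"
    by (auto intro!: tendsto_eq_intros)
  show "\<forall>\<^sub>F e in at_right 0. a \<le> b + e * c"
    using assms by (auto simp: eventually_at_right_field intro: exI[of _ 1])
qed simp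

definition oprod :: "'h::complex_hilbert op list \<Rightarrow> 'h op" where
  "oprod xs = foldr (o\<^sub>L) xs id_blinfun"

lemma oprod_simps [simp]: "oprod [] = id_blinfun" "oprod (x # xs) = x o\<^sub>L oprod xs"
  by (simp_all add: oprod_def)

lemma oprod_append: "oprod (xs @ ys) = oprod xs o\<^sub>L oprod ys"
  by (induction xs) (simp_all add: o_assoc)

lemma oprod_concat_replicate: "oprod (concat (replicate m xs)) = opow (oprod xs) m"
  by (induction m) (simp_all add: oprod_append opow_Suc)

lemma prod_list_concat_replicate:
  "prod_list (map f (concat (replicate m xs))) = (prod_list (map f xs) :: 'a::comm_monoid_mult) ^ m"
  by (induction m) simp_all

text \<open>An unpaired last letter is dropped, which is why products are compared only for words of
  even length.\<close>

fun compose_pairs :: "'h::complex_hilbert op list \<Rightarrow> 'h op list" where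
  "compose_pairs (x # y # xs) = (x o\<^sub>L y) # compose_pairs xs"
| "compose_pairs _ = []"

lemma length_compose_pairs: "length (compose_pairs xs) = length xs div 2"
  by (induction xs rule: compose_pairs.induct) auto

lemma oprod_compose_pairs: "even (length xs) \<Longrightarrow> oprod (compose_pairs xs) = oprod xs"
  by (induction xs rule: compose_pairs.induct) (auto simp: o_assoc)

lemma opow_compose_commute: "opow (u o\<^sub>L v) k o\<^sub>L u = u o\<^sub>L opow (v o\<^sub>L u) k"
  by (induction k) (simp_all add: opow_Suc o_assoc)

locale tracial_vn_algebra = vn_algebra M for M :: "'h::complex_hilbert op set" +
  fixes \<phi> :: "'h op \<Rightarrow> complex"
  assumes state: "faithful_normal_tracial_state M \<phi>"
begin

section \<open>Positivity of the trace and its duality with the trace norm\<close>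

lemma phi_add: "x \<in> M \<Longrightarrow> y \<in> M \<Longrightarrow> \<phi> (x + y) = \<phi> x + \<phi> y"
  and phi_scaleC: "x \<in> M \<Longrightarrow> \<phi> (c *\<^sub>C x) = c * \<phi> x"
  and phi_id: "\<phi> id_blinfun = 1"
  and phi_trace: "x \<in> M \<Longrightarrow> y \<in> M \<Longrightarrow> \<phi> (x o\<^sub>L y) = \<phi> (y o\<^sub>L x)"
  and phi_modulus_square: "x \<in> M \<Longrightarrow> \<phi> (adj x o\<^sub>L x) \<in> \<real>\<^sub>\<ge>\<^sub>0"
  using state by (auto simp: faithful_normal_tracial_state_def clinear_on_def)

lemma phi_scaleR: "x \<in> M \<Longrightarrow> \<phi> (r *\<^sub>R x) = of_real r * \<phi> x"
  by (simp add: scaleR_scaleC phi_scaleC)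

lemma phi_diff: "x \<in> M \<Longrightarrow> y \<in> M \<Longrightarrow> \<phi> (x - y) = \<phi> x - \<phi> y"
  using phi_add[of "x - y" y] by simp

lemma phi_modulus_square_real: "x \<in> M \<Longrightarrow> \<phi> (adj x o\<^sub>L x) = of_real (Re (\<phi> (adj x o\<^sub>L x)))"
  and phi_modulus_square_nonneg: "x \<in> M \<Longrightarrow> 0 \<le> Re (\<phi> (adj x o\<^sub>L x))"
  using phi_modulus_square[of x] by (auto simp: complex_nonneg_Reals_iff complex_eq_iff)

lemma phi_form_expand:
  assumes "x \<in> M" "y \<in> M"
  shows "\<phi> (adj (x + c *\<^sub>C y) o\<^sub>L (x + c *\<^sub>C y)) = \<phi> (adj x o\<^sub>L x) +
    (c * \<phi> (adj x o\<^sub>L y) + cnj c * \<phi> (adj y o\<^sub>L x)) + of_real ((cmod c)\<^sup>2) * \<phi> (adj y o\<^sub>L y)"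
proof -
  have lin: "adj z o\<^sub>L (c *\<^sub>C y) = c *\<^sub>C (adj z o\<^sub>L y)" if "z \<in> M" for z
    using M_clinear[OF M_adj[OF that]]
    by (intro blinfun_eqI) (simp add: blinfun_apply_scaleC clinear_ops_def)
  have "adj (x + c *\<^sub>C y) o\<^sub>L (x + c *\<^sub>C y) = (adj x o\<^sub>L x) + c *\<^sub>C (adj x o\<^sub>L y) +
      (cnj c *\<^sub>C (adj y o\<^sub>L x) + cnj c *\<^sub>C c *\<^sub>C (adj y o\<^sub>L y))"
    using assms by (simp add: adj_add adj_scaleC o_add_left o_add_right o_scaleC_left lin)
  then show ?thesis
    using assms by (simp add: phi_add phi_scaleC mult_cnj_self[symmetric] algebra_simps)
qed

text \<open>Polarisation: \<open>\<phi>\<close> is real on every \<open>adj z o\<^sub>L z\<close>,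
  and \<open>z = x + c *\<^sub>C y\<close> with \<open>c = 1\<close> and \<open>c = \<i>\<close>
  determines the imaginary and the real part of the difference.\<close>

lemma phi_hermitian:
  assumes "x \<in> M" "y \<in> M"
  shows "\<phi> (adj y o\<^sub>L x) = cnj (\<phi> (adj x o\<^sub>L y))"
proof -
  have "Im (c * \<phi> (adj x o\<^sub>L y) + cnj c * \<phi> (adj y o\<^sub>L x)) = 0" for c
  proof -
    have "Im (\<phi> (adj z o\<^sub>L z)) = 0" if "z \<in> M" for z
      using phi_modulus_square_real[OF that] by (metis Im_complex_of_real)
    then have "Im (\<phi> (adj (x + c *\<^sub>C y) o\<^sub>L (x + c *\<^sub>C y))) = 0"
      "Im (\<phi> (adj x o\<^sub>L x)) = 0" "Im (\<phi> (adj y o\<^sub>L y)) = 0"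
      using assms by simp_all
    then show ?thesis
      unfolding phi_form_expand[OF assms] by (simp add: plus_complex.sel times_complex.sel del: of_real_power)
  qed
  from this[of 1] this[of \<i>] show ?thesis by (simp add: complex_eq_iff)
qed

lemma phi_cauchy_schwarz:
  assumes "x \<in> M" "y \<in> M"
  shows "(cmod (\<phi> (adj x o\<^sub>L y)))\<^sup>2 \<le> Re (\<phi> (adj x o\<^sub>L x)) * Re (\<phi> (adj y o\<^sub>L y))"
proof (rule hermitian_form_cauchy_schwarz)
  fix c
  have "Re (\<phi> (adj (x + c *\<^sub>C y) o\<^sub>L (x + c *\<^sub>C y))) = Re (\<phi> (adj x o\<^sub>L x)) +
      2 * Re (c * \<phi> (adj x o\<^sub>L y)) + (cmod c)\<^sup>2 * Re (\<phi> (adj y o\<^sub>L y))"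
    unfolding phi_form_expand[OF assms] phi_hermitian[OF assms] by (simp del: of_real_power)
  then show "0 \<le> Re (\<phi> (adj x o\<^sub>L x)) +
      2 * Re (c * \<phi> (adj x o\<^sub>L y)) + (cmod c)\<^sup>2 * Re (\<phi> (adj y o\<^sub>L y))"
    using phi_modulus_square_nonneg[of "x + c *\<^sub>C y"] assms by simp
qed (rule phi_modulus_square_nonneg[OF assms(2)])

lemma adj_pos_op: "pos_op a \<Longrightarrow> adj a = a"
  by (simp add: pos_op_def adj_eqI)

lemma phi_pos_op:
  assumes "h \<in> M" "pos_op h"
  shows "\<phi> h = of_real (Re (\<phi> h))" "0 \<le> Re (\<phi> h)"
  using phi_modulus_square_real[of "cfc sqrt h"] phi_modulus_square_nonneg[of "cfc sqrt h"]
    cfc_sqrt[OF assms] adj_pos_op[of "cfc sqrt h"] by simp_all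

text \<open>Write \<open>C - h\<close> as \<open>w o\<^sub>L w\<close> with \<open>w\<close>
  self-adjoint; the difference of the two sides is then the trace of
  \<open>adj (w o\<^sub>L x) o\<^sub>L (w o\<^sub>L x)\<close>.\<close>

lemma phi_conjugate_le:
  assumes h: "h \<in> M" "pos_op h" and "norm h \<le> C" and x: "x \<in> M"
  shows "Re (\<phi> (adj x o\<^sub>L h o\<^sub>L x)) \<le> C * Re (\<phi> (adj x o\<^sub>L x))"
proof -
  define k where "k = C *\<^sub>R id_blinfun - h"
  have k: "k \<in> M" "pos_op k" using h pos_op_bound_minus[OF assms(1-3)] by (auto simp: k_def)
  define w where "w = cfc sqrt k"
  have w: "w \<in> M" "adj w = w" "w o\<^sub>L w = k"
    using cfc_sqrt[OF k] adj_pos_op by (auto simp: w_def)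
  have "adj (w o\<^sub>L x) o\<^sub>L (w o\<^sub>L x) = adj x o\<^sub>L ((w o\<^sub>L w) o\<^sub>L x)"
    using w(1,2) x by (simp add: o_assoc)
  also have "\<dots> = C *\<^sub>R (adj x o\<^sub>L x) - (adj x o\<^sub>L h o\<^sub>L x)"
    by (simp add: w(3) k_def o_diff_left o_diff_right o_scaleR_left o_scaleR_right o_assoc)
  finally show ?thesis
    using phi_modulus_square_nonneg[of "w o\<^sub>L x"] w x h by (simp add: phi_diff phi_scaleR)
qed

text \<open>With \<open>h = s o\<^sub>L s\<close> the trace property moves one \<open>s\<close> to
  the front; Cauchy-Schwarz applies to \<open>s\<close> and \<open>c o\<^sub>L s\<close>, and
  \<open>phi_conjugate_le\<close> extracts the norm of \<open>c\<close>.\<close>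

lemma cmod_phi_compose_pos_le:
  assumes h: "h \<in> M" "pos_op h" and c: "c \<in> M"
  shows "cmod (\<phi> (c o\<^sub>L h)) \<le> norm c * Re (\<phi> h)"
proof -
  define s where "s = cfc sqrt h"
  have s: "s \<in> M" "adj s = s" "s o\<^sub>L s = h"
    using cfc_sqrt[OF h] adj_pos_op by (auto simp: s_def)
  have "\<phi> (c o\<^sub>L h) = \<phi> (adj s o\<^sub>L (c o\<^sub>L s))"
    using phi_trace[of "c o\<^sub>L s" s] s c by (simp add: o_assoc)
  moreover have "adj (c o\<^sub>L s) o\<^sub>L (c o\<^sub>L s) = adj s o\<^sub>L (adj c o\<^sub>L c) o\<^sub>L s"
    using s(1,2) c by (simp add: o_assoc)
  ultimately have "(cmod (\<phi> (c o\<^sub>L h)))\<^sup>2 \<le> Re (\<phi> h) * Re (\<phi> (adj s o\<^sub>L (adj c o\<^sub>L c) o\<^sub>L s))"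
    using phi_cauchy_schwarz[of s "c o\<^sub>L s"] s c by simp
  also have "\<dots> \<le> Re (\<phi> h) * ((norm c)\<^sup>2 * Re (\<phi> h))"
    using phi_conjugate_le[of "adj c o\<^sub>L c" "(norm c)\<^sup>2" s] pos_op_modulus_square[OF c] norm_adj_compose[OF c]
      s c phi_pos_op(2)[OF h] by (intro mult_left_mono) auto
  also have "\<dots> = (norm c * Re (\<phi> h))\<^sup>2" by (simp add: power2_eq_square)
  finally show ?thesis
    by (rule power2_le_imp_le) (simp add: phi_pos_op(2)[OF h])
qed

lemma cmod_phi_le_norm: "x \<in> M \<Longrightarrow> cmod (\<phi> x) \<le> norm x"
  using cmod_phi_compose_pos_le[of id_blinfun x] pos_op_modulus_square[OF M_id] by (simp add: phi_id)

lemma p_norm_1_eq: "x \<in> M \<Longrightarrow> p_norm \<phi> 1 x = Re (\<phi> (op_abs x))"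
  using phi_pos_op(2)[of "op_abs x"] op_abs[of x] by (simp add: p_norm_1)

lemma norm_compose_le: "norm x \<le> c \<Longrightarrow> norm y \<le> d \<Longrightarrow> norm (x o\<^sub>L y) \<le> c * d"
  by (meson norm_blinfun_compose order_trans mult_mono norm_ge_zero)

text \<open>Reduces to the positive case: up to an error \<open>e\<close> in operator norm,
  \<open>x\<close> is \<open>x o\<^sub>L g\<close> times its modulus, with
  \<open>norm (x o\<^sub>L g) \<le> 1 + e\<close>.\<close>

lemma cmod_phi_compose_le_p_norm_1:
  assumes x: "x \<in> M" and y: "y \<in> M"
  shows "cmod (\<phi> (y o\<^sub>L x)) \<le> norm y * p_norm \<phi> 1 x"
proof (rule le_if_le_add_mult)
  fix e :: real assume "e > 0"
  define b where "b = op_abs x"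
  have b: "b \<in> M" "pos_op b" using op_abs[OF x] by (auto simp: b_def)
  obtain g where g: "g \<in> M" "norm (x o\<^sub>L g) \<le> 1 + e" "norm (x - (x o\<^sub>L g o\<^sub>L b)) \<le> e"
    using approximate_polar_decomposition[OF x \<open>e > 0\<close>] unfolding b_def by blast
  define r where "r = x - (x o\<^sub>L g o\<^sub>L b)"
  have r: "r \<in> M" "norm r \<le> e" using x g b by (auto simp: r_def)
  have "y o\<^sub>L x = ((y o\<^sub>L (x o\<^sub>L g)) o\<^sub>L b) + (y o\<^sub>L r)"
    by (simp add: r_def o_diff_right o_assoc)
  then have "\<phi> (y o\<^sub>L x) = \<phi> ((y o\<^sub>L (x o\<^sub>L g)) o\<^sub>L b) + \<phi> (y o\<^sub>L r)"
    using x y g b r by (simp add: phi_add)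
  then have "cmod (\<phi> (y o\<^sub>L x)) \<le> cmod (\<phi> ((y o\<^sub>L (x o\<^sub>L g)) o\<^sub>L b)) + cmod (\<phi> (y o\<^sub>L r))"
    by (simp add: norm_triangle_ineq)
  also have "\<dots> \<le> norm (y o\<^sub>L (x o\<^sub>L g)) * Re (\<phi> b) + norm (y o\<^sub>L r)"
    using x y g b r by (intro add_mono cmod_phi_compose_pos_le cmod_phi_le_norm) auto
  also have "\<dots> \<le> (norm y * (1 + e)) * Re (\<phi> b) + norm y * e"
    using g r phi_pos_op(2)[OF b] by (intro add_mono mult_right_mono norm_compose_le) auto
  also have "\<dots> = norm y * p_norm \<phi> 1 x + e * (norm y * Re (\<phi> b) + norm y)"
    using p_norm_1_eq[OF x] by (simp add: b_def algebra_simps)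
  finally show "cmod (\<phi> (y o\<^sub>L x)) \<le> norm y * p_norm \<phi> 1 x + e * (norm y * Re (\<phi> b) + norm y)"
    unfolding b_def .
qed

lemma cmod_phi_le_p_norm_1: "x \<in> M \<Longrightarrow> cmod (\<phi> x) \<le> p_norm \<phi> 1 x"
proof -
  assume x: "x \<in> M"
  have "cmod (\<phi> x) \<le> norm (id_blinfun :: 'h op) * p_norm \<phi> 1 x"
    using cmod_phi_compose_le_p_norm_1[OF x M_id] by simp
  also have "\<dots> \<le> 1 * p_norm \<phi> 1 x"
    using norm_blinfun_id_le phi_pos_op(2) op_abs[OF x] by (intro mult_right_mono) (auto simp: p_norm_1_eq[OF x])
  finally show ?thesis by simp
qed

section \<open>Hoelder and Minkowski inequalities at the exponents \<open>2 ^ Suc j\<close>\<close>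

definition dnorm :: "nat \<Rightarrow> 'h op \<Rightarrow> real" where
  "dnorm j = p_norm \<phi> (2 ^ Suc j)"

text \<open>The power is the square of the self-adjoint \<open>opow s m\<close>, where
  \<open>s\<close> is the root of \<open>a\<close>.\<close>

lemma pos_op_opow:
  assumes "a \<in> M" "pos_op a"
  shows "pos_op (opow a m)"
proof -
  define s where "s = cfc sqrt a"
  have s: "s \<in> M" "is_adjoint s s" "s o\<^sub>L s = a"
    using cfc_sqrt[OF assms] by (auto simp: s_def pos_op_def)
  have "opow a m = opow s (2 * m)"
    unfolding opow_mult using s(3) by (simp add: opow_Suc numeral_2_eq_2)
  then have "opow a m = opow s m o\<^sub>L opow s m"
    by (simp add: mult_2 opow_add)
  then show ?thesis
    using s by (auto intro!: pos_op_square is_adjoint_opow M_clinear)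
qed

lemma phi_opow_modulus_square_nonneg: "x \<in> M \<Longrightarrow> 0 \<le> Re (\<phi> (opow (adj x o\<^sub>L x) m))"
  by (intro phi_pos_op pos_op_opow pos_op_modulus_square) auto

lemma dnorm_nonneg [simp]: "0 \<le> dnorm j x"
  by (simp add: dnorm_def p_norm_def)

lemma dnorm_power:
  assumes "x \<in> M"
  shows "dnorm j x ^ (2 ^ Suc j) = Re (\<phi> (opow (adj x o\<^sub>L x) (2 ^ j)))"
proof -
  define q where "q = Re (\<phi> (opow (adj x o\<^sub>L x) (2 ^ j)))"
  have dnorm: "dnorm j x = q powr (1 / 2 ^ Suc j)"
    unfolding dnorm_def q_def by (rule p_norm_power2[OF assms])
  show ?thesis
  proof (cases "q = 0")
    case False
    then have "q > 0" using phi_opow_modulus_square_nonneg[OF assms, of "2 ^ j"] by (simp add: q_def)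
    then have "dnorm j x ^ (2 ^ Suc j) = (q powr (1 / 2 ^ Suc j)) powr real (2 ^ Suc j)"
      unfolding dnorm by (subst powr_realpow) auto
    also have "\<dots> = q" using \<open>q > 0\<close> by (simp add: powr_powr)
    finally show ?thesis by (simp add: q_def)
  qed (use dnorm in \<open>simp add: q_def\<close>)
qed

lemma dnorm_0_sq: "x \<in> M \<Longrightarrow> (dnorm 0 x)\<^sup>2 = Re (\<phi> (adj x o\<^sub>L x))"
  using dnorm_power[of x 0] by simp

text \<open>Cyclic invariance of the trace. It makes \<open>dnorm\<close> invariant under adjoints
  and lets \<open>dnorm (x o\<^sub>L y)\<close> be rewritten in terms of
  \<open>adj x o\<^sub>L x\<close> and \<open>y o\<^sub>L adj y\<close>.\<close>

lemma phi_opow_commute: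
  assumes "u \<in> M" "v \<in> M"
  shows "\<phi> (opow (u o\<^sub>L v) m) = \<phi> (opow (v o\<^sub>L u) m)"
proof (cases m)
  case (Suc k)
  have "opow (u o\<^sub>L v) (Suc k) = (opow (u o\<^sub>L v) k o\<^sub>L u) o\<^sub>L v"
    by (simp add: opow_Suc2 o_assoc)
  also have "\<dots> = u o\<^sub>L (opow (v o\<^sub>L u) k o\<^sub>L v)"
    by (simp add: opow_compose_commute o_assoc)
  also have "\<phi> \<dots> = \<phi> ((opow (v o\<^sub>L u) k o\<^sub>L v) o\<^sub>L u)"
    using assms by (intro phi_trace) auto
  also have "(opow (v o\<^sub>L u) k o\<^sub>L v) o\<^sub>L u = opow (v o\<^sub>L u) (Suc k)"
    by (simp add: opow_Suc2 o_assoc)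
  finally show ?thesis using Suc by simp
qed simp

lemma dnorm_eqI:
  assumes "0 \<le> r" "dnorm j x ^ (2 ^ Suc j) = r ^ (2 ^ Suc j)"
  shows "dnorm j x = r"
  using assms power_eq_imp_eq_base[of "dnorm j x" "2 ^ Suc j" r] by simp

lemma dnorm_adj: "x \<in> M \<Longrightarrow> dnorm j (adj x) = dnorm j x"
  using phi_opow_commute[of x "adj x" "2 ^ j"] by (intro dnorm_eqI) (simp_all add: dnorm_power del: power_Suc)

lemma dnorm_id: "dnorm j id_blinfun = 1"
proof -
  have "opow id_blinfun m = (id_blinfun :: 'h op)" for m
    by (induction m) (simp_all add: opow_Suc)
  then show ?thesis by (intro dnorm_eqI) (simp_all add: dnorm_power phi_id del: power_Suc)
qed

lemma dnorm_modulus_square: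
  assumes "x \<in> M"
  shows "dnorm j (adj x o\<^sub>L x) = (dnorm (Suc j) x)\<^sup>2"
proof (rule dnorm_eqI)
  have "dnorm j (adj x o\<^sub>L x) ^ (2 ^ Suc j) = Re (\<phi> (opow ((adj x o\<^sub>L x) o\<^sub>L (adj x o\<^sub>L x)) (2 ^ j)))"
    using assms by (simp only: dnorm_power M_compose M_adj adj_compose adj_adj)
  also have "opow ((adj x o\<^sub>L x) o\<^sub>L (adj x o\<^sub>L x)) (2 ^ j) = opow (adj x o\<^sub>L x) (2 * 2 ^ j)"
    unfolding opow_mult by (simp add: opow_Suc numeral_2_eq_2)
  also have "Re (\<phi> \<dots>) = dnorm (Suc j) x ^ (2 ^ Suc (Suc j))"
    using dnorm_power[OF assms, of "Suc j"] by simp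
  also have "\<dots> = ((dnorm (Suc j) x)\<^sup>2) ^ (2 ^ Suc j)"
    by (simp flip: power_mult)
  finally show "dnorm j (adj x o\<^sub>L x) ^ (2 ^ Suc j) = ((dnorm (Suc j) x)\<^sup>2) ^ (2 ^ Suc j)" .
qed simp

lemma compose_pairs_in_M: "set xs \<subseteq> M \<Longrightarrow> set (compose_pairs xs) \<subseteq> M"
  by (induction xs rule: compose_pairs.induct) auto

text \<open>A power of the left side is the trace of a word of length \<open>2 ^ Suc j\<close>
  alternating between \<open>adj x o\<^sub>L x\<close> and \<open>y o\<^sub>L adj y\<close>; their
  norms at level \<open>j\<close> are squares of norms at level \<open>Suc j\<close>. Hoelder's
  inequality at level \<open>j\<close> is a hypothesis because the two statements are proved in
  alternation.\<close>

lemma dnorm_compose_if_holder: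
  assumes holder: "\<And>xs. set xs \<subseteq> M \<Longrightarrow> length xs = 2 ^ Suc j \<Longrightarrow>
      cmod (\<phi> (oprod xs)) \<le> prod_list (map (dnorm j) xs)"
    and x: "x \<in> M" and y: "y \<in> M"
  shows "dnorm j (x o\<^sub>L y) \<le> dnorm (Suc j) x * dnorm (Suc j) y"
proof -
  let ?m = "2 ^ j :: nat" and ?a = "adj x o\<^sub>L x" and ?b = "y o\<^sub>L adj y"
  have "dnorm j (x o\<^sub>L y) ^ (2 ^ Suc j) = Re (\<phi> (opow (adj y o\<^sub>L (?a o\<^sub>L y)) ?m))"
    using x y by (simp only: dnorm_power M_compose adj_compose o_assoc)
  also have "\<phi> (opow (adj y o\<^sub>L (?a o\<^sub>L y)) ?m) = \<phi> (opow (?a o\<^sub>L ?b) ?m)"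
    using phi_opow_commute[of "adj y" "?a o\<^sub>L y"] x y by (simp add: o_assoc)
  also have "Re \<dots> \<le> cmod \<dots>" by (rule complex_Re_le_cmod)
  also have "\<dots> = cmod (\<phi> (oprod (concat (replicate ?m [?a, ?b]))))"
    by (simp only: oprod_concat_replicate oprod_simps o_id)
  also have "\<dots> \<le> prod_list (map (dnorm j) (concat (replicate ?m [?a, ?b])))"
    using x y by (intro holder) (auto simp: length_concat sum_list_replicate)
  also have "\<dots> = (dnorm j ?a * dnorm j ?b) ^ ?m"
    by (simp add: prod_list_concat_replicate)
  also have "\<dots> = (dnorm (Suc j) x * dnorm (Suc j) y) ^ (2 ^ Suc j)"
    using dnorm_modulus_square[OF x, of j] dnorm_modulus_square[of "adj y" j] x y
    by (simp add: dnorm_adj power_mult_distrib flip: power_mult)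
  finally show ?thesis by (simp add: power_mono_iff del: power_Suc)
qed

text \<open>The induction step multiplies neighbouring factors, which halves the length of the word.\<close>

lemma phi_holder:
  "set xs \<subseteq> M \<Longrightarrow> length xs = 2 ^ Suc j \<Longrightarrow> cmod (\<phi> (oprod xs)) \<le> prod_list (map (dnorm j) xs)"
proof (induction j arbitrary: xs)
  case 0
  then obtain x y where xs: "xs = [x, y]" by (auto simp: length_Suc_conv numeral_2_eq_2)
  then have M: "x \<in> M" "y \<in> M" using 0 by auto
  have "(cmod (\<phi> (adj (adj x) o\<^sub>L y)))\<^sup>2 \<le> (dnorm 0 (adj x))\<^sup>2 * (dnorm 0 y)\<^sup>2"
    using phi_cauchy_schwarz[OF M_adj[OF M(1)] M(2)] by (simp only: dnorm_0_sq M_adj M)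
  then have "(cmod (\<phi> (oprod xs)))\<^sup>2 \<le> (dnorm 0 x * dnorm 0 y)\<^sup>2"
    by (simp add: xs M power_mult_distrib dnorm_adj)
  from power2_le_imp_le[OF this] show ?case
    by (simp add: xs)
next
  case (Suc j)
  have even: "even (length xs)" using Suc.prems by simp
  have "cmod (\<phi> (oprod xs)) = cmod (\<phi> (oprod (compose_pairs xs)))"
    by (simp add: oprod_compose_pairs[OF even])
  also have "\<dots> \<le> prod_list (map (dnorm j) (compose_pairs xs))"
    using Suc.prems by (intro Suc.IH compose_pairs_in_M) (auto simp: length_compose_pairs)
  also have "\<dots> \<le> prod_list (map (dnorm (Suc j)) xs)"
    using even Suc.prems(1)
  proof (induction xs rule: compose_pairs.induct)
    case (1 x y xs)
    have nonneg: "0 \<le> prod_list (map (dnorm j) (compose_pairs xs))"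
      by (rule prod_list_nonneg) auto
    have "dnorm j (x o\<^sub>L y) * prod_list (map (dnorm j) (compose_pairs xs)) \<le>
        (dnorm (Suc j) x * dnorm (Suc j) y) * prod_list (map (dnorm (Suc j)) xs)"
      using 1 nonneg by (intro mult_mono dnorm_compose_if_holder[OF Suc.IH]) auto
    then show ?case by (simp add: mult_ac)
  qed auto
  finally show ?case .
qed

lemma dnorm_compose: "x \<in> M \<Longrightarrow> y \<in> M \<Longrightarrow> dnorm j (x o\<^sub>L y) \<le> dnorm (Suc j) x * dnorm (Suc j) y"
  by (rule dnorm_compose_if_holder[OF phi_holder])

lemma dnorm_le_Suc: "x \<in> M \<Longrightarrow> dnorm j x \<le> dnorm (Suc j) x"
  using dnorm_compose[of x id_blinfun j] by (simp add: dnorm_id)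

text \<open>The noncommutative form of \<open>|z| ^ (p - 2) * cnj z\<close> with
  \<open>p = 2 ^ Suc j\<close>: the element that norms \<open>z\<close> in the duality of Lp with
  its conjugate space.\<close>

definition power_dual :: "nat \<Rightarrow> 'h op \<Rightarrow> 'h op" where
  "power_dual j z = opow (adj z o\<^sub>L z) (2 ^ j - 1) o\<^sub>L adj z"

lemma power_dual_in_M: "z \<in> M \<Longrightarrow> power_dual j z \<in> M"
  by (simp add: power_dual_def)

lemma phi_power_dual_self: "z \<in> M \<Longrightarrow> Re (\<phi> (power_dual j z o\<^sub>L z)) = dnorm j z ^ (2 ^ Suc j)"
  using opow_Suc2[of "adj z o\<^sub>L z" "2 ^ j - 1"] by (simp add: power_dual_def o_assoc dnorm_power del: power_Suc)

lemma phi_power_dual_le: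
  assumes "z \<in> M" "u \<in> M"
  shows "cmod (\<phi> (power_dual j z o\<^sub>L u)) \<le> dnorm j z ^ (2 ^ Suc j - 1) * dnorm j u"
proof -
  let ?k = "2 ^ j - 1 :: nat"
  have "1 \<le> (2 ^ j :: nat)" by simp
  then have len: "2 ^ Suc j = 2 * ?k + 2" unfolding power_Suc by linarith
  \<comment> \<open>A word with exactly \<open>2 * ?k + 2 = 2 ^ Suc j\<close> letters, as Hoelder's
    inequality requires; all but the last are \<open>z\<close> or \<open>adj z\<close>.\<close>
  have "power_dual j z o\<^sub>L u = oprod (concat (replicate ?k [adj z, z]) @ [adj z, u])"
    by (simp only: oprod_append oprod_concat_replicate oprod_simps o_id power_dual_def o_assoc)
  then have "cmod (\<phi> (power_dual j z o\<^sub>L u)) \<le>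
      prod_list (map (dnorm j) (concat (replicate ?k [adj z, z]) @ [adj z, u]))"
    by (simp only:) (rule phi_holder, use assms in \<open>auto simp: length_concat sum_list_replicate len simp del: power_Suc\<close>)
  also have "\<dots> = (dnorm j z * dnorm j z) ^ ?k * (dnorm j z * dnorm j u)"
    using assms by (simp add: prod_list_concat_replicate dnorm_adj)
  also have "(dnorm j z * dnorm j z) ^ ?k = dnorm j z ^ (2 * ?k)"
    by (simp add: power_mult power2_eq_square)
  also have "dnorm j z ^ (2 * ?k) * (dnorm j z * dnorm j u) = dnorm j z ^ Suc (2 * ?k) * dnorm j u"
    by simp
  also have "Suc (2 * ?k) = 2 ^ Suc j - 1" using len by simp
  finally show ?thesis .
qed

text \<open>Duality in usable form: pairing \<open>z\<close> with its dual gives the full power of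
  the norm, of which all factors but one cancel. It yields the triangle inequality and, later, the
  injectivity of Lp in L1.\<close>

lemma dnorm_le_if_power_dual:
  assumes "z \<in> M" "cmod (\<phi> (power_dual j z o\<^sub>L z)) \<le> dnorm j z ^ (2 ^ Suc j - 1) * C" "0 \<le> C"
  shows "dnorm j z \<le> C"
proof (cases "dnorm j z = 0")
  case False
  then have "0 < dnorm j z" using dnorm_nonneg[of j z] by linarith
  have "dnorm j z ^ (2 ^ Suc j) \<le> dnorm j z ^ (2 ^ Suc j - 1) * C"
    using assms(2) phi_power_dual_self[OF assms(1), of j] complex_Re_le_cmod order_trans by metis
  moreover have "dnorm j z ^ (2 ^ Suc j) = dnorm j z ^ (2 ^ Suc j - 1) * dnorm j z"
    using power_Suc2[of "dnorm j z" "2 ^ Suc j - 1"] by simp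
  ultimately show ?thesis using \<open>0 < dnorm j z\<close> by simp
qed (use assms in simp)

lemma dnorm_triangle:
  assumes "x \<in> M" "y \<in> M"
  shows "dnorm j (x + y) \<le> dnorm j x + dnorm j y"
proof (rule dnorm_le_if_power_dual)
  let ?w = "power_dual j (x + y)"
  have "\<phi> (?w o\<^sub>L (x + y)) = \<phi> (?w o\<^sub>L x) + \<phi> (?w o\<^sub>L y)"
    using assms by (simp add: o_add_right phi_add power_dual_in_M)
  then have "cmod (\<phi> (?w o\<^sub>L (x + y))) \<le> cmod (\<phi> (?w o\<^sub>L x)) + cmod (\<phi> (?w o\<^sub>L y))"
    by (simp add: norm_triangle_ineq)
  also have "\<dots> \<le> dnorm j (x + y) ^ (2 ^ Suc j - 1) * dnorm j x + dnorm j (x + y) ^ (2 ^ Suc j - 1) * dnorm j y"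
    using assms by (intro add_mono phi_power_dual_le) auto
  finally show "cmod (\<phi> (?w o\<^sub>L (x + y))) \<le> dnorm j (x + y) ^ (2 ^ Suc j - 1) * (dnorm j x + dnorm j y)"
    by (simp add: algebra_simps)
qed (use assms in auto)

lemma dnorm_uminus: "x \<in> M \<Longrightarrow> dnorm j (- x) = dnorm j x"
proof -
  assume x: "x \<in> M"
  have "adj (- x) = - adj x"
    using adj_scaleC[OF x, of "-1"] by (simp add: scaleC_minus_one)
  moreover have "(- y) o\<^sub>L (- z) = y o\<^sub>L z" for y z :: "'h op"
    by (rule blinfun_eqI) (simp add: blinfun.minus_left blinfun.minus_right)
  ultimately show ?thesis
    using x M_scaleC[OF x, of "-1"]
    by (intro dnorm_eqI) (simp_all add: dnorm_power scaleC_minus_one del: power_Suc)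
qed

text \<open>The modulus of \<open>z = x o\<^sub>L y\<close> is close to
  \<open>u o\<^sub>L z\<close>, where \<open>u = g o\<^sub>L adj z\<close> is almost a contraction.
  So its trace is close to that of \<open>(u o\<^sub>L x) o\<^sub>L y\<close>, to which
  Cauchy-Schwarz applies. This estimate makes the product from L2 x L2 to L1 well defined.\<close>

lemma p_norm_1_compose:
  assumes x: "x \<in> M" and y: "y \<in> M"
  shows "p_norm \<phi> 1 (x o\<^sub>L y) \<le> dnorm 0 x * dnorm 0 y"
proof (rule le_if_le_add_mult)
  fix e :: real assume "e > 0"
  define z where "z = x o\<^sub>L y"
  have z: "z \<in> M" using x y by (simp add: z_def)
  obtain g where g: "g \<in> M" "is_adjoint g g" "norm (z o\<^sub>L g) \<le> 1 + e"
      "norm ((g o\<^sub>L (adj z o\<^sub>L z)) - op_abs z) \<le> e"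
    using approximate_polar_decomposition[OF z \<open>e > 0\<close>] by blast
  define u where "u = adj (z o\<^sub>L g)"
  have u: "u \<in> M" "adj u = z o\<^sub>L g" "u = g o\<^sub>L adj z"
    using z g adj_eqI[OF g(2)] by (simp_all add: u_def)
  have "norm (adj u o\<^sub>L u) = (norm (z o\<^sub>L g))\<^sup>2"
    using norm_adj_compose[OF u(1)] norm_adj[of "z o\<^sub>L g"] z g(1) by (simp add: u_def del: adj_compose)
  then have norm_u: "norm (adj u o\<^sub>L u) \<le> (1 + e)\<^sup>2" using g(3) by (simp add: power_mono)
  have "(dnorm 0 (adj (u o\<^sub>L x)))\<^sup>2 = (dnorm 0 (u o\<^sub>L x))\<^sup>2" using u x by (simp add: dnorm_adj del: adj_compose)
  also have "\<dots> = Re (\<phi> (adj x o\<^sub>L (adj u o\<^sub>L u) o\<^sub>L x))"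
    using u(1) x by (simp add: dnorm_0_sq o_assoc)
  also have "\<dots> \<le> (1 + e)\<^sup>2 * Re (\<phi> (adj x o\<^sub>L x))"
    using u(1) x norm_u by (intro phi_conjugate_le pos_op_modulus_square) auto
  also have "\<dots> = ((1 + e) * dnorm 0 x)\<^sup>2" using x by (simp add: dnorm_0_sq power_mult_distrib)
  finally have ux: "dnorm 0 (adj (u o\<^sub>L x)) \<le> (1 + e) * dnorm 0 x"
    by (rule power2_le_imp_le) (use \<open>e > 0\<close> in simp)
  have "u o\<^sub>L x \<in> M" using u(1) x by simp
  then have "(cmod (\<phi> (adj (adj (u o\<^sub>L x)) o\<^sub>L y)))\<^sup>2 \<le> (dnorm 0 (adj (u o\<^sub>L x)))\<^sup>2 * (dnorm 0 y)\<^sup>2"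
    using phi_cauchy_schwarz[of "adj (u o\<^sub>L x)" y] y by (simp only: dnorm_0_sq M_adj)
  moreover have "adj (adj (u o\<^sub>L x)) o\<^sub>L y = u o\<^sub>L z"
    using \<open>u o\<^sub>L x \<in> M\<close> by (simp add: z_def o_assoc del: adj_compose)
  ultimately have "cmod (\<phi> (u o\<^sub>L z)) \<le> dnorm 0 (adj (u o\<^sub>L x)) * dnorm 0 y"
    by (metis power_mult_distrib power2_le_imp_le mult_nonneg_nonneg dnorm_nonneg)
  also have "\<dots> \<le> (1 + e) * dnorm 0 x * dnorm 0 y"
    using ux by (simp add: mult_right_mono)
  finally have main: "cmod (\<phi> (u o\<^sub>L z)) \<le> (1 + e) * dnorm 0 x * dnorm 0 y" .
  have "cmod (\<phi> (u o\<^sub>L z) - \<phi> (op_abs z)) \<le> e"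
    using cmod_phi_le_norm[of "(u o\<^sub>L z) - op_abs z"] u(1) z op_abs(1)[OF z] g(4)
    by (simp add: phi_diff) (simp add: u(3) o_assoc)
  then have "Re (\<phi> (op_abs z)) \<le> cmod (\<phi> (u o\<^sub>L z)) + e"
    using complex_Re_le_cmod[of "\<phi> (op_abs z)"] norm_triangle_ineq2[of "\<phi> (op_abs z)" "\<phi> (u o\<^sub>L z)"]
    by (simp add: norm_minus_commute)
  then show "p_norm \<phi> 1 (x o\<^sub>L y) \<le> dnorm 0 x * dnorm 0 y + e * (dnorm 0 x * dnorm 0 y + 1)"
    using main z by (simp add: z_def p_norm_1_eq algebra_simps)
qed

lemma p_norm_1_le_dnorm: "x \<in> M \<Longrightarrow> p_norm \<phi> 1 x \<le> dnorm 0 x"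
  using p_norm_1_compose[of x id_blinfun] by (simp add: dnorm_id)

end

section \<open>Noncommutative \<open>L\<^sup>p\<close> spaces for dyadic exponents\<close>

locale tracial_L1 = tracial_vn_algebra M \<phi>
  for M :: "'h::complex_hilbert op set" and \<phi> +
  fixes \<iota> :: "'h op \<Rightarrow> 'l::complex_banach"
  assumes embedding: "L1_embedding M \<phi> \<iota>"
begin

lemma iota_add: "x \<in> M \<Longrightarrow> y \<in> M \<Longrightarrow> \<iota> (x + y) = \<iota> x + \<iota> y"
  and norm_iota: "x \<in> M \<Longrightarrow> norm (\<iota> x) = p_norm \<phi> 1 x"
  using embedding by (auto simp: L1_embedding_def)

lemma iota_diff: "x \<in> M \<Longrightarrow> y \<in> M \<Longrightarrow> \<iota> (x - y) = \<iota> x - \<iota> y"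
  using iota_add[of "x - y" y] by simp

text \<open>The limit \<open>X\<close> lives in the one space containing L1 at every level; only the
  Cauchy condition depends on \<open>j\<close>. This permits comparison of levels.\<close>

definition dlim :: "nat \<Rightarrow> (nat \<Rightarrow> 'h op) \<Rightarrow> 'l \<Rightarrow> bool" where
  "dlim j = Lp_lim M \<phi> \<iota> (2 ^ Suc j)"

definition Ldnorm :: "nat \<Rightarrow> 'l \<Rightarrow> real" where
  "Ldnorm j = Lp_norm M \<phi> \<iota> (2 ^ Suc j)"

lemma dlim_iff: "dlim j x X \<longleftrightarrow> (\<forall>n. x n \<in> M) \<and>
    (\<forall>e>0. \<exists>K. \<forall>m\<ge>K. \<forall>n\<ge>K. dnorm j (x m - x n) < e) \<and> (\<lambda>n. \<iota> (x n)) \<longlonglongrightarrow> X"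
  by (simp add: dlim_def Lp_lim_def dnorm_def)

lemma dlim_0_eq: "dlim 0 = Lp_lim M \<phi> \<iota> 2"
  by (simp add: dlim_def)

lemma dlim_in_M: "dlim j x X \<Longrightarrow> x n \<in> M"
  by (simp add: dlim_iff)

lemma dlim_iota: "dlim j x X \<Longrightarrow> (\<lambda>n. \<iota> (x n)) \<longlonglongrightarrow> X"
  by (simp add: dlim_iff)

lemma dlim_cauchy:
  assumes "dlim j x X" "e > 0"
  obtains K where "\<And>m n. m \<ge> K \<Longrightarrow> n \<ge> K \<Longrightarrow> dnorm j (x m - x n) < e"
  using assms unfolding dlim_iff by metis

lemma dnorm_0 [simp]: "dnorm j 0 = 0"
proof (rule dnorm_eqI)
  have "opow (0 :: 'h op) (2 ^ j) = 0"
    using opow_Suc[of 0 "2 ^ j - 1"] by simp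
  moreover have "\<phi> 0 = 0"
    using phi_scaleR[OF M_id, of 0] by simp
  ultimately show "dnorm j 0 ^ 2 ^ Suc j = 0 ^ 2 ^ Suc j"
    using dnorm_power[OF M_zero, of j] by simp
qed simp

lemma dlim_const: "x \<in> M \<Longrightarrow> dlim j (\<lambda>_. x) (\<iota> x)"
  by (simp add: dlim_iff)

lemma abs_dnorm_diff_le: "x \<in> M \<Longrightarrow> y \<in> M \<Longrightarrow> \<bar>dnorm j x - dnorm j y\<bar> \<le> dnorm j (x - y)"
  using dnorm_triangle[of "x - y" y j] dnorm_triangle[of "y - x" x j] dnorm_uminus[of "x - y" j]
  by simp

lemma dlim_bounded:
  assumes "dlim j x X"
  obtains C where "C > 0" "\<And>n. dnorm j (x n) \<le> C"
proof -
  obtain K where K: "\<And>m n. m \<ge> K \<Longrightarrow> n \<ge> K \<Longrightarrow> dnorm j (x m - x n) < 1"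
    using dlim_cauchy[OF assms zero_less_one] by blast
  define C where "C = 1 + (\<Sum>n\<le>K. dnorm j (x n))"
  have le: "dnorm j (x n) \<le> (\<Sum>n\<le>K. dnorm j (x n))" if "n \<le> K" for n
    using that by (intro member_le_sum) auto
  have "dnorm j (x n) \<le> C" for n
  proof (cases "n \<le> K")
    case False
    then have "dnorm j (x n) - dnorm j (x K) < 1"
      using K[of n K] abs_dnorm_diff_le[of "x n" "x K" j] dlim_in_M[OF assms] by (simp add: abs_le_iff)
    then show ?thesis using le[of K] by (simp add: C_def)
  qed (use le[of n] in \<open>simp add: C_def\<close>)
  moreover have "C > 0" by (simp add: C_def add_pos_nonneg sum_nonneg)
  ultimately show ?thesis using that by blast
qed

lemma dlim_add:
  assumes x: "dlim j x X" and y: "dlim j y Y"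
  shows "dlim j (\<lambda>n. x n + y n) (X + Y)"
  unfolding dlim_iff
proof (intro conjI allI impI)
  fix n show "x n + y n \<in> M" using dlim_in_M[OF x] dlim_in_M[OF y] by simp
next
  fix e :: real assume "e > 0"
  then have "e / 2 > 0" by simp
  obtain K where K: "\<And>m n. m \<ge> K \<Longrightarrow> n \<ge> K \<Longrightarrow> dnorm j (x m - x n) < e / 2"
    using dlim_cauchy[OF x \<open>e / 2 > 0\<close>] by blast
  obtain K' where K': "\<And>m n. m \<ge> K' \<Longrightarrow> n \<ge> K' \<Longrightarrow> dnorm j (y m - y n) < e / 2"
    using dlim_cauchy[OF y \<open>e / 2 > 0\<close>] by blast
  have "dnorm j (x m + y m - (x n + y n)) < e" if "m \<ge> max K K'" "n \<ge> max K K'" for m n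
  proof -
    have "x m + y m - (x n + y n) = (x m - x n) + (y m - y n)" by simp
    also have "dnorm j \<dots> \<le> dnorm j (x m - x n) + dnorm j (y m - y n)"
      using dlim_in_M[OF x] dlim_in_M[OF y] by (intro dnorm_triangle) auto
    finally have "dnorm j (x m + y m - (x n + y n)) \<le> dnorm j (x m - x n) + dnorm j (y m - y n)" .
    then show ?thesis using K[of m n] K'[of m n] that by simp
  qed
  then show "\<exists>K. \<forall>m\<ge>K. \<forall>n\<ge>K. dnorm j (x m + y m - (x n + y n)) < e" by blast
next
  show "(\<lambda>n. \<iota> (x n + y n)) \<longlonglongrightarrow> X + Y"
    using tendsto_add[OF dlim_iota[OF x] dlim_iota[OF y]] dlim_in_M[OF x] dlim_in_M[OF y]
    by (simp add: iota_add)
qed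

lemma M_uminus: "x \<in> M \<Longrightarrow> - x \<in> M"
  using M_diff[OF M_zero, of x] by simp

lemma dlim_uminus:
  assumes x: "dlim j x X"
  shows "dlim j (\<lambda>n. - x n) (- X)"
proof -
  have M: "x n \<in> M" for n using dlim_in_M[OF x] .
  have "\<iota> 0 = 0" using iota_add[of 0 0] by simp
  then have neg: "\<iota> (- x n) = - \<iota> (x n)" for n using iota_diff[of 0 "x n"] M by simp
  have "dnorm j (- x m - - x n) = dnorm j (x m - x n)" for m n
    using dnorm_uminus[of "x m - x n" j] M by simp
  then show ?thesis
    using x tendsto_minus[OF dlim_iota[OF x]] by (simp add: dlim_iff M_uminus neg)
qed

lemma dlim_diff: "dlim j x X \<Longrightarrow> dlim j y Y \<Longrightarrow> dlim j (\<lambda>n. x n - y n) (X - Y)"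
  using dlim_add[of j x X "\<lambda>n. - y n" "- Y"] dlim_uminus[of j y Y] by simp

lemma dlim_mono: "dlim (Suc j) x X \<Longrightarrow> dlim j x X"
  unfolding dlim_iff using dnorm_le_Suc by (meson M_diff le_less_trans)

lemma dlim_0: "dlim j x X \<Longrightarrow> dlim 0 x X"
  by (induction j) (auto dest: dlim_mono)

text \<open>Injectivity of \<open>L\<^sup>p(M) \<rightarrow> L\<^sup>1(M)\<close>.\<close>

lemma dnorm_tendsto_0:
  assumes z: "dlim j z 0"
  shows "(\<lambda>n. dnorm j (z n)) \<longlonglongrightarrow> 0"
proof (rule LIMSEQ_I)
  fix e :: real assume "e > 0"
  then have "e / 2 > 0" by simp
  obtain K where K: "\<And>m n. m \<ge> K \<Longrightarrow> n \<ge> K \<Longrightarrow> dnorm j (z m - z n) < e / 2"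
    using dlim_cauchy[OF z \<open>e / 2 > 0\<close>] by blast
  have M: "z n \<in> M" for n using dlim_in_M[OF z] .
  have "dnorm j (z n) \<le> e / 2" if "n \<ge> K" for n
  proof (rule dnorm_le_if_power_dual[OF M])
    define w where "w = power_dual j (z n)"
    have w: "w \<in> M" using M power_dual_in_M by (simp add: w_def)
    define D where "D = dnorm j (z n) ^ (2 ^ Suc j - 1)"
    \<comment> \<open>Here \<open>n\<close> is fixed and \<open>m\<close> tends to infinity:
      \<open>z n - z m\<close> is controlled by the Cauchy condition, while pairing the bounded
      operator \<open>w\<close> with \<open>z m\<close> tends to 0 because
      \<open>\<iota> (z m)\<close> does.\<close>
    have "(\<lambda>m. D * (e / 2) + norm w * norm (\<iota> (z m))) \<longlonglongrightarrow> D * (e / 2) + norm w * norm (0::'l)"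
      by (intro tendsto_intros dlim_iota[OF z])
    moreover have "cmod (\<phi> (w o\<^sub>L z n)) \<le> D * (e / 2) + norm w * norm (\<iota> (z m))" if "m \<ge> K" for m
    proof -
      have "\<phi> (w o\<^sub>L z n) = \<phi> (w o\<^sub>L (z n - z m)) + \<phi> (w o\<^sub>L z m)"
        using w M phi_add[of "w o\<^sub>L (z n - z m)" "w o\<^sub>L z m"] by (simp flip: o_add_right)
      then have "cmod (\<phi> (w o\<^sub>L z n)) \<le> cmod (\<phi> (w o\<^sub>L (z n - z m))) + cmod (\<phi> (w o\<^sub>L z m))"
        by (simp add: norm_triangle_ineq)
      also have "cmod (\<phi> (w o\<^sub>L (z n - z m))) \<le> D * dnorm j (z n - z m)"
        unfolding w_def D_def using M by (intro phi_power_dual_le) auto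
      also have "\<dots> \<le> D * (e / 2)"
        using K[OF \<open>n \<ge> K\<close> that] by (intro mult_left_mono) (auto simp: D_def)
      also have "cmod (\<phi> (w o\<^sub>L z m)) \<le> norm w * norm (\<iota> (z m))"
        using w M by (simp add: norm_iota cmod_phi_compose_le_p_norm_1)
      finally show ?thesis by simp
    qed
    ultimately have "cmod (\<phi> (w o\<^sub>L z n)) \<le> D * (e / 2) + norm w * norm (0::'l)"
      by (intro LIMSEQ_le_const) blast+
    then show "cmod (\<phi> (power_dual j (z n) o\<^sub>L z n)) \<le> dnorm j (z n) ^ (2 ^ Suc j - 1) * (e / 2)"
      by (simp add: w_def D_def)
  qed (use \<open>e > 0\<close> in simp)
  then show "\<exists>K. \<forall>n\<ge>K. norm (dnorm j (z n) - 0) < e"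
    using \<open>e > 0\<close> by (intro exI[of _ K]) force
qed

lemma dnorm_diff_tendsto_0: "dlim j x X \<Longrightarrow> dlim j y X \<Longrightarrow> (\<lambda>n. dnorm j (x n - y n)) \<longlonglongrightarrow> 0"
  using dlim_diff[of j x X y X] dnorm_tendsto_0 by simp

text \<open>Independence of the approximating sequence is exactly the injectivity of Lp in L1: two
  sequences with the same image \<open>X\<close> differ by one that tends to 0 in
  \<open>dnorm j\<close>.\<close>

lemma dnorm_tendsto_Ldnorm:
  assumes x: "dlim j x X"
  shows "(\<lambda>n. dnorm j (x n)) \<longlonglongrightarrow> Ldnorm j X"
proof -
  have "Cauchy (\<lambda>n. dnorm j (x n))"
  proof (rule metric_CauchyI)
    fix e :: real assume "e > 0"
    obtain K where K: "\<And>m n. m \<ge> K \<Longrightarrow> n \<ge> K \<Longrightarrow> dnorm j (x m - x n) < e"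
      using dlim_cauchy[OF x \<open>e > 0\<close>] by blast
    show "\<exists>K. \<forall>m\<ge>K. \<forall>n\<ge>K. dist (dnorm j (x m)) (dnorm j (x n)) < e"
      unfolding dist_real_def
      by (intro exI[of _ K] allI impI le_less_trans[OF abs_dnorm_diff_le] K dlim_in_M[OF x])
  qed
  from convergentD[OF Cauchy_convergent[OF this]] obtain r where r: "(\<lambda>n. dnorm j (x n)) \<longlonglongrightarrow> r" ..
  have all: "(\<lambda>n. dnorm j (y n)) \<longlonglongrightarrow> r" if y: "dlim j y X" for y
  proof -
    have "(\<lambda>n. dnorm j (y n) - dnorm j (x n)) \<longlonglongrightarrow> 0"
      by (rule Lim_null_comparison[OF always_eventually dnorm_diff_tendsto_0[OF y x]])
        (simp add: abs_dnorm_diff_le dlim_in_M[OF x] dlim_in_M[OF y])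
    from tendsto_add[OF this r] show ?thesis by simp
  qed
  have "Ldnorm j X = r"
    unfolding Ldnorm_def Lp_norm_def dlim_def[symmetric]
  proof (rule the_equality)
    show "\<forall>y. dlim j y X \<longrightarrow> (\<lambda>n. p_norm \<phi> (2 ^ Suc j) (y n)) \<longlonglongrightarrow> r"
      using all by (simp add: dnorm_def)
    show "r' = r" if "\<forall>y. dlim j y X \<longrightarrow> (\<lambda>n. p_norm \<phi> (2 ^ Suc j) (y n)) \<longlonglongrightarrow> r'" for r'
      using that x r LIMSEQ_unique unfolding dnorm_def by blast
  qed
  then show ?thesis using r by simp
qed

lemma norm_iota_compose_diff_le:
  assumes "x \<in> M" "y \<in> M" "x' \<in> M" "y' \<in> M"
  shows "norm (\<iota> (x o\<^sub>L y) - \<iota> (x' o\<^sub>L y')) \<le>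
    dnorm 0 (x - x') * dnorm 0 y + dnorm 0 x' * dnorm 0 (y - y')"
proof -
  have "\<iota> (x o\<^sub>L y) - \<iota> (x' o\<^sub>L y') = \<iota> ((x - x') o\<^sub>L y) + \<iota> (x' o\<^sub>L (y - y'))"
    using assms by (simp add: o_diff_left o_diff_right iota_diff)
  also have "norm \<dots> \<le> norm (\<iota> ((x - x') o\<^sub>L y)) + norm (\<iota> (x' o\<^sub>L (y - y')))"
    by (rule norm_triangle_ineq)
  also have "\<dots> \<le> dnorm 0 (x - x') * dnorm 0 y + dnorm 0 x' * dnorm 0 (y - y')"
    using assms by (intro add_mono) (simp_all add: norm_iota p_norm_1_compose)
  finally show ?thesis .
qed

lemma dnorm_compose_diff_le:
  assumes "x \<in> M" "y \<in> M" "x' \<in> M" "y' \<in> M"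
  shows "dnorm j ((x o\<^sub>L y) - (x' o\<^sub>L y')) \<le>
    dnorm (Suc j) (x - x') * dnorm (Suc j) y + dnorm (Suc j) x' * dnorm (Suc j) (y - y')"
proof -
  have "(x o\<^sub>L y) - (x' o\<^sub>L y') = ((x - x') o\<^sub>L y) + (x' o\<^sub>L (y - y'))"
    by (simp add: o_diff_left o_diff_right)
  also have "dnorm j \<dots> \<le> dnorm j ((x - x') o\<^sub>L y) + dnorm j (x' o\<^sub>L (y - y'))"
    using assms by (intro dnorm_triangle) auto
  also have "\<dots> \<le> dnorm (Suc j) (x - x') * dnorm (Suc j) y + dnorm (Suc j) x' * dnorm (Suc j) (y - y')"
    using assms by (intro add_mono dnorm_compose) auto
  finally show ?thesis .
qed

lemma product_cauchy_bound:
  assumes x: "dlim j x X" and y: "dlim j y Y" and "e > 0"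
  obtains K where "\<And>m n. m \<ge> K \<Longrightarrow> n \<ge> K \<Longrightarrow>
    dnorm j (x m - x n) * dnorm j (y m) + dnorm j (x n) * dnorm j (y m - y n) < e"
proof -
  obtain C where C: "C > 0" "\<And>n. dnorm j (x n) \<le> C" using dlim_bounded[OF x] by blast
  obtain D where D: "D > 0" "\<And>n. dnorm j (y n) \<le> D" using dlim_bounded[OF y] by blast
  define d where "d = e / (C + D)"
  have d: "d > 0" "d * (C + D) = e" using C D \<open>e > 0\<close> by (simp_all add: d_def)
  obtain K where K: "\<And>m n. m \<ge> K \<Longrightarrow> n \<ge> K \<Longrightarrow> dnorm j (x m - x n) < d"
    using dlim_cauchy[OF x d(1)] by blast
  obtain K' where K': "\<And>m n. m \<ge> K' \<Longrightarrow> n \<ge> K' \<Longrightarrow> dnorm j (y m - y n) < d"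
    using dlim_cauchy[OF y d(1)] by blast
  have "dnorm j (x m - x n) * dnorm j (y m) + dnorm j (x n) * dnorm j (y m - y n) < e"
    if "m \<ge> max K K'" "n \<ge> max K K'" for m n
  proof -
    have "dnorm j (x m - x n) * dnorm j (y m) \<le> dnorm j (x m - x n) * D"
      using D by (intro mult_left_mono) auto
    also have "\<dots> < d * D"
      using K[of m n] that D by (intro mult_strict_right_mono) auto
    finally have 1: "dnorm j (x m - x n) * dnorm j (y m) < d * D" .
    have "dnorm j (x n) * dnorm j (y m - y n) \<le> C * d"
      using K'[of m n] that C by (intro mult_mono) (auto simp: less_imp_le)
    then show ?thesis using 1 d(2) by (simp add: algebra_simps)
  qed
  then show ?thesis by (rule that)
qed

text \<open>The definite description is resolved by one estimate,
  \<open>norm_iota_compose_diff_le\<close>, used for the Cauchy property and for comparing two pairs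
  of sequences.\<close>

lemma iota_compose_tendsto_L_mult:
  assumes x: "dlim 0 x X" and y: "dlim 0 y Y"
  shows "(\<lambda>n. \<iota> (x n o\<^sub>L y n)) \<longlonglongrightarrow> L_mult M \<phi> \<iota> X Y"
proof -
  have "Cauchy (\<lambda>n. \<iota> (x n o\<^sub>L y n))"
  proof (rule metric_CauchyI)
    fix e :: real assume "e > 0"
    obtain K where K: "\<And>m n. m \<ge> K \<Longrightarrow> n \<ge> K \<Longrightarrow>
        dnorm 0 (x m - x n) * dnorm 0 (y m) + dnorm 0 (x n) * dnorm 0 (y m - y n) < e"
      using product_cauchy_bound[OF x y \<open>e > 0\<close>] by blast
    show "\<exists>K. \<forall>m\<ge>K. \<forall>n\<ge>K. dist (\<iota> (x m o\<^sub>L y m)) (\<iota> (x n o\<^sub>L y n)) < e"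
      unfolding dist_norm
      by (intro exI[of _ K] allI impI le_less_trans[OF norm_iota_compose_diff_le] K dlim_in_M[OF x] dlim_in_M[OF y])
  qed
  from convergentD[OF Cauchy_convergent[OF this]] obtain Z where Z: "(\<lambda>n. \<iota> (x n o\<^sub>L y n)) \<longlonglongrightarrow> Z" ..
  have all: "(\<lambda>n. \<iota> (x' n o\<^sub>L y' n)) \<longlonglongrightarrow> Z" if x': "dlim 0 x' X" and y': "dlim 0 y' Y" for x' y'
  proof -
    have "(\<lambda>n. dnorm 0 (x' n - x n) * dnorm 0 (y' n) + dnorm 0 (x n) * dnorm 0 (y' n - y n)) \<longlonglongrightarrow>
        0 * Ldnorm 0 Y + Ldnorm 0 X * 0"
      by (intro tendsto_intros dnorm_diff_tendsto_0[OF x' x] dnorm_diff_tendsto_0[OF y' y]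
          dnorm_tendsto_Ldnorm[OF y'] dnorm_tendsto_Ldnorm[OF x])
    then have lim: "(\<lambda>n. dnorm 0 (x' n - x n) * dnorm 0 (y' n) + dnorm 0 (x n) * dnorm 0 (y' n - y n)) \<longlonglongrightarrow> 0"
      by simp
    have "(\<lambda>n. \<iota> (x' n o\<^sub>L y' n) - \<iota> (x n o\<^sub>L y n)) \<longlonglongrightarrow> 0"
      by (rule Lim_null_comparison[OF always_eventually lim])
        (intro allI norm_iota_compose_diff_le dlim_in_M[OF x'] dlim_in_M[OF y'] dlim_in_M[OF x] dlim_in_M[OF y])
    from tendsto_add[OF this Z] show ?thesis by simp
  qed
  have "L_mult M \<phi> \<iota> X Y = Z"
    unfolding L_mult_def dlim_0_eq[symmetric]
  proof (rule the_equality)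
    show "\<forall>x y. dlim 0 x X \<longrightarrow> dlim 0 y Y \<longrightarrow> (\<lambda>n. \<iota> (x n o\<^sub>L y n)) \<longlonglongrightarrow> Z"
      using all by simp
    show "Z' = Z" if "\<forall>x y. dlim 0 x X \<longrightarrow> dlim 0 y Y \<longrightarrow>
        (\<lambda>n. \<iota> (x n o\<^sub>L y n)) \<longlonglongrightarrow> Z'" for Z'
    proof (rule LIMSEQ_unique[OF _ Z])
      show "(\<lambda>n. \<iota> (x n o\<^sub>L y n)) \<longlonglongrightarrow> Z'" using that x y by simp
    qed
  qed
  then show ?thesis using Z by simp
qed

text \<open>A product loses one level. For this reason iterated products are formed in the
  intersection of all levels.\<close>

lemma dlim_compose:
  assumes x: "dlim (Suc j) x X" and y: "dlim (Suc j) y Y"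
  shows "dlim j (\<lambda>n. x n o\<^sub>L y n) (L_mult M \<phi> \<iota> X Y)"
  unfolding dlim_iff
proof (intro conjI allI impI)
  show "x n o\<^sub>L y n \<in> M" for n using dlim_in_M[OF x] dlim_in_M[OF y] by simp
  show "(\<lambda>n. \<iota> (x n o\<^sub>L y n)) \<longlonglongrightarrow> L_mult M \<phi> \<iota> X Y"
    using iota_compose_tendsto_L_mult[OF dlim_0[OF x] dlim_0[OF y]] .
  fix e :: real assume "e > 0"
  obtain K where K: "\<And>m n. m \<ge> K \<Longrightarrow> n \<ge> K \<Longrightarrow>
      dnorm (Suc j) (x m - x n) * dnorm (Suc j) (y m) + dnorm (Suc j) (x n) * dnorm (Suc j) (y m - y n) < e"
    using product_cauchy_bound[OF x y \<open>e > 0\<close>] by blast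
  show "\<exists>K. \<forall>m\<ge>K. \<forall>n\<ge>K. dnorm j ((x m o\<^sub>L y m) - (x n o\<^sub>L y n)) < e"
    by (intro exI[of _ K] allI impI le_less_trans[OF dnorm_compose_diff_le] K dlim_in_M[OF x] dlim_in_M[OF y])
qed

text \<open>\<open>L_state\<close> is described by sequences that are Cauchy for
  \<open>p_norm \<phi> 1\<close>. A \<open>dlim\<close> sequence is one, because
  \<open>\<iota>\<close> is isometric for this norm and its images converge.\<close>

lemma phi_tendsto_L_state:
  assumes x: "dlim j x X"
  shows "(\<lambda>n. \<phi> (x n)) \<longlonglongrightarrow> L_state M \<phi> \<iota> X"
proof -
  have le: "norm (\<phi> a - \<phi> b) \<le> norm (\<iota> a - \<iota> b)" if "a \<in> M" "b \<in> M" for a b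
    using cmod_phi_le_p_norm_1[of "a - b"] that by (simp add: phi_diff norm_iota flip: iota_diff)
  have M: "x n \<in> M" for n by (rule dlim_in_M[OF x])
  have Cauchy: "Cauchy (\<lambda>n. \<iota> (x n))"
    using dlim_iota[OF x] LIMSEQ_imp_Cauchy by blast
  have L1: "Lp_lim M \<phi> \<iota> 1 x X"
    using Cauchy dlim_iota[OF x] M
    by (simp add: Lp_lim_def Cauchy_def dist_norm norm_iota flip: iota_diff)
  have "Cauchy (\<lambda>n. \<phi> (x n))"
  proof (rule metric_CauchyI)
    fix e :: real assume "e > 0"
    then obtain K where K: "\<And>m n. m \<ge> K \<Longrightarrow> n \<ge> K \<Longrightarrow> norm (\<iota> (x m) - \<iota> (x n)) < e"
      using Cauchy unfolding Cauchy_def dist_norm by blast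
    show "\<exists>K. \<forall>m\<ge>K. \<forall>n\<ge>K. dist (\<phi> (x m)) (\<phi> (x n)) < e"
      unfolding dist_norm by (intro exI[of _ K] allI impI le_less_trans[OF le[OF M M]] K)
  qed
  from convergentD[OF Cauchy_convergent[OF this]] obtain c where c: "(\<lambda>n. \<phi> (x n)) \<longlonglongrightarrow> c" ..
  have all: "(\<lambda>n. \<phi> (y n)) \<longlonglongrightarrow> c" if y: "Lp_lim M \<phi> \<iota> 1 y X" for y
  proof -
    have yM: "y n \<in> M" for n using y by (simp add: Lp_lim_def)
    have "(\<lambda>n. \<iota> (y n) - \<iota> (x n)) \<longlonglongrightarrow> 0"
      using tendsto_diff[of "\<lambda>n. \<iota> (y n)" X _ "\<lambda>n. \<iota> (x n)" X] dlim_iota[OF x] y by (simp add: Lp_lim_def)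
    then have lim: "(\<lambda>n. norm (\<iota> (y n) - \<iota> (x n))) \<longlonglongrightarrow> 0"
      by (rule tendsto_norm_zero)
    have "(\<lambda>n. \<phi> (y n) - \<phi> (x n)) \<longlonglongrightarrow> 0"
      by (rule Lim_null_comparison[OF always_eventually lim]) (intro allI le yM M)
    from tendsto_add[OF this c] show ?thesis by simp
  qed
  have "L_state M \<phi> \<iota> X = c"
    unfolding L_state_def
  proof (rule the_equality)
    show "c' = c" if "\<forall>x. Lp_lim M \<phi> \<iota> 1 x X \<longrightarrow> (\<lambda>n. \<phi> (x n)) \<longlonglongrightarrow> c'" for c'
      using that L1 c LIMSEQ_unique by blast
  qed (use all in blast)
  then show ?thesis using c by simp
qed

text \<open>As \<open>L\<^sup>p(M)\<close> decreases with \<open>p\<close>, this is \<open>L_inf_minus M \<phi> \<iota>\<close>.\<close>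

definition L_dyadic :: "'l set" where
  "L_dyadic = {X. \<forall>j. \<exists>x. dlim j x X}"

lemma L_inf_minus_subset: "L_inf_minus M \<phi> \<iota> \<subseteq> L_dyadic"
proof
  fix X assume X: "X \<in> L_inf_minus M \<phi> \<iota>"
  have "\<exists>x. dlim j x X" for j
  proof -
    have "(1::real) \<le> 2 ^ Suc j" by (rule one_le_power) simp
    then show ?thesis using X by (simp add: L_inf_minus_def Lp_space_def dlim_def del: power_Suc)
  qed
  then show "X \<in> L_dyadic" by (simp add: L_dyadic_def)
qed

abbreviation mult (infixl "\<bullet>\<^sub>L" 70) where "X \<bullet>\<^sub>L Y \<equiv> L_mult M \<phi> \<iota> X Y"

lemma L_dyadic_add: "X \<in> L_dyadic \<Longrightarrow> Y \<in> L_dyadic \<Longrightarrow> X + Y \<in> L_dyadic"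
  unfolding L_dyadic_def mem_Collect_eq by (meson dlim_add)

lemma L_dyadic_diff: "X \<in> L_dyadic \<Longrightarrow> Y \<in> L_dyadic \<Longrightarrow> X - Y \<in> L_dyadic"
  unfolding L_dyadic_def mem_Collect_eq by (meson dlim_diff)

lemma L_dyadic_mult: "X \<in> L_dyadic \<Longrightarrow> Y \<in> L_dyadic \<Longrightarrow> X \<bullet>\<^sub>L Y \<in> L_dyadic"
  unfolding L_dyadic_def mem_Collect_eq by (meson dlim_compose)

lemma L_dyadic_iota: "x \<in> M \<Longrightarrow> \<iota> x \<in> L_dyadic"
  using dlim_const by (auto simp: L_dyadic_def)

lemma L_dyadic_zero: "0 \<in> L_dyadic"
  using L_dyadic_diff[OF L_dyadic_iota[OF M_id] L_dyadic_iota[OF M_id]] by simp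

lemma L_dyadicE:
  assumes "X \<in> L_dyadic"
  obtains x where "dlim j x X"
  using assms by (auto simp: L_dyadic_def)

lemma L_mult_add_left:
  assumes "X \<in> L_dyadic" "Y \<in> L_dyadic" "Z \<in> L_dyadic"
  shows "(X + Y) \<bullet>\<^sub>L Z = X \<bullet>\<^sub>L Z + Y \<bullet>\<^sub>L Z"
proof -
  obtain x where x: "dlim 1 x X" using L_dyadicE assms(1) by blast
  obtain y where y: "dlim 1 y Y" using L_dyadicE assms(2) by blast
  obtain z where z: "dlim 1 z Z" using L_dyadicE assms(3) by blast
  have "(\<lambda>n. \<iota> ((x n + y n) o\<^sub>L z n)) \<longlonglongrightarrow> (X + Y) \<bullet>\<^sub>L Z"
    by (intro iota_compose_tendsto_L_mult dlim_0[OF dlim_add[OF x y]] dlim_0[OF z])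
  moreover have "(\<lambda>n. \<iota> (x n o\<^sub>L z n) + \<iota> (y n o\<^sub>L z n)) \<longlonglongrightarrow> X \<bullet>\<^sub>L Z + Y \<bullet>\<^sub>L Z"
    by (intro tendsto_add iota_compose_tendsto_L_mult dlim_0[OF x] dlim_0[OF y] dlim_0[OF z])
  moreover have "\<iota> ((x n + y n) o\<^sub>L z n) = \<iota> (x n o\<^sub>L z n) + \<iota> (y n o\<^sub>L z n)" for n
    using dlim_in_M[OF x] dlim_in_M[OF y] dlim_in_M[OF z] by (simp add: o_add_left iota_add)
  ultimately show ?thesis by (simp add: LIMSEQ_unique)
qed

lemma L_mult_add_right:
  assumes "X \<in> L_dyadic" "Y \<in> L_dyadic" "Z \<in> L_dyadic"
  shows "X \<bullet>\<^sub>L (Y + Z) = X \<bullet>\<^sub>L Y + X \<bullet>\<^sub>L Z"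
proof -
  obtain x where x: "dlim 1 x X" using L_dyadicE assms(1) by blast
  obtain y where y: "dlim 1 y Y" using L_dyadicE assms(2) by blast
  obtain z where z: "dlim 1 z Z" using L_dyadicE assms(3) by blast
  have "(\<lambda>n. \<iota> (x n o\<^sub>L (y n + z n))) \<longlonglongrightarrow> X \<bullet>\<^sub>L (Y + Z)"
    by (intro iota_compose_tendsto_L_mult dlim_0[OF dlim_add[OF y z]] dlim_0[OF x])
  moreover have "(\<lambda>n. \<iota> (x n o\<^sub>L y n) + \<iota> (x n o\<^sub>L z n)) \<longlonglongrightarrow> X \<bullet>\<^sub>L Y + X \<bullet>\<^sub>L Z"
    by (intro tendsto_add iota_compose_tendsto_L_mult dlim_0[OF x] dlim_0[OF y] dlim_0[OF z])
  moreover have "\<iota> (x n o\<^sub>L (y n + z n)) = \<iota> (x n o\<^sub>L y n) + \<iota> (x n o\<^sub>L z n)" for n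
    using dlim_in_M[OF x] dlim_in_M[OF y] dlim_in_M[OF z] by (simp add: o_add_right iota_add)
  ultimately show ?thesis by (simp add: LIMSEQ_unique)
qed

lemma L_state_add:
  assumes "X \<in> L_dyadic" "Y \<in> L_dyadic"
  shows "L_state M \<phi> \<iota> (X + Y) = L_state M \<phi> \<iota> X + L_state M \<phi> \<iota> Y"
proof -
  obtain x where x: "dlim 0 x X" using L_dyadicE assms(1) by blast
  obtain y where y: "dlim 0 y Y" using L_dyadicE assms(2) by blast
  have "(\<lambda>n. \<phi> (x n + y n)) \<longlonglongrightarrow> L_state M \<phi> \<iota> (X + Y)"
    by (rule phi_tendsto_L_state[OF dlim_add[OF x y]])
  moreover have "(\<lambda>n. \<phi> (x n) + \<phi> (y n)) \<longlonglongrightarrow> L_state M \<phi> \<iota> X + L_state M \<phi> \<iota> Y"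
    by (intro tendsto_add phi_tendsto_L_state[OF x] phi_tendsto_L_state[OF y])
  ultimately show ?thesis
    using dlim_in_M[OF x] dlim_in_M[OF y] by (simp add: phi_add LIMSEQ_unique)
qed

lemma L_state_zero: "L_state M \<phi> \<iota> 0 = 0"
  using L_state_add[OF L_dyadic_zero L_dyadic_zero] by simp

lemma L_mult_zero_left: "Y \<in> L_dyadic \<Longrightarrow> 0 \<bullet>\<^sub>L Y = 0"
  using L_mult_add_left[OF L_dyadic_zero L_dyadic_zero, of Y] by simp

lemma L_mult_zero_right: "Y \<in> L_dyadic \<Longrightarrow> Y \<bullet>\<^sub>L 0 = 0"
  using L_mult_add_right[OF _ L_dyadic_zero L_dyadic_zero, of Y] by simp

lemma Ldnorm_nonneg:
  assumes "X \<in> L_dyadic"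
  shows "0 \<le> Ldnorm j X"
proof -
  obtain x where "dlim j x X" using L_dyadicE assms by blast
  then show ?thesis
    by (rule tendsto_lowerbound[OF dnorm_tendsto_Ldnorm]) auto
qed

lemma Ldnorm_triangle:
  assumes "X \<in> L_dyadic" "Y \<in> L_dyadic"
  shows "Ldnorm j (X + Y) \<le> Ldnorm j X + Ldnorm j Y"
proof -
  obtain x where x: "dlim j x X" using L_dyadicE assms(1) by blast
  obtain y where y: "dlim j y Y" using L_dyadicE assms(2) by blast
  show ?thesis
    using dnorm_tendsto_Ldnorm[OF dlim_add[OF x y]]
      tendsto_add[OF dnorm_tendsto_Ldnorm[OF x] dnorm_tendsto_Ldnorm[OF y]]
    by (rule LIMSEQ_le) (use dnorm_triangle[OF dlim_in_M[OF x] dlim_in_M[OF y]] in blast)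
qed

lemma Ldnorm_mult:
  assumes "X \<in> L_dyadic" "Y \<in> L_dyadic"
  shows "Ldnorm j (X \<bullet>\<^sub>L Y) \<le> Ldnorm (Suc j) X * Ldnorm (Suc j) Y"
proof -
  obtain x where x: "dlim (Suc j) x X" using L_dyadicE assms(1) by blast
  obtain y where y: "dlim (Suc j) y Y" using L_dyadicE assms(2) by blast
  show ?thesis
    using dnorm_tendsto_Ldnorm[OF dlim_compose[OF x y]]
      tendsto_mult[OF dnorm_tendsto_Ldnorm[OF x] dnorm_tendsto_Ldnorm[OF y]]
    by (rule LIMSEQ_le) (use dnorm_compose[OF dlim_in_M[OF x] dlim_in_M[OF y]] in blast)
qed

lemma cmod_L_state_le:
  assumes "X \<in> L_dyadic"
  shows "cmod (L_state M \<phi> \<iota> X) \<le> Ldnorm 0 X"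
proof -
  obtain x where x: "dlim 0 x X" using L_dyadicE assms(1) by blast
  show ?thesis
    using tendsto_norm[OF phi_tendsto_L_state[OF x]] dnorm_tendsto_Ldnorm[OF x]
    by (rule LIMSEQ_le)
      (use cmod_phi_le_p_norm_1 p_norm_1_le_dnorm dlim_in_M[OF x] order_trans in blast)
qed

end

section \<open>Sums over tuples and polynomials\<close>

lemma finite_lists_over: "finite {js. set js \<subseteq> {..<m::nat} \<and> length js = n}"
  by (rule finite_lists_length_eq) simp

text \<open>The increasing enumeration \<open>e\<close> of \<open>S\<close> maps the tuples with
  values \<open>{..<card S}\<close> bijectively to those with values \<open>S\<close>, and
  \<open>F\<close> does not notice the relabelling.\<close>

lemma sum_lists_with_support:
  fixes F :: "nat list \<Rightarrow> 'a::comm_monoid_add"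
  assumes invariant: "\<And>js e. length js = n \<Longrightarrow> strict_mono_on (set js) e \<Longrightarrow> F (map e js) = F js"
    and "finite S"
  shows "(\<Sum>js | set js = S \<and> length js = n. F js) = (\<Sum>js | set js = {..<card S} \<and> length js = n. F js)"
proof -
  obtain e where e: "bij_betw e {..<card S} S" and mono: "strict_mono_on {..<card S} e"
    using ex_bij_betw_strict_mono_card[OF \<open>finite S\<close>] by blast
  have inj: "inj_on e {..<card S}" and img: "e ` {..<card S} = S"
    using e by (auto simp: bij_betw_def)
  have "bij_betw (map e) {js. set js = {..<card S} \<and> length js = n} {js. set js = S \<and> length js = n}"
  proof (rule bij_betw_imageI)
    show "inj_on (map e) {js. set js = {..<card S} \<and> length js = n}"
      by (rule inj_onI, rule map_inj_on[of e]) (use inj in auto)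
    show "map e ` {js. set js = {..<card S} \<and> length js = n} = {js. set js = S \<and> length js = n}"
    proof (intro subset_antisym subsetI)
      fix js assume js: "js \<in> {js. set js = S \<and> length js = n}"
      define ks where "ks = map (inv_into {..<card S} e) js"
      have "map e ks = js"
        unfolding ks_def map_map by (rule map_idI) (use js img in \<open>auto simp: f_inv_into_f\<close>)
      moreover have "set ks = {..<card S}"
        using js bij_betw_imp_surj_on[OF bij_betw_inv_into[OF e]] by (simp add: ks_def)
      ultimately show "js \<in> map e ` {js. set js = {..<card S} \<and> length js = n}"
        using js by (intro image_eqI[of js "map e" ks]) (auto simp: ks_def)
    qed (use img in auto)
  qed
  then have "(\<Sum>js | set js = S \<and> length js = n. F js) =
      (\<Sum>js | set js = {..<card S} \<and> length js = n. F (map e js))"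
    by (rule sum.reindex_bij_betw[symmetric])
  also have "\<dots> = (\<Sum>js | set js = {..<card S} \<and> length js = n. F js)"
    using mono by (intro sum.cong invariant) auto
  finally show ?thesis .
qed

text \<open>Tuples are grouped by their set of values, and these sets by their cardinality.\<close>

lemma sum_lists_eq_binomial_sum:
  fixes F :: "nat list \<Rightarrow> complex"
  assumes invariant: "\<And>js e. length js = n \<Longrightarrow> strict_mono_on (set js) e \<Longrightarrow> F (map e js) = F js"
  shows "(\<Sum>js | set js \<subseteq> {..<m} \<and> length js = n. F js) =
    (\<Sum>r\<le>n. of_nat (m choose r) * (\<Sum>js | set js = {..<r} \<and> length js = n. F js))"
proof -
  define G where "G r = (\<Sum>js | set js = {..<r} \<and> length js = n. F js)" for r
  let ?L = "{js. set js \<subseteq> {..<m} \<and> length js = n}"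
  have "(\<Sum>js\<in>?L. F js) = (\<Sum>S\<in>Pow {..<m}. \<Sum>js | js \<in> ?L \<and> set js = S. F js)"
    by (rule sum.group[symmetric]) (auto simp: finite_lists_over)
  also have "\<dots> = (\<Sum>S\<in>Pow {..<m}. G (card S))"
  proof (rule sum.cong[OF refl])
    fix S assume S: "S \<in> Pow {..<m}"
    then have "{js. js \<in> ?L \<and> set js = S} = {js. set js = S \<and> length js = n}" by auto
    moreover have "finite S" using S finite_subset by blast
    ultimately show "(\<Sum>js | js \<in> ?L \<and> set js = S. F js) = G (card S)"
      using sum_lists_with_support[of n F S] invariant by (simp add: G_def)
  qed
  also have "\<dots> = (\<Sum>r\<le>m. \<Sum>S | S \<in> Pow {..<m} \<and> card S = r. G (card S))"
    by (rule sum.group[symmetric]) (auto dest: card_mono[rotated])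
  also have "\<dots> = (\<Sum>r\<le>m. of_nat (m choose r) * G r)"
    by (rule sum.cong) (auto simp: n_subsets)
  \<comment> \<open>The range is extended, as \<open>m choose r = 0\<close> for
    \<open>r > m\<close>, and then cut at \<open>n\<close>, as a tuple of length \<open>n\<close>
    has at most \<open>n\<close> values. The new range no longer depends on
    \<open>m\<close>.\<close>
  also have "\<dots> = (\<Sum>r\<le>max m n. of_nat (m choose r) * G r)"
    by (rule sum.mono_neutral_left) auto
  also have "\<dots> = (\<Sum>r\<le>n. of_nat (m choose r) * G r)"
  proof (rule sum.mono_neutral_right)
    have "{js. set js = {..<r} \<and> length js = n} = {}" if "r > n" for r
    proof -
      have "length js \<noteq> n" if "set js = {..<r}" for js
        using card_length[of js] that \<open>r > n\<close> by simp
      then show ?thesis by blast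
    qed
    then have "G r = 0" if "r > n" for r using that unfolding G_def by (metis sum.empty)
    then show "\<forall>r\<in>{..max m n} - {..n}. of_nat (m choose r) * G r = 0" by simp
  qed auto
  finally show ?thesis by (simp add: G_def)
qed

lemma binomial_polynomial:
  obtains q :: "complex poly" where "degree q \<le> r" "\<And>m. poly q (of_nat m) = of_nat (m choose r)"
proof -
  define q :: "complex poly" where "q = smult (1 / fact r) (\<Prod>i=0..<r. [:- of_nat i, 1:])"
  have "degree (\<Prod>i=0..<r. [:- of_nat i, 1 :: complex:]) \<le> r"
    by (rule order_trans[OF degree_prod_sum_le]) auto
  then have "degree q \<le> r" by (simp add: q_def)
  moreover have "poly q (of_nat m) = of_nat (m choose r)" for m
    by (simp add: q_def poly_prod binomial_gbinomial gbinomial_prod_rev)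
  ultimately show ?thesis by (rule that)
qed

lemma poly_eqI_of_nat:
  fixes p q :: "complex poly"
  assumes "\<And>m. poly p (of_nat m) = poly q (of_nat m)"
  shows "p = q"
proof (rule ccontr)
  assume "p \<noteq> q"
  then have "finite {x. poly (p - q) x = 0}" by (intro poly_roots_finite) simp
  moreover have "range of_nat \<subseteq> {x. poly (p - q) x = 0}" using assms by auto
  ultimately have "finite (range (of_nat :: nat \<Rightarrow> complex))" by (rule rev_finite_subset)
  then show False by (simp add: finite_image_iff inj_on_def)
qed

text \<open>The continuity assumption speaks only of positive sequences avoiding their limit,
  matching the punctured limit in the continuity of a flow. It is applied to rationals increasing to
  an irrational \<open>t\<close>.\<close>

lemma polynomial_if_polynomial_on_multiples:
  fixes f :: "real \<Rightarrow> complex"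
  assumes multiples: "\<And>t. t > 0 \<Longrightarrow> \<exists>p. degree p \<le> n \<and> (\<forall>m::nat. poly p (of_nat m) = f (real m * t))"
    and continuous: "\<And>t u. t > 0 \<Longrightarrow> u \<longlonglongrightarrow> t \<Longrightarrow> (\<And>k. u k > 0 \<and> u k \<noteq> t) \<Longrightarrow> (\<lambda>k::nat. f (u k)) \<longlonglongrightarrow> f t"
  shows "\<exists>p. degree p \<le> n \<and> (\<forall>t\<ge>0. f t = poly p (of_real t))"
proof -
  obtain p where p: "degree p \<le> n" "\<And>m::nat. poly p (of_nat m) = f (real m)"
    using multiples[of 1] by auto
  have rational: "f (real m / real d) = poly p (of_real (real m / real d))" if "d > 0" for m d :: nat
  proof -
    obtain q where q: "\<And>m::nat. poly q (of_nat m) = f (real m * (1 / real d))"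
      using multiples[of "1 / real d"] \<open>d > 0\<close> by auto
    \<comment> \<open>Both sides interpolate \<open>f\<close> at the natural numbers:
      \<open>m\<close> equals \<open>m * d\<close> steps of length \<open>1 / d\<close>.\<close>
    have "pcompose q [:0, of_nat d:] = p"
    proof (rule poly_eqI_of_nat)
      fix m
      show "poly (pcompose q [:0, of_nat d:]) (of_nat m) = poly p (of_nat m)"
        using q[of "m * d"] that by (simp add: poly_pcompose p(2))
    qed
    then have "poly p (of_real (real m / real d)) = poly q (of_nat m)"
      using that by (auto simp: poly_pcompose)
    then show ?thesis using q[of m] by simp
  qed
  have "f t = poly p (of_real t)" if "t \<ge> 0" for t
  proof (cases "t \<in> \<rat>")
    case True
    then obtain m d :: nat where "d \<noteq> 0" "\<bar>t\<bar> = real m / real d"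
      using Rats_abs_nat_div_natE by metis
    then show ?thesis using rational[of d m] that by simp
  next
    case False
    then have "t > 0" using that by (metis Rats_0 less_eq_real_def)
    \<comment> \<open>The \<open>max\<close> with 0 keeps the approximating rationals
      positive.\<close>
    have "\<exists>r\<in>\<rat>. max 0 (t - inverse (Suc k)) < r \<and> r < t" for k
      using \<open>t > 0\<close> by (intro Rats_dense_in_real) auto
    then obtain u where u: "\<And>k. u k \<in> \<rat>" "\<And>k. max 0 (t - inverse (Suc k)) < u k" "\<And>k. u k < t"
      by metis
    have "u \<longlonglongrightarrow> t"
    proof (rule tendsto_sandwich)
      show "(\<lambda>k. t - inverse (Suc k)) \<longlonglongrightarrow> t"
        using tendsto_diff[OF tendsto_const LIMSEQ_inverse_real_of_nat, of t] by simp
      show "\<forall>\<^sub>F k in sequentially. t - inverse (Suc k) \<le> u k"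
        using u(2) by (simp add: less_imp_le)
      show "\<forall>\<^sub>F k in sequentially. u k \<le> t"
        using u(3) by (simp add: less_imp_le)
    qed simp
    moreover have "f (u k) = poly p (of_real (u k))" for k
    proof -
      have "u k > 0" using u(2)[of k] by simp
      then obtain m d :: nat where "d \<noteq> 0" "u k = real m / real d"
        using Rats_abs_nat_div_natE[OF u(1)[of k]] by (metis abs_of_pos)
      then show ?thesis using rational[of d m] by simp
    qed
    moreover have "u k > 0 \<and> u k \<noteq> t" for k using u(2,3)[of k] by simp
    ultimately have "(\<lambda>k. poly p (of_real (u k))) \<longlonglongrightarrow> f t" "u \<longlonglongrightarrow> t"
      using continuous[OF \<open>t > 0\<close>, of u] by auto
    moreover from this(2) have "(\<lambda>k. poly p (of_real (u k))) \<longlonglongrightarrow> poly p (of_real t)"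
      by (intro isCont_tendsto_compose[OF poly_isCont] tendsto_of_real)
    ultimately show ?thesis using LIMSEQ_unique by blast
  qed
  then show ?thesis using p(1) by blast
qed

section \<open>Order classes\<close>

lemma order_class_nonempty_tuples:
  assumes "\<sigma> \<in> order_classes n"
  shows "\<sigma> \<noteq> {}" "\<sigma> \<subseteq> tuples n"
  using assms equiv_order_equiv in_quotient_imp_non_empty in_quotient_imp_subset
  unfolding order_classes_def by blast+

lemma num_values_range:
  assumes "n \<ge> 1" "\<sigma> \<in> order_classes n"
  shows "num_values \<sigma> \<in> {1..n}"
proof -
  obtain i where i: "i \<in> \<sigma>" "length i = n"
    using order_class_nonempty_tuples[OF assms(2)] by (auto simp: tuples_def)
  then have "num_values \<sigma> = card (set i)" using num_values_eq[OF assms(2)] by simp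
  moreover have "card (set i) \<le> n" using i card_length by blast
  moreover have "set i \<noteq> {}" using i assms(1) by auto
  ultimately show ?thesis by (simp add: Suc_le_eq card_gt_0_iff)
qed

lemma order_class_exists:
  assumes "r \<in> {1..n}"
  shows "\<exists>\<sigma>\<in>order_classes n. num_values \<sigma> = r"
proof -
  define i where "i = [1..<Suc r] @ replicate (n - r) 1"
  have set_i: "set i = {1..r}" using assms by (auto simp: i_def)
  have "i \<in> tuples n" using assms set_i by (auto simp: tuples_def) (simp add: i_def)
  then have "order_equiv n `` {i} \<in> order_classes n" "i \<in> order_equiv n `` {i}"
    by (simp_all add: order_classes_def quotientI) (simp add: order_equiv_def)
  then show ?thesis using num_values_eq[of _ n i] set_i by auto
qed

text \<open>There is at least one order class for each number of values between 1 and \<open>n\<close>, so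
  the coefficient of degree \<open>r\<close> can be distributed evenly over the classes with \<open>r\<close> values.\<close>

lemma polynomials_as_order_class_sums:
  fixes p :: "nat \<Rightarrow> complex poly"
  assumes "\<And>n. n \<ge> 1 \<Longrightarrow> degree (p n) \<le> n \<and> poly (p n) 0 = 0"
  shows "\<exists>c. \<forall>n\<ge>1. \<forall>x. poly (p n) x =
    (\<Sum>\<sigma>\<in>order_classes n. 1 / fact (num_values \<sigma>) * c \<sigma> * x ^ num_values \<sigma>)"
proof -
  define N where "N n r = card {\<sigma> \<in> order_classes n. num_values \<sigma> = r}" for n r
  \<comment> \<open>Recovers \<open>n\<close> from a class, since \<open>c\<close> takes only the
    class as argument; all members are tuples of length \<open>n\<close>.\<close>
  define len where "len \<sigma> = length (SOME i. i \<in> \<sigma>)" for \<sigma> :: "nat list set"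
  \<comment> \<open>The factorial cancels the factor \<open>1 / fact\<close>, and the division
    shares the coefficient among the classes with the same number of values.\<close>
  define c where "c \<sigma> = fact (num_values \<sigma>) * coeff (p (len \<sigma>)) (num_values \<sigma>)
      / of_nat (N (len \<sigma>) (num_values \<sigma>))" for \<sigma>
  have "poly (p n) x = (\<Sum>\<sigma>\<in>order_classes n. 1 / fact (num_values \<sigma>) * c \<sigma> * x ^ num_values \<sigma>)"
    if n: "n \<ge> 1" for n x
  proof -
    have len: "len \<sigma> = n" if "\<sigma> \<in> order_classes n" for \<sigma>
      using order_class_nonempty_tuples[OF that] someI_ex[of "\<lambda>i. i \<in> \<sigma>"]
      by (auto simp: len_def tuples_def)
    have N: "N n r > 0" if "r \<in> {1..n}" for r
      using order_class_exists[OF that] finite_order_classes[of n] by (auto simp: N_def card_gt_0_iff)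
    let ?g = "\<lambda>r. coeff (p n) r * x ^ r"
    have "(\<Sum>\<sigma>\<in>order_classes n. 1 / fact (num_values \<sigma>) * c \<sigma> * x ^ num_values \<sigma>) =
        (\<Sum>\<sigma>\<in>order_classes n. ?g (num_values \<sigma>) / of_nat (N n (num_values \<sigma>)))"
      by (rule sum.cong) (auto simp: c_def len)
    also have "\<dots> = (\<Sum>r\<in>{1..n}. \<Sum>\<sigma> | \<sigma> \<in> order_classes n \<and> num_values \<sigma> = r.
        ?g (num_values \<sigma>) / of_nat (N n (num_values \<sigma>)))"
      using num_values_range[OF n] finite_order_classes by (intro sum.group[symmetric]) auto
    also have "\<dots> = (\<Sum>r\<in>{1..n}. of_nat (N n r) * (?g r / of_nat (N n r)))"
      by (rule sum.cong) (auto simp: N_def)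
    also have "\<dots> = (\<Sum>r\<in>{1..n}. ?g r)"
      using N by (intro sum.cong) (auto simp del: atLeastAtMost_iff)
    \<comment> \<open>No class has 0 values; the missing term is 0 because \<open>p n\<close>
      vanishes at 0.\<close>
    also have "\<dots> = (\<Sum>r\<in>{0..n}. ?g r)"
      using assms[OF n] by (intro sum.mono_neutral_left) (auto simp: poly_0_coeff_0 Suc_le_eq)
    also have "\<dots> = poly (p n) x"
      using assms[OF n] poly_altdef[of "p n" x]
      by (simp add: atMost_atLeast0[symmetric])
        (intro sum.mono_neutral_right, auto simp: coeff_eq_0)
    finally show ?thesis by simp
  qed
  then show ?thesis by (intro exI[of _ c]) blast
qed

section \<open>Moments of a flow\<close>

context tracial_L1
begin

lemma L_prod_simps [simp]:
  "L_prod M \<phi> \<iota> [] = \<iota> id_blinfun" "L_prod M \<phi> \<iota> (X # Xs) = X \<bullet>\<^sub>L L_prod M \<phi> \<iota> Xs"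
  by (simp_all add: L_prod_def)

lemma L_prod_in_L_dyadic: "set Xs \<subseteq> L_dyadic \<Longrightarrow> L_prod M \<phi> \<iota> Xs \<in> L_dyadic"
  by (induction Xs) (auto intro: L_dyadic_iota L_dyadic_mult)

lemma L_dyadic_sum: "(\<And>k. k \<in> S \<Longrightarrow> b k \<in> L_dyadic) \<Longrightarrow> sum b S \<in> L_dyadic"
  by (induction S rule: infinite_finite_induct) (auto intro: L_dyadic_zero L_dyadic_add)

lemma L_mult_sum_left:
  "(\<And>k. k \<in> S \<Longrightarrow> b k \<in> L_dyadic) \<Longrightarrow> Y \<in> L_dyadic \<Longrightarrow> sum b S \<bullet>\<^sub>L Y = (\<Sum>k\<in>S. b k \<bullet>\<^sub>L Y)"
  by (induction S rule: infinite_finite_induct) (auto simp: L_mult_zero_left L_mult_add_left L_dyadic_sum)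

lemma L_mult_sum_right:
  "(\<And>k. k \<in> S \<Longrightarrow> b k \<in> L_dyadic) \<Longrightarrow> Y \<in> L_dyadic \<Longrightarrow> Y \<bullet>\<^sub>L sum b S = (\<Sum>k\<in>S. Y \<bullet>\<^sub>L b k)"
  by (induction S rule: infinite_finite_induct) (auto simp: L_mult_zero_right L_mult_add_right L_dyadic_sum)

lemma L_state_sum:
  "(\<And>k. k \<in> S \<Longrightarrow> b k \<in> L_dyadic) \<Longrightarrow> L_state M \<phi> \<iota> (sum b S) = (\<Sum>k\<in>S. L_state M \<phi> \<iota> (b k))"
  by (induction S rule: infinite_finite_induct) (auto simp: L_state_zero L_state_add L_dyadic_sum)

text \<open>The noncommutative multinomial expansion. \<open>L_prod\<close> nests to the right, so
  each new factor prepends an index.\<close>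

lemma L_prod_replicate_sum:
  assumes b: "\<And>k. k < m \<Longrightarrow> b k \<in> L_dyadic"
  shows "L_prod M \<phi> \<iota> (replicate n (\<Sum>k<m. b k)) =
    (\<Sum>js | set js \<subseteq> {..<m} \<and> length js = n. L_prod M \<phi> \<iota> (map b js))"
proof (induction n)
  case 0
  have "{js. set js \<subseteq> {..<m} \<and> length js = 0} = {[]}" by auto
  then show ?case by simp
next
  case (Suc n)
  let ?L = "{js. set js \<subseteq> {..<m} \<and> length js = n}"
  have L: "L_prod M \<phi> \<iota> (map b js) \<in> L_dyadic" if "js \<in> ?L" for js
    using that b by (intro L_prod_in_L_dyadic) auto
  have "L_prod M \<phi> \<iota> (replicate (Suc n) (\<Sum>k<m. b k)) =
      (\<Sum>k<m. b k) \<bullet>\<^sub>L (\<Sum>js\<in>?L. L_prod M \<phi> \<iota> (map b js))"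
    using Suc.IH by simp
  also have "\<dots> = (\<Sum>js\<in>?L. (\<Sum>k<m. b k) \<bullet>\<^sub>L L_prod M \<phi> \<iota> (map b js))"
    using L b by (intro L_mult_sum_right L_dyadic_sum) auto
  also have "\<dots> = (\<Sum>js\<in>?L. \<Sum>k<m. b k \<bullet>\<^sub>L L_prod M \<phi> \<iota> (map b js))"
    using L b by (intro sum.cong refl L_mult_sum_left) auto
  also have "\<dots> = (\<Sum>(js, k)\<in>?L \<times> {..<m}. L_prod M \<phi> \<iota> (map b (k # js)))"
    by (simp add: sum.cartesian_product)
  also have "\<dots> = (\<Sum>js\<in>(\<lambda>(js, k). k # js) ` (?L \<times> {..<m}). L_prod M \<phi> \<iota> (map b js))"
    by (subst sum.reindex) (auto simp: inj_on_def case_prod_beta)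
  also have "(\<lambda>(js, k). k # js) ` (?L \<times> {..<m}) = {js. set js \<subseteq> {..<m} \<and> length js = Suc n}"
    by (rule lists_length_Suc_eq[symmetric])
  finally show ?case .
qed

lemma moment_replicate_sum:
  assumes b: "\<And>k. k < m \<Longrightarrow> b k \<in> L_dyadic"
  shows "moment M \<phi> \<iota> (replicate n (\<Sum>k<m. b k)) =
    (\<Sum>js | set js \<subseteq> {..<m} \<and> length js = n. moment M \<phi> \<iota> (map b js))"
proof -
  have "moment M \<phi> \<iota> (replicate n (\<Sum>k<m. b k)) =
      L_state M \<phi> \<iota> (\<Sum>js | set js \<subseteq> {..<m} \<and> length js = n. L_prod M \<phi> \<iota> (map b js))"
    using L_prod_replicate_sum[of m b n] b by (simp add: moment_def)
  also have "\<dots> = (\<Sum>js | set js \<subseteq> {..<m} \<and> length js = n. moment M \<phi> \<iota> (map b js))"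
    unfolding moment_def using b by (intro L_state_sum L_prod_in_L_dyadic) auto
  finally show ?thesis .
qed

text \<open>All levels at once, because the estimate of a product at level \<open>j\<close> uses its
  factors at level \<open>Suc j\<close>.\<close>

definition dyadic_tendsto :: "(nat \<Rightarrow> 'l) \<Rightarrow> 'l \<Rightarrow> bool" where
  "dyadic_tendsto Y X \<longleftrightarrow> (\<forall>k. Y k \<in> L_dyadic) \<and> X \<in> L_dyadic \<and> (\<forall>j. (\<lambda>k. Ldnorm j (Y k - X)) \<longlonglongrightarrow> 0)"

lemma dyadic_tendsto_const: "X \<in> L_dyadic \<Longrightarrow> dyadic_tendsto (\<lambda>_. X) X"
  using dnorm_tendsto_Ldnorm[OF dlim_const[OF M_zero]] iota_add[of 0 0]
  by (simp add: dyadic_tendsto_def LIMSEQ_const_iff)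

lemma dyadic_tendsto_mult:
  assumes Y: "dyadic_tendsto Y X" and W: "dyadic_tendsto W V"
  shows "dyadic_tendsto (\<lambda>k. Y k \<bullet>\<^sub>L W k) (X \<bullet>\<^sub>L V)"
proof -
  have D: "Y k \<in> L_dyadic" "W k \<in> L_dyadic" "X \<in> L_dyadic" "V \<in> L_dyadic" for k
    using Y W by (auto simp: dyadic_tendsto_def)
  have "(\<lambda>k. Ldnorm j (Y k \<bullet>\<^sub>L W k - X \<bullet>\<^sub>L V)) \<longlonglongrightarrow> 0" for j
  proof (rule Lim_null_comparison[OF always_eventually])
    let ?N = "Ldnorm (Suc j)"
    \<comment> \<open>The norm of \<open>W k\<close> is replaced by that of \<open>W k - V\<close>
      plus that of \<open>V\<close>, which makes the limit explicit.\<close>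
    have "(\<lambda>k. ?N (Y k - X) * (?N (W k - V) + ?N V) + ?N X * ?N (W k - V)) \<longlonglongrightarrow>
        0 * (0 + ?N V) + ?N X * 0"
      using Y W by (intro tendsto_intros) (auto simp: dyadic_tendsto_def)
    then show "(\<lambda>k. ?N (Y k - X) * (?N (W k - V) + ?N V) + ?N X * ?N (W k - V)) \<longlonglongrightarrow> 0"
      by simp
    show "\<forall>k. norm (Ldnorm j (Y k \<bullet>\<^sub>L W k - X \<bullet>\<^sub>L V)) \<le>
        ?N (Y k - X) * (?N (W k - V) + ?N V) + ?N X * ?N (W k - V)"
    proof
      fix k
      have "(Y k - X) \<bullet>\<^sub>L W k = Y k \<bullet>\<^sub>L W k - X \<bullet>\<^sub>L W k"
        using L_mult_add_left[of "Y k - X" X "W k"] D by (simp add: L_dyadic_diff)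
      moreover have "X \<bullet>\<^sub>L (W k - V) = X \<bullet>\<^sub>L W k - X \<bullet>\<^sub>L V"
        using L_mult_add_right[of X "W k - V" V] D by (simp add: L_dyadic_diff)
      ultimately have "Y k \<bullet>\<^sub>L W k - X \<bullet>\<^sub>L V = (Y k - X) \<bullet>\<^sub>L W k + X \<bullet>\<^sub>L (W k - V)"
        by simp
      then have "Ldnorm j (Y k \<bullet>\<^sub>L W k - X \<bullet>\<^sub>L V) \<le>
          Ldnorm j ((Y k - X) \<bullet>\<^sub>L W k) + Ldnorm j (X \<bullet>\<^sub>L (W k - V))"
        using Ldnorm_triangle D L_dyadic_diff L_dyadic_mult by simp
      also have "\<dots> \<le> ?N (Y k - X) * ?N (W k) + ?N X * ?N (W k - V)"
        by (intro add_mono Ldnorm_mult L_dyadic_diff D)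
      also have "\<dots> \<le> ?N (Y k - X) * (?N (W k - V) + ?N V) + ?N X * ?N (W k - V)"
        using Ldnorm_triangle[of "W k - V" V "Suc j"] D
        by (intro add_right_mono mult_left_mono Ldnorm_nonneg) (auto intro: L_dyadic_diff)
      finally show "norm (Ldnorm j (Y k \<bullet>\<^sub>L W k - X \<bullet>\<^sub>L V)) \<le>
          ?N (Y k - X) * (?N (W k - V) + ?N V) + ?N X * ?N (W k - V)"
        using Ldnorm_nonneg[of "Y k \<bullet>\<^sub>L W k - X \<bullet>\<^sub>L V" j] D by (simp add: L_dyadic_diff L_dyadic_mult)
    qed
  qed
  then show ?thesis using D by (simp add: dyadic_tendsto_def L_dyadic_mult)
qed

lemma dyadic_tendsto_L_prod_replicate:
  "dyadic_tendsto Y X \<Longrightarrow>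
    dyadic_tendsto (\<lambda>k. L_prod M \<phi> \<iota> (replicate n (Y k))) (L_prod M \<phi> \<iota> (replicate n X))"
  by (induction n) (simp_all add: dyadic_tendsto_const dyadic_tendsto_mult L_dyadic_iota)

lemma tendsto_moment_replicate:
  assumes "dyadic_tendsto Y X"
  shows "(\<lambda>k. moment M \<phi> \<iota> (replicate n (Y k))) \<longlonglongrightarrow> moment M \<phi> \<iota> (replicate n X)"
proof -
  let ?P = "\<lambda>Z. L_prod M \<phi> \<iota> (replicate n Z)"
  have P: "?P (Y k) \<in> L_dyadic" "?P X \<in> L_dyadic" "(\<lambda>k. Ldnorm 0 (?P (Y k) - ?P X)) \<longlonglongrightarrow> 0" for k
    using dyadic_tendsto_L_prod_replicate[OF assms, of n] by (auto simp: dyadic_tendsto_def)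
  have "(\<lambda>k. L_state M \<phi> \<iota> (?P (Y k)) - L_state M \<phi> \<iota> (?P X)) \<longlonglongrightarrow> 0"
  proof (rule Lim_null_comparison[OF always_eventually P(3)], rule allI)
    fix k
    have "L_state M \<phi> \<iota> (?P (Y k)) - L_state M \<phi> \<iota> (?P X) = L_state M \<phi> \<iota> (?P (Y k) - ?P X)"
      using L_state_add[of "?P (Y k) - ?P X" "?P X"] P(1,2) by (simp add: L_dyadic_diff)
    then show "norm (L_state M \<phi> \<iota> (?P (Y k)) - L_state M \<phi> \<iota> (?P X)) \<le> Ldnorm 0 (?P (Y k) - ?P X)"
      using cmod_L_state_le P(1,2) by (simp add: L_dyadic_diff)
  qed
  then show ?thesis unfolding moment_def by (simp add: LIM_zero_iff)
qed

lemma moment_replicate_zero: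
  assumes "n \<ge> 1"
  shows "moment M \<phi> \<iota> (replicate n 0) = 0"
proof -
  obtain k where "n = Suc k" using assms by (cases n) auto
  moreover have "L_prod M \<phi> \<iota> (replicate k 0) \<in> L_dyadic"
    by (rule L_prod_in_L_dyadic) (auto intro: L_dyadic_zero)
  ultimately show ?thesis by (simp add: moment_def L_mult_zero_left L_state_zero)
qed

end

section \<open>Grids of intervals of equal length\<close>

lemma interval_eq_iff: "s < t \<Longrightarrow> u < v \<Longrightarrow> {s..<t} = {u..<v} \<longleftrightarrow> s = u \<and> t = (v::real)"
  by (auto simp: atLeastLessThan_eq_iff)

lemma shift_interval: "shift {s..<t} u = {s + u..<t + u}"
  by (simp add: shift_def)

lemma interval_less_grid:
  fixes t :: real and i j :: nat
  assumes "t > 0"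
  shows "interval_less {real i * t..<(real i + 1) * t} {real j * t..<(real j + 1) * t} \<longleftrightarrow> i < j"
proof
  have "real i * t \<in> {real i * t..<(real i + 1) * t}" "real j * t \<in> {real j * t..<(real j + 1) * t}"
    using assms by (auto simp: algebra_simps)
  then show "i < j" if "interval_less {real i * t..<(real i + 1) * t} {real j * t..<(real j + 1) * t}"
    using that assms unfolding interval_less_def by (metis mult_less_cancel_right_pos of_nat_less_iff)
  show "interval_less {real i * t..<(real i + 1) * t} {real j * t..<(real j + 1) * t}" if "i < j"
  proof -
    have "(real i + 1) * t \<le> real j * t" using that assms by (intro mult_right_mono) auto
    then show ?thesis unfolding interval_less_def by auto
  qed
qed

text \<open>An increasing renaming of grid cells is a family of admissible shifts: equal cells are
  moved equally, and the order of distinct cells is kept because \<open>e\<close> is increasing on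
  the values which occur.\<close>

lemma order_invariant_grid:
  fixes \<iota> :: "'h::complex_hilbert op \<Rightarrow> 'l::complex_banach"
  assumes inv: "order_invariant M \<phi> \<iota> B" and "t > 0" and js: "js \<noteq> []" and e: "strict_mono_on (set js) e"
  shows "moment M \<phi> \<iota> (map (\<lambda>k. B {real k * t..<(real k + 1) * t}) (map e js)) =
    moment M \<phi> \<iota> (map (\<lambda>k. B {real k * t..<(real k + 1) * t}) js)"
proof -
  define n where "n = length js"
  define J where "J i = {real i * t..<(real i + 1) * t}" for i :: nat
  define I where "I k = J (js ! (k - 1))" for k :: nat
  \<comment> \<open>The shift that carries cell \<open>js ! (k - 1)\<close> to cell
    \<open>e (js ! (k - 1))\<close>. Factors are numbered from 1, list positions from 0.\<close>
  define T where "T k = (real (e (js ! (k - 1))) - real (js ! (k - 1))) * t" for k :: nat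
  have shift: "shift (I k) (T k) = J (e (js ! (k - 1)))" for k
    by (simp add: I_def T_def J_def shift_interval algebra_simps)
  have J_less: "i < j \<longleftrightarrow> interval_less (J i) (J j)" for i j
    using interval_less_grid[OF \<open>t > 0\<close>] by (simp add: J_def)
  have J_disj: "J i \<inter> J j = {}" if "i < j" for i j
    using that J_less[of i j] by (force simp: interval_less_def)
  have J_eq: "J i = J j \<longleftrightarrow> i = j" for i j
    using \<open>t > 0\<close> by (auto simp: J_def interval_eq_iff)
  have "moment M \<phi> \<iota> (map (\<lambda>k. B (I k)) [1..<Suc n]) =
      moment M \<phi> \<iota> (map (\<lambda>k. B (shift (I k) (T k))) [1..<Suc n])"
  proof (rule inv[unfolded order_invariant_def, rule_format])
    show "1 \<le> n" using js by (simp add: n_def Suc_le_eq)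
    show "I k \<in> intervals" for k
    proof -
      have "real (js ! (k - 1)) * t < (real (js ! (k - 1)) + 1) * t" using \<open>t > 0\<close> by simp
      then show ?thesis unfolding I_def J_def intervals_def by blast
    qed
    show "I k = I l \<or> I k \<inter> I l = {}" for k l
      using J_disj unfolding I_def by (metis Int_commute nat_neq_iff)
    fix k l assume kl: "k \<in> {1..n}" "l \<in> {1..n}"
    show "(I k = I l \<longrightarrow> T k = T l) \<and>
        (interval_less (I k) (I l) \<longrightarrow> interval_less (shift (I k) (T k)) (shift (I l) (T l)))"
    proof (intro conjI impI)
      show "T k = T l" if "I k = I l" using that by (simp add: I_def J_eq T_def)
      show "interval_less (shift (I k) (T k)) (shift (I l) (T l))" if "interval_less (I k) (I l)"
      proof -
        have "js ! (k - 1) < js ! (l - 1)" using that by (simp add: I_def J_less)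
        then show ?thesis
          unfolding shift J_less[symmetric] using kl by (intro strict_mono_onD[OF e] nth_mem) (auto simp: n_def)
      qed
    qed
  qed
  moreover have "map (\<lambda>k. B (I k)) [1..<Suc n] = map (\<lambda>k. B (J k)) js"
    by (rule nth_equalityI) (auto simp: n_def I_def simp del: upt_Suc)
  moreover have "map (\<lambda>k. B (shift (I k) (T k))) [1..<Suc n] = map (\<lambda>k. B (J k)) (map e js)"
    by (rule nth_equalityI) (auto simp: n_def shift simp del: upt_Suc)
  ultimately show ?thesis by (simp add: J_def)
qed

locale levy_flow = tracial_L1 M \<phi> \<iota>
  for M :: "'h::complex_hilbert op set" and \<phi> and \<iota> :: "'h op \<Rightarrow> 'l::complex_banach" +
  fixes A :: "real set \<Rightarrow> 'h op set" and B :: "real set \<Rightarrow> 'l"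
  assumes flow: "flow M \<phi> A \<iota> B"
begin

lemma B_in_L_dyadic: "s < t \<Longrightarrow> B {s..<t} \<in> L_dyadic"
  using flow L_inf_minus_subset unfolding flow_def intervals_def by blast

lemma levy_process_multiple:
  assumes "t > 0"
  shows "levy_process B (real m * t) = (\<Sum>k<m. B {real k * t..<(real k + 1) * t})"
proof (induction m)
  case (Suc m)
  show ?case
  \<comment> \<open>Additivity of a flow is available only for nondegenerate intervals, so the first
    cell cannot be split off from an empty one.\<close>
  proof (cases "m = 0")
    case False
    then have "0 < real m * t" "real m * t < (real m + 1) * t" using assms by (auto simp: algebra_simps)
    then have "B {0..<(real m + 1) * t} = B {0..<real m * t} + B {real m * t..<(real m + 1) * t}"
      using flow unfolding flow_def by blast
    then show ?thesis
      using Suc.IH False assms by (simp add: levy_process_def add.commute)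
  qed (use assms in \<open>simp add: levy_process_def\<close>)
qed (simp add: levy_process_def)

text \<open>The sums \<open>G r\<close> depend on the length \<open>t\<close> of the cells but not
  on their number \<open>m\<close>, which enters only through \<open>m choose r\<close>.\<close>

lemma moment_polynomial_on_multiples:
  assumes "order_invariant M \<phi> \<iota> B" "t > 0" "n \<ge> 1"
  shows "\<exists>p. degree p \<le> n \<and>
    (\<forall>m::nat. poly p (of_nat m) = moment M \<phi> \<iota> (replicate n (levy_process B (real m * t))))"
proof -
  define F where "F js = moment M \<phi> \<iota> (map (\<lambda>k. B {real k * t..<(real k + 1) * t}) js)" for js
  define G where "G r = (\<Sum>js | set js = {..<r} \<and> length js = n. F js)" for r
  have "\<exists>q :: complex poly. degree q \<le> r \<and> (\<forall>m. poly q (of_nat m) = of_nat (m choose r))" for r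
    using binomial_polynomial by metis
  then obtain q :: "nat \<Rightarrow> complex poly" where q: "\<And>r. degree (q r) \<le> r"
      "\<And>r m. poly (q r) (of_nat m) = of_nat (m choose r)"
    by metis
  define p where "p = (\<Sum>r\<le>n. smult (G r) (q r))"
  have "degree p \<le> n"
    unfolding p_def by (intro degree_sum_le) (auto intro: order_trans[OF degree_smult_le] order_trans[OF q(1)])
  moreover have "poly p (of_nat m) = moment M \<phi> \<iota> (replicate n (levy_process B (real m * t)))" for m
  proof -
    have "moment M \<phi> \<iota> (replicate n (levy_process B (real m * t))) =
        (\<Sum>js | set js \<subseteq> {..<m} \<and> length js = n. F js)"
      unfolding levy_process_multiple[OF \<open>t > 0\<close>] F_def
      by (intro moment_replicate_sum B_in_L_dyadic) (use \<open>t > 0\<close> in \<open>simp add: algebra_simps\<close>)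
    also have "\<dots> = (\<Sum>r\<le>n. of_nat (m choose r) * G r)"
      unfolding G_def
    proof (rule sum_lists_eq_binomial_sum)
      fix js :: "nat list" and e :: "nat \<Rightarrow> nat"
      assume "length js = n" "strict_mono_on (set js) e"
      then show "F (map e js) = F js"
        unfolding F_def using assms by (intro order_invariant_grid) auto
    qed
    also have "\<dots> = poly p (of_nat m)"
      by (simp add: p_def poly_sum q(2) mult.commute)
    finally show ?thesis by simp
  qed
  ultimately show ?thesis by blast
qed

text \<open>Joint continuity of the flow with left endpoint 0 held fixed. Its limit is punctured,
  hence \<open>u k \<noteq> t\<close>; positivity keeps the intervals nondegenerate.\<close>

lemma dyadic_tendsto_levy_process:
  assumes "t > 0" and u: "u \<longlonglongrightarrow> t" "\<And>k. u k > 0 \<and> u k \<noteq> t"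
  shows "dyadic_tendsto (\<lambda>k. levy_process B (u k)) (levy_process B t)"
proof -
  have "(\<lambda>k. Ldnorm j (levy_process B (u k) - levy_process B t)) \<longlonglongrightarrow> 0" for j
  proof -
    let ?f = "\<lambda>(s', t'). Ldnorm j (B {s'..<t'} - B {0..<t})"
    have "(1::real) \<le> 2 ^ Suc j" by (rule one_le_power) simp
    then have "(?f \<longlongrightarrow> 0) (at (0, t) within {(s', t'). s' < t'})"
      using flow assms(1) unfolding flow_def Ldnorm_def by blast
    moreover have "filterlim (\<lambda>k. (0, u k)) (at (0, t) within {(s', t'). s' < t'}) sequentially"
      using u unfolding filterlim_at by (auto intro!: tendsto_Pair always_eventually)
    ultimately have "(\<lambda>k. ?f (0, u k)) \<longlonglongrightarrow> 0" by (rule filterlim_compose)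
    moreover have "levy_process B (u k) = B {0..<u k}" "levy_process B t = B {0..<t}" for k
      using u(2)[of k] assms(1) by (auto simp: levy_process_def)
    ultimately show ?thesis by simp
  qed
  moreover have "levy_process B s \<in> L_dyadic" if "s > 0" for s
    using that by (simp add: levy_process_def B_in_L_dyadic)
  ultimately show ?thesis using assms by (simp add: dyadic_tendsto_def)
qed

lemma moment_polynomial:
  assumes "order_invariant M \<phi> \<iota> B" "n \<ge> 1"
  shows "\<exists>p. degree p \<le> n \<and>
    (\<forall>t\<ge>0. moment M \<phi> \<iota> (replicate n (levy_process B t)) = poly p (of_real t))"
proof (rule polynomial_if_polynomial_on_multiples)
  show "(\<lambda>k. moment M \<phi> \<iota> (replicate n (levy_process B (u k)))) \<longlonglongrightarrow>
      moment M \<phi> \<iota> (replicate n (levy_process B t))"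
    if "t > 0" "u \<longlonglongrightarrow> t" "\<And>k. u k > 0 \<and> u k \<noteq> t" for t u
    by (rule tendsto_moment_replicate[OF dyadic_tendsto_levy_process[OF that]])
qed (rule moment_polynomial_on_multiples[OF assms(1) _ assms(2)])

end

theorem theorem4p10:
  fixes M :: "'h::complex_hilbert op set"
    and \<phi> :: "'h op \<Rightarrow> complex"
    and A :: "real set \<Rightarrow> 'h op set"
    and \<iota> :: "'h op \<Rightarrow> 'l::complex_banach"
    and B :: "real set \<Rightarrow> 'l"
  assumes "continuous_bernoulli_system M \<phi> A"
    and "L1_embedding M \<phi> \<iota>"
    and "flow M \<phi> A \<iota> B"
    and "stationary M \<phi> \<iota> B"
    and "order_invariant M \<phi> \<iota> B"
  shows "\<exists>c :: nat list set \<Rightarrow> complex. \<forall>n\<ge>1. \<forall>t\<ge>0.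
    moment M \<phi> \<iota> (replicate n (levy_process B t)) =
      (\<Sum>\<sigma>\<in>order_classes n. 1 / fact (num_values \<sigma>) * c \<sigma> * of_real t ^ num_values \<sigma>)"
proof -
  interpret levy_flow M \<phi> \<iota> A B
    using assms by unfold_locales (auto simp: continuous_bernoulli_system_def)
  obtain p where p: "\<And>n. n \<ge> 1 \<Longrightarrow> degree (p n) \<le> n"
      "\<And>n t. n \<ge> 1 \<Longrightarrow> t \<ge> 0 \<Longrightarrow> moment M \<phi> \<iota> (replicate n (levy_process B t)) = poly (p n) (of_real t)"
    using moment_polynomial[OF assms(5)] by metis
  \<comment> \<open>At \<open>t = 0\<close> the process is 0 by definition, so the moment and with
    it the constant term vanish.\<close>
  have "poly (p n) 0 = 0" if "n \<ge> 1" for n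
    using p(2)[OF that, of 0] moment_replicate_zero[OF that] by (simp add: levy_process_def)
  then obtain c where "\<forall>n\<ge>1. \<forall>x. poly (p n) x =
      (\<Sum>\<sigma>\<in>order_classes n. 1 / fact (num_values \<sigma>) * c \<sigma> * x ^ num_values \<sigma>)"
    using polynomials_as_order_class_sums[of p] p(1) by blast
  then show ?thesis using p(2) by (intro exI[of _ c]) simp
qed

end
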